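(* Let $\Lambda$ be a rank $r$ graph satisfying condition (F). Let $(\overline{\mathbb{N}}^r,S)$ be the shift system $S_k(n)=n-k$, $\mathrm{dom}(S_k)=\{n\in\overline{\mathbb{N}}^r:n\ge k\}$, and let $(\Lambda^\infty,W)$ be the shift system $W_k(y)(n,n')=y(n+k,n'+k)$ ($k\in\mathbb{N}^r$). Let $(Z,(T,V))$ be the dynamical system with $Z=\{(x,y)\in X\times\Lambda^\infty:s(x)=t(y)\}$, $T_m(x,y)=(x',x''y)$ for $x=x'x''$, $\sigma(x'')=m$, and $V_m(x,y)=(L_m(x\,y(0,m)),L_m(y))$. Then the continuous map $\phi:Z\to\overline{\mathbb{N}}^r\times\Lambda^\infty$ which extends $(x,y)\mapsto(\sigma(x),xy)$, $x\in\overline{\Lambda}$, is an equivariant map from $(Z,(T,V))$ to $(\overline{\mathbb{N}}^r\times\Lambda^\infty,S\times W)$; that is, $\phi\circ T_k=(S_k\times\mathrm{id})\circ\phi$ and $\phi\circ V_k=(\mathrm{id}\times W_k)\circ\phi$ as partial maps, for all $k\in\mathbb{N}^r$.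
   Context: Graphs. A rank $r$ graph $(\Lambda,\sigma)$ is a small category (source $s$, terminus $t$; $\lambda\mu$ defined when $s(\lambda)=t(\mu)$) with a functor $\sigma:\Lambda\to\mathbb{N}^r$ (shape) having unique factorization: if $\sigma(\lambda)=m+n$ there are unique $\mu,\nu$ with $\lambda=\mu\nu$, $\sigma(\mu)=m$, $\sigma(\nu)=n$. Condition (F): for every $n\in\mathbb{N}^r$, $\{\lambda:\sigma(\lambda)=n\}$ is nonempty and finite, and for every object $v$ there are finitely many, and at least one, morphisms of shape $n$ with source $v$, and likewise with terminus $v$. $\overline{\mathbb{N}}=\mathbb{N}\cup\{\infty\}$ (one-point compactification), $\infty-k=\infty$. The space $X$. $\Lambda^*$ is the set of morphisms of nonzero shape; $\overline{\Lambda}=\{\Omega\}\cup\Lambda^*$ where $\Omega\notin\Lambda^*$ is a symbol with $\sigma(\Omega)=0$. On $\ell^2(\overline{\Lambda})$ (basis $\delta_\mu$, $\delta_\Omega=\Omega$), for $\lambda\in\Lambda^*$: $L_\lambda\delta_\mu=\delta_{\lambda\mu}$ if $s(\lambda)=t(\mu)$, $0$ otherwise; $R_\lambda\delta_\mu=\delta_{\mu\lambda}$ if $s(\mu)=t(\lambda)$, $0$ otherwise; $L_\lambda\Omega=R_\lambda\Omega=\delta_\lambda$. $\mathcal{E}=C^*(L_\lambda,R_\lambda;\lambda\in\Lambda^* )$ and $X$ is the Gelfand spectrum of $\mathcal{E}\cap\ell^\infty(\overline{\Lambda})$ ($\ell^\infty(\overline{\Lambda})$ = diagonal operators). $\overline{\Lambda}$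 is an open dense discrete subset of $X$. By Gelfand duality $f\mapsto L_\lambda fL_\lambda^*$ and $f\mapsto R_\lambda fR_\lambda^*$ give homeomorphisms $l_\lambda$, $r_\lambda$ between clopen subsets of $X$ extending $\mu\mapsto\lambda\mu$, $\mu\mapsto\mu\lambda$ on $\overline{\Lambda}$ (with $\lambda\Omega=\Omega\lambda=\lambda$); write $\lambda x=l_\lambda(x)$, $x\lambda=r_\lambda(x)$, and $\Omega x=x\Omega=x$. The shape extends to a continuous map $\sigma:X\to\overline{\mathbb{N}}^r$, and $s,t$ extend continuously from $\Lambda^*$ to $X\setminus\{\Omega\}$; by convention $\Omega$ is composable with everything, so $(\Omega,y)\in Z$ for all $y\in\Lambda^\infty$. For $x\in X$ with $\sigma(x)\ge m$ there are unique factorizations $x=\lambda x_1=x_2\mu$ with $\lambda,\mu\in\overline{\Lambda}$, $\sigma(\lambda)=\sigma(\mu)=m$, $x_1,x_2\in X$; define $L_mx=x_1$. In the definition of $T_m$, $x=x'x''$ is this right factorization with $x''\in\overline{\Lambda}$, $\sigma(x'')=m$; so $\mathrm{dom}(T_m)=\{(x,y)\in Z:\sigma(x)\ge m\}$, while $\mathrm{dom}(V_m)=Z$. Infinite paths. $\Lambda^\infty$ is the set of shape-preserving functors $y$ from the rank $r$ graph $\{(n,n')\in\mathbb{N}^r\times\mathbb{N}^r:n\le n'\}$ (with $t(n,n')=n$, $s(n,n')=n'$, $(n,k)(k,p)=(n,p)$, shape $n'-n$) to $\Lambda$, topologized by the cylinder sets $\{y:y(0,k)=\lambda\}$; $t(y)=y(0,0)$;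 $L_m(y)(n,n')=y(n+m,n'+m)$; $\lambda y$ is concatenation, $\Omega y=y$; when $m=0$, $x\,y(0,0)$ is understood as $x$. Partial maps are composed on natural domains: $\mathrm{dom}(AB)=\{x\in\mathrm{dom}(B):B(x)\in\mathrm{dom}(A)\}$. An equivariant map between two dynamical systems $(X_1,A)$, $(X_2,B)$ given by actions of the same semigroup $\mathbb{N}^q$ by partial local homeomorphisms is a map $\phi:X_1\to X_2$ with $\phi\circ A_m=B_m\circ\phi$ for all $m$ (equality of partial maps). $S\times W$ is the action of $\mathbb{N}^r\times\mathbb{N}^r$ on $\overline{\mathbb{N}}^r\times\Lambda^\infty$ by $S_k\times W_{k'}$. *)

theory Defs
  imports "HOL-Analysis.Analysis"
begin

section \<open>Higher rank graphs\<close>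

text \<open>
  A small category with object set \<open>obj\<close> and morphism set \<open>mor\<close>, together with a shape map.
  The rank is the cardinality of the index type \<open>'r\<close>.  The composite \<open>cmp \<Lambda> a b\<close> is meaningful
  only when \<open>src \<Lambda> a = tgt \<Lambda> b\<close>.
\<close>

record ('o, 'm, 'r) rgraph =
  obj :: "'o set"
  mor :: "'m set"
  src :: "'m \<Rightarrow> 'o"
  tgt :: "'m \<Rightarrow> 'o"
  ident :: "'o \<Rightarrow> 'm"
  cmp :: "'m \<Rightarrow> 'm \<Rightarrow> 'm"
  shape :: "'m \<Rightarrow> nat ^ 'r"

definition small_category :: "('o, 'm, 'r::finite) rgraph \<Rightarrow> bool" where
  "small_category \<Lambda> \<longleftrightarrow>
     (\<forall>a\<in>mor \<Lambda>. src \<Lambda> a \<in> obj \<Lambda> \<and> tgt \<Lambda> a \<in> obj \<Lambda>) \<and>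
     (\<forall>v\<in>obj \<Lambda>. ident \<Lambda> v \<in> mor \<Lambda> \<and> src \<Lambda> (ident \<Lambda> v) = v \<and> tgt \<Lambda> (ident \<Lambda> v) = v) \<and>
     (\<forall>a\<in>mor \<Lambda>. \<forall>b\<in>mor \<Lambda>. src \<Lambda> a = tgt \<Lambda> b \<longrightarrow>
        cmp \<Lambda> a b \<in> mor \<Lambda> \<and> src \<Lambda> (cmp \<Lambda> a b) = src \<Lambda> b \<and> tgt \<Lambda> (cmp \<Lambda> a b) = tgt \<Lambda> a) \<and>
     (\<forall>a\<in>mor \<Lambda>. \<forall>b\<in>mor \<Lambda>. \<forall>c\<in>mor \<Lambda>. src \<Lambda> a = tgt \<Lambda> b \<and> src \<Lambda> b = tgt \<Lambda> c \<longrightarrow>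
        cmp \<Lambda> (cmp \<Lambda> a b) c = cmp \<Lambda> a (cmp \<Lambda> b c)) \<and>
     (\<forall>a\<in>mor \<Lambda>. cmp \<Lambda> (ident \<Lambda> (tgt \<Lambda> a)) a = a \<and> cmp \<Lambda> a (ident \<Lambda> (src \<Lambda> a)) = a)"

definition rank_graph :: "('o, 'm, 'r::finite) rgraph \<Rightarrow> bool" where
  "rank_graph \<Lambda> \<longleftrightarrow> small_category \<Lambda> \<and>
     (\<forall>v\<in>obj \<Lambda>. shape \<Lambda> (ident \<Lambda> v) = 0) \<and>
     (\<forall>a\<in>mor \<Lambda>. \<forall>b\<in>mor \<Lambda>. src \<Lambda> a = tgt \<Lambda> b \<longrightarrow>
        shape \<Lambda> (cmp \<Lambda> a b) = shape \<Lambda> a + shape \<Lambda> b) \<and>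
     (\<forall>a\<in>mor \<Lambda>. \<forall>m n. shape \<Lambda> a = m + n \<longrightarrow>
        (\<exists>!(b, c). b \<in> mor \<Lambda> \<and> c \<in> mor \<Lambda> \<and> src \<Lambda> b = tgt \<Lambda> c \<and> a = cmp \<Lambda> b c \<and>
                   shape \<Lambda> b = m \<and> shape \<Lambda> c = n))"

definition condition_F :: "('o, 'm, 'r::finite) rgraph \<Rightarrow> bool" where
  "condition_F \<Lambda> \<longleftrightarrow>
     (\<forall>n. {a \<in> mor \<Lambda>. shape \<Lambda> a = n} \<noteq> {} \<and> finite {a \<in> mor \<Lambda>. shape \<Lambda> a = n}) \<and>
     (\<forall>n. \<forall>v\<in>obj \<Lambda>.
        {a \<in> mor \<Lambda>. shape \<Lambda> a = n \<and> src \<Lambda> a = v} \<noteq> {} \<and>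
        finite {a \<in> mor \<Lambda>. shape \<Lambda> a = n \<and> src \<Lambda> a = v} \<and>
        {a \<in> mor \<Lambda>. shape \<Lambda> a = n \<and> tgt \<Lambda> a = v} \<noteq> {} \<and>
        finite {a \<in> mor \<Lambda>. shape \<Lambda> a = n \<and> tgt \<Lambda> a = v})"

definition mor_star :: "('o, 'm, 'r::finite) rgraph \<Rightarrow> 'm set" where
  "mor_star \<Lambda> = {a \<in> mor \<Lambda>. shape \<Lambda> a \<noteq> 0}"

text \<open>
  The set \<open>{\<Omega>} \<union> \<Lambda>\<^sup>*\<close> is encoded in \<open>'m option\<close>, with \<open>\<Omega>\<close> represented by \<open>None\<close>.
  \<open>\<Omega>\<close> is composable with everything and acts as a unit.
\<close>

definition mor_bar :: "('o, 'm, 'r::finite) rgraph \<Rightarrow> 'm option set" where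
  "mor_bar \<Lambda> = insert None (Some ` mor_star \<Lambda>)"

fun shape_bar :: "('o, 'm, 'r::finite) rgraph \<Rightarrow> 'm option \<Rightarrow> nat ^ 'r" where
  "shape_bar \<Lambda> None = 0"
| "shape_bar \<Lambda> (Some a) = shape \<Lambda> a"

fun composable_bar :: "('o, 'm, 'r::finite) rgraph \<Rightarrow> 'm option \<Rightarrow> 'm option \<Rightarrow> bool" where
  "composable_bar \<Lambda> (Some a) (Some b) \<longleftrightarrow> src \<Lambda> a = tgt \<Lambda> b"
| "composable_bar \<Lambda> _ _ \<longleftrightarrow> True"

fun cmp_bar :: "('o, 'm, 'r::finite) rgraph \<Rightarrow> 'm option \<Rightarrow> 'm option \<Rightarrow> 'm option" where
  "cmp_bar \<Lambda> None b = b"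
| "cmp_bar \<Lambda> a None = a"
| "cmp_bar \<Lambda> (Some a) (Some b) = Some (cmp \<Lambda> a b)"

text \<open>Morphisms of shape \<open>0\<close> (objects) act on the elements of \<open>\<Lambda>\<^sup>*\<close> like \<open>\<Omega>\<close>.\<close>

definition to_bar :: "('o, 'm, 'r::finite) rgraph \<Rightarrow> 'm \<Rightarrow> 'm option" where
  "to_bar \<Lambda> a = (if shape \<Lambda> a = 0 then None else Some a)"


section \<open>Operators on the Hilbert space of square summable functions\<close>

text \<open>
  The Hilbert space over an index set \<open>A\<close> consists of functions vanishing off \<open>A\<close>.  Bounded operators are
  functions that are \<open>0\<close> outside the Hilbert space, so that equality of operators is equality
  of functions.
\<close>

type_synonym 'b op = "('b \<Rightarrow> complex) \<Rightarrow> ('b \<Rightarrow> complex)"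

definition ell2 :: "'b set \<Rightarrow> ('b \<Rightarrow> complex) set" where
  "ell2 A = {\<xi>. (\<forall>a. a \<notin> A \<longrightarrow> \<xi> a = 0) \<and> (\<lambda>a. (cmod (\<xi> a))\<^sup>2) summable_on A}"

definition ell2_inner :: "'b set \<Rightarrow> ('b \<Rightarrow> complex) \<Rightarrow> ('b \<Rightarrow> complex) \<Rightarrow> complex" where
  "ell2_inner A \<xi> \<eta> = (\<Sum>\<^sub>\<infinity>a\<in>A. \<xi> a * cnj (\<eta> a))"

definition ell2_norm :: "'b set \<Rightarrow> ('b \<Rightarrow> complex) \<Rightarrow> real" where
  "ell2_norm A \<xi> = sqrt (\<Sum>\<^sub>\<infinity>a\<in>A. (cmod (\<xi> a))\<^sup>2)"

definition ket :: "'b \<Rightarrow> 'b \<Rightarrow> complex" where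
  "ket a = (\<lambda>b. if b = a then 1 else 0)"

definition bounded_ops :: "'b set \<Rightarrow> 'b op set" where
  "bounded_ops A = {T.
     (\<forall>\<xi>. \<xi> \<notin> ell2 A \<longrightarrow> T \<xi> = (\<lambda>a. 0)) \<and>
     (\<forall>\<xi>\<in>ell2 A. T \<xi> \<in> ell2 A) \<and>
     (\<forall>\<xi>\<in>ell2 A. \<forall>\<eta>\<in>ell2 A. T (\<lambda>a. \<xi> a + \<eta> a) = (\<lambda>a. T \<xi> a + T \<eta> a)) \<and>
     (\<forall>c. \<forall>\<xi>\<in>ell2 A. T (\<lambda>a. c * \<xi> a) = (\<lambda>a. c * T \<xi> a)) \<and>
     (\<exists>C. \<forall>\<xi>\<in>ell2 A. ell2_norm A (T \<xi>) \<le> C * ell2_norm A \<xi>)}"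

definition op_norm :: "'b set \<Rightarrow> 'b op \<Rightarrow> real" where
  "op_norm A T = (SUP \<xi>\<in>{\<xi> \<in> ell2 A. ell2_norm A \<xi> \<le> 1}. ell2_norm A (T \<xi>))"

definition op_add :: "'b op \<Rightarrow> 'b op \<Rightarrow> 'b op" where
  "op_add S T = (\<lambda>\<xi> a. S \<xi> a + T \<xi> a)"

definition op_scale :: "complex \<Rightarrow> 'b op \<Rightarrow> 'b op" where
  "op_scale c T = (\<lambda>\<xi> a. c * T \<xi> a)"

definition is_adjoint :: "'b set \<Rightarrow> 'b op \<Rightarrow> 'b op \<Rightarrow> bool" where
  "is_adjoint A T S \<longleftrightarrow> S \<in> bounded_ops A \<and>
     (\<forall>\<xi>\<in>ell2 A. \<forall>\<eta>\<in>ell2 A. ell2_inner A (T \<xi>) \<eta> = ell2_inner A \<xi> (S \<eta>))"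

definition op_adj :: "'b set \<Rightarrow> 'b op \<Rightarrow> 'b op" where
  "op_adj A T = (THE S. is_adjoint A T S)"

text \<open>The C*-algebra of operators on \<open>ell2 A\<close> generated by a set \<open>G\<close> of bounded operators.\<close>

inductive_set cstar_gen :: "'b set \<Rightarrow> 'b op set \<Rightarrow> 'b op set"
  for A :: "'b set" and G :: "'b op set" where
  gen: "T \<in> G \<Longrightarrow> T \<in> cstar_gen A G"
| add: "S \<in> cstar_gen A G \<Longrightarrow> T \<in> cstar_gen A G \<Longrightarrow> op_add S T \<in> cstar_gen A G"
| scale: "T \<in> cstar_gen A G \<Longrightarrow> op_scale c T \<in> cstar_gen A G"
| mult: "S \<in> cstar_gen A G \<Longrightarrow> T \<in> cstar_gen A G \<Longrightarrow> S \<circ> T \<in> cstar_gen A G"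
| adj: "T \<in> cstar_gen A G \<Longrightarrow> is_adjoint A T S \<Longrightarrow> S \<in> cstar_gen A G"
| lim: "(\<And>n::nat. T n \<in> cstar_gen A G) \<Longrightarrow> T' \<in> bounded_ops A \<Longrightarrow>
        (\<lambda>n. op_norm A (op_add (T n) (op_scale (-1) T'))) \<longlonglongrightarrow> 0 \<Longrightarrow> T' \<in> cstar_gen A G"

definition diagonal_op :: "'b set \<Rightarrow> ('b \<Rightarrow> complex) \<Rightarrow> 'b op" where
  "diagonal_op A f = (\<lambda>\<xi>. if \<xi> \<in> ell2 A then (\<lambda>a. f a * \<xi> a) else (\<lambda>a. 0))"

definition diagonal_ops :: "'b set \<Rightarrow> 'b op set" where
  "diagonal_ops A = {diagonal_op A f |f. bounded (f ` A)}"

text \<open>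
  The Gelfand spectrum of an algebra \<open>D\<close> of operators: its characters with the topology of
  pointwise convergence on \<open>D\<close>.  Characters are \<open>undefined\<close> off \<open>D\<close>.
\<close>

definition characters :: "'b op set \<Rightarrow> ('b op \<Rightarrow> complex) set" where
  "characters D = {\<omega> \<in> extensional D.
     (\<forall>S\<in>D. \<forall>T\<in>D. \<omega> (op_add S T) = \<omega> S + \<omega> T) \<and>
     (\<forall>c. \<forall>T\<in>D. \<omega> (op_scale c T) = c * \<omega> T) \<and>
     (\<forall>S\<in>D. \<forall>T\<in>D. \<omega> (S \<circ> T) = \<omega> S * \<omega> T) \<and>
     (\<exists>T\<in>D. \<omega> T \<noteq> 0)}"

definition gelfand_spectrum :: "'b op set \<Rightarrow> ('b op \<Rightarrow> complex) topology" where
  "gelfand_spectrum D = subtopology (product_topology (\<lambda>T. euclidean) D) (characters D)"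


section \<open>The space \<open>X\<close>\<close>

text \<open>By unique factorization, each of the sums below has at most one term.\<close>

definition L_op :: "('o, 'm, 'r::finite) rgraph \<Rightarrow> 'm \<Rightarrow> 'm option op" where
  "L_op \<Lambda> l = (\<lambda>\<xi>. if \<xi> \<in> ell2 (mor_bar \<Lambda>)
     then (\<lambda>\<nu>. \<Sum>\<mu> | \<mu> \<in> mor_bar \<Lambda> \<and> composable_bar \<Lambda> (Some l) \<mu> \<and> cmp_bar \<Lambda> (Some l) \<mu> = \<nu>. \<xi> \<mu>)
     else (\<lambda>\<nu>. 0))"

definition R_op :: "('o, 'm, 'r::finite) rgraph \<Rightarrow> 'm \<Rightarrow> 'm option op" where
  "R_op \<Lambda> l = (\<lambda>\<xi>. if \<xi> \<in> ell2 (mor_bar \<Lambda>)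
     then (\<lambda>\<nu>. \<Sum>\<mu> | \<mu> \<in> mor_bar \<Lambda> \<and> composable_bar \<Lambda> \<mu> (Some l) \<and> cmp_bar \<Lambda> \<mu> (Some l) = \<nu>. \<xi> \<mu>)
     else (\<lambda>\<nu>. 0))"

lemma cmp_shape:
  assumes G: "rank_graph \<Lambda>" and a: "a \<in> mor \<Lambda>" and b: "b \<in> mor \<Lambda>"
    and ab: "src \<Lambda> a = tgt \<Lambda> b"
  shows "cmp \<Lambda> a b \<in> mor \<Lambda> \<and> shape \<Lambda> (cmp \<Lambda> a b) = shape \<Lambda> a + shape \<Lambda> b"
proof -
  have "\<forall>a\<in>mor \<Lambda>. \<forall>b\<in>mor \<Lambda>. src \<Lambda> a = tgt \<Lambda> b \<longrightarrow>
        cmp \<Lambda> a b \<in> mor \<Lambda> \<and> src \<Lambda> (cmp \<Lambda> a b) = src \<Lambda> b \<and> tgt \<Lambda> (cmp \<Lambda> a b) = tgt \<Lambda> a"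
    using G unfolding rank_graph_def small_category_def by (elim conjE)
  moreover have "\<forall>a\<in>mor \<Lambda>. \<forall>b\<in>mor \<Lambda>. src \<Lambda> a = tgt \<Lambda> b \<longrightarrow>
        shape \<Lambda> (cmp \<Lambda> a b) = shape \<Lambda> a + shape \<Lambda> b"
    using G unfolding rank_graph_def by (elim conjE)
  ultimately show ?thesis using a b ab by blast
qed

lemma factorization_unique:
  assumes "rank_graph \<Lambda>" "a \<in> mor \<Lambda>" "b \<in> mor \<Lambda>" "src \<Lambda> a = tgt \<Lambda> b"
    "c \<in> mor \<Lambda>" "d \<in> mor \<Lambda>" "src \<Lambda> c = tgt \<Lambda> d" "cmp \<Lambda> a b = cmp \<Lambda> c d"
    "shape \<Lambda> a = shape \<Lambda> c \<or> shape \<Lambda> b = shape \<Lambda> d"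
  shows "a = c \<and> b = d"
proof -
  have 1: "cmp \<Lambda> a b \<in> mor \<Lambda>" "shape \<Lambda> (cmp \<Lambda> a b) = shape \<Lambda> a + shape \<Lambda> b"
    using cmp_shape[OF assms(1-4)] by blast+
  have "shape \<Lambda> a + shape \<Lambda> b = shape \<Lambda> c + shape \<Lambda> d"
    using cmp_shape[OF assms(1,5,6,7)] unfolding assms(8)[symmetric] 1(2) by blast
  then have 3: "shape \<Lambda> c = shape \<Lambda> a" "shape \<Lambda> d = shape \<Lambda> b"
    using assms(9) by (metis add_left_cancel add_right_cancel)+
  define P where "P = (\<lambda>(b', c'). b' \<in> mor \<Lambda> \<and> c' \<in> mor \<Lambda> \<and> src \<Lambda> b' = tgt \<Lambda> c' \<and>
    cmp \<Lambda> a b = cmp \<Lambda> b' c' \<and> shape \<Lambda> b' = shape \<Lambda> a \<and> shape \<Lambda> c' = shape \<Lambda> b)"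
  have "\<forall>x\<in>mor \<Lambda>. \<forall>m n. shape \<Lambda> x = m + n \<longrightarrow>
        (\<exists>!(b, c). b \<in> mor \<Lambda> \<and> c \<in> mor \<Lambda> \<and> src \<Lambda> b = tgt \<Lambda> c \<and> x = cmp \<Lambda> b c \<and>
                   shape \<Lambda> b = m \<and> shape \<Lambda> c = n)"
    using assms(1) unfolding rank_graph_def by (elim conjE)
  from this[rule_format, OF 1] have "\<exists>!p. P p" unfolding P_def .
  moreover have "P (a, b)" unfolding P_def using assms(2-4) by (intro case_prodI conjI refl)
  moreover have "P (c, d)" unfolding P_def using assms(5-8) 3 by (intro case_prodI conjI)
  ultimately have "(a, b) = (c, d)" by (elim ex1E) metis
  then show ?thesis by simp
qed

lemma cmp_bar_cancel:
  assumes G: "rank_graph \<Lambda>" and l: "l \<in> mor_star \<Lambda>"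
    and \<mu>: "\<mu> \<in> mor_bar \<Lambda>" and \<mu>': "\<mu>' \<in> mor_bar \<Lambda>"
  shows "composable_bar \<Lambda> (Some l) \<mu> \<Longrightarrow> composable_bar \<Lambda> (Some l) \<mu>' \<Longrightarrow>
           cmp_bar \<Lambda> (Some l) \<mu> = cmp_bar \<Lambda> (Some l) \<mu>' \<Longrightarrow> \<mu> = \<mu>'"
    and "composable_bar \<Lambda> \<mu> (Some l) \<Longrightarrow> composable_bar \<Lambda> \<mu>' (Some l) \<Longrightarrow>
           cmp_bar \<Lambda> \<mu> (Some l) = cmp_bar \<Lambda> \<mu>' (Some l) \<Longrightarrow> \<mu> = \<mu>'"
proof -
  have l': "l \<in> mor \<Lambda>" using l by (simp add: mor_star_def)
  have m: "b \<in> mor \<Lambda> \<and> shape \<Lambda> b \<noteq> 0" if "Some b \<in> mor_bar \<Lambda>" for b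
    using that by (auto simp: mor_bar_def mor_star_def)
  have nl: "cmp \<Lambda> l b \<noteq> l" if b: "Some b \<in> mor_bar \<Lambda>" and lb: "src \<Lambda> l = tgt \<Lambda> b" for b
  proof
    assume "cmp \<Lambda> l b = l"
    then have "shape \<Lambda> l + shape \<Lambda> b = shape \<Lambda> l + 0"
      using cmp_shape[OF G l' _ lb] m[OF b] by (metis add_0_right)
    then have "shape \<Lambda> b = 0" by (rule add_left_imp_eq)
    with m[OF b] show False by blast
  qed
  have nr: "cmp \<Lambda> b l \<noteq> l" if b: "Some b \<in> mor_bar \<Lambda>" and bl: "src \<Lambda> b = tgt \<Lambda> l" for b
  proof
    assume "cmp \<Lambda> b l = l"
    then have "shape \<Lambda> b + shape \<Lambda> l = 0 + shape \<Lambda> l"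
      using cmp_shape[OF G _ l' bl] m[OF b] by (metis add_0_left)
    then have "shape \<Lambda> b = 0" by (rule add_right_imp_eq)
    with m[OF b] show False by blast
  qed
  show "\<mu> = \<mu>'" if c: "composable_bar \<Lambda> (Some l) \<mu>" and c': "composable_bar \<Lambda> (Some l) \<mu>'"
    and e: "cmp_bar \<Lambda> (Some l) \<mu> = cmp_bar \<Lambda> (Some l) \<mu>'"
  proof (cases \<mu>; cases \<mu>')
    fix b assume "\<mu> = None" and b: "\<mu>' = Some b"
    with e have "cmp \<Lambda> l b = l" by (metis cmp_bar.simps option.inject)
    moreover have "src \<Lambda> l = tgt \<Lambda> b" using c' b by simp
    ultimately show ?thesis using nl \<mu>' b by blast
  next
    fix b assume b: "\<mu> = Some b" and "\<mu>' = None"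
    with e have "cmp \<Lambda> l b = l" by (metis cmp_bar.simps option.inject)
    moreover have "src \<Lambda> l = tgt \<Lambda> b" using c b by simp
    ultimately show ?thesis using nl \<mu> b by blast
  next
    fix b b' assume b: "\<mu> = Some b" and b': "\<mu>' = Some b'"
    have st: "src \<Lambda> l = tgt \<Lambda> b" "src \<Lambda> l = tgt \<Lambda> b'" using c c' b b' by simp_all
    have eq: "cmp \<Lambda> l b = cmp \<Lambda> l b'" using e b b' by simp
    have "b \<in> mor \<Lambda>" "b' \<in> mor \<Lambda>" using m \<mu> \<mu>' b b' by blast+
    then have "b = b'" using factorization_unique[OF G l' _ st(1) l' _ st(2) eq] by blast
    then show ?thesis using b b' by simp
  qed simp
  show "\<mu> = \<mu>'" if c: "composable_bar \<Lambda> \<mu> (Some l)" and c': "composable_bar \<Lambda> \<mu>' (Some l)"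
    and e: "cmp_bar \<Lambda> \<mu> (Some l) = cmp_bar \<Lambda> \<mu>' (Some l)"
  proof (cases \<mu>; cases \<mu>')
    fix b assume "\<mu> = None" and b: "\<mu>' = Some b"
    with e have "cmp \<Lambda> b l = l" by (metis cmp_bar.simps option.inject)
    moreover have "src \<Lambda> b = tgt \<Lambda> l" using c' b by simp
    ultimately show ?thesis using nr \<mu>' b by blast
  next
    fix b assume b: "\<mu> = Some b" and "\<mu>' = None"
    with e have "cmp \<Lambda> b l = l" by (metis cmp_bar.simps option.inject)
    moreover have "src \<Lambda> b = tgt \<Lambda> l" using c b by simp
    ultimately show ?thesis using nr \<mu> b by blast
  next
    fix b b' assume b: "\<mu> = Some b" and b': "\<mu>' = Some b'"
    have st: "src \<Lambda> b = tgt \<Lambda> l" "src \<Lambda> b' = tgt \<Lambda> l" using c c' b b' by simp_all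
    have eq: "cmp \<Lambda> b l = cmp \<Lambda> b' l" using e b b' by simp
    have "b \<in> mor \<Lambda>" "b' \<in> mor \<Lambda>" using m \<mu> \<mu>' b b' by blast+
    then have "b = b'" using factorization_unique[OF G _ l' st(1) _ l' st(2) eq] by blast
    then show ?thesis using b b' by simp
  qed simp
qed

lemma ket_in_ell2: "a \<in> A \<Longrightarrow> ket a \<in> ell2 A"
proof -
  assume "a \<in> A"
  have "(\<lambda>b. (cmod (ket a b))\<^sup>2) summable_on A \<longleftrightarrow> (\<lambda>b. (cmod (ket a b))\<^sup>2) summable_on {a}"
    using \<open>a \<in> A\<close> by (intro summable_on_cong_neutral) (auto simp: ket_def)
  then show ?thesis using \<open>a \<in> A\<close> by (auto simp: ell2_def ket_def)
qed

text \<open>The action on the orthonormal basis.\<close>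

lemma L_op_ket:
  assumes "rank_graph \<Lambda>" "l \<in> mor_star \<Lambda>" "\<mu> \<in> mor_bar \<Lambda>"
  shows "L_op \<Lambda> l (ket \<mu>) =
    (if composable_bar \<Lambda> (Some l) \<mu> then ket (cmp_bar \<Lambda> (Some l) \<mu>) else (\<lambda>\<nu>. 0))"
proof
  fix \<nu>
  let ?M = "{\<mu>' \<in> mor_bar \<Lambda>. composable_bar \<Lambda> (Some l) \<mu>' \<and> cmp_bar \<Lambda> (Some l) \<mu>' = \<nu>}"
  have fin: "finite ?M"
  proof (cases "?M = {}")
    case False
    then obtain \<rho> where "\<rho> \<in> ?M" by blast
    then have "?M \<subseteq> {\<rho>}" using cmp_bar_cancel(1)[OF assms(1,2)] by auto
    then show ?thesis by (rule finite_subset) simp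
  next
    case True
    show ?thesis unfolding True by simp
  qed
  have "L_op \<Lambda> l (ket \<mu>) \<nu> = (\<Sum>\<mu>'\<in>?M. if \<mu>' = \<mu> then 1 else 0)"
    using ket_in_ell2[OF assms(3)] by (simp add: L_op_def ket_def)
  also have "\<dots> = (if \<mu> \<in> ?M then 1 else 0)" using fin by simp
  finally show "L_op \<Lambda> l (ket \<mu>) \<nu> = (if composable_bar \<Lambda> (Some l) \<mu> then ket (cmp_bar \<Lambda> (Some l) \<mu>) else (\<lambda>\<nu>. 0)) \<nu>"
    using assms(3) by (auto simp: ket_def)
qed

lemma R_op_ket:
  assumes "rank_graph \<Lambda>" "l \<in> mor_star \<Lambda>" "\<mu> \<in> mor_bar \<Lambda>"
  shows "R_op \<Lambda> l (ket \<mu>) =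
    (if composable_bar \<Lambda> \<mu> (Some l) then ket (cmp_bar \<Lambda> \<mu> (Some l)) else (\<lambda>\<nu>. 0))"
proof
  fix \<nu>
  let ?M = "{\<mu>' \<in> mor_bar \<Lambda>. composable_bar \<Lambda> \<mu>' (Some l) \<and> cmp_bar \<Lambda> \<mu>' (Some l) = \<nu>}"
  have fin: "finite ?M"
  proof (cases "?M = {}")
    case False
    then obtain \<rho> where "\<rho> \<in> ?M" by blast
    then have "?M \<subseteq> {\<rho>}" using cmp_bar_cancel(2)[OF assms(1,2)] by auto
    then show ?thesis by (rule finite_subset) simp
  next
    case True
    show ?thesis unfolding True by simp
  qed
  have "R_op \<Lambda> l (ket \<mu>) \<nu> = (\<Sum>\<mu>'\<in>?M. if \<mu>' = \<mu> then 1 else 0)"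
    using ket_in_ell2[OF assms(3)] by (simp add: R_op_def ket_def)
  also have "\<dots> = (if \<mu> \<in> ?M then 1 else 0)" using fin by simp
  finally show "R_op \<Lambda> l (ket \<mu>) \<nu> = (if composable_bar \<Lambda> \<mu> (Some l) then ket (cmp_bar \<Lambda> \<mu> (Some l)) else (\<lambda>\<nu>. 0)) \<nu>"
    using assms(3) by (auto simp: ket_def)
qed

definition E_alg :: "('o, 'm, 'r::finite) rgraph \<Rightarrow> 'm option op set" where
  "E_alg \<Lambda> = cstar_gen (mor_bar \<Lambda>) (L_op \<Lambda> ` mor_star \<Lambda> \<union> R_op \<Lambda> ` mor_star \<Lambda>)"

definition D_alg :: "('o, 'm, 'r::finite) rgraph \<Rightarrow> 'm option op set" where
  "D_alg \<Lambda> = E_alg \<Lambda> \<inter> diagonal_ops (mor_bar \<Lambda>)"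

type_synonym 'm point = "'m option op \<Rightarrow> complex"

definition X_top :: "('o, 'm, 'r::finite) rgraph \<Rightarrow> 'm point topology" where
  "X_top \<Lambda> = gelfand_spectrum (D_alg \<Lambda>)"

abbreviation X_set :: "('o, 'm, 'r::finite) rgraph \<Rightarrow> 'm point set" where
  "X_set \<Lambda> \<equiv> topspace (X_top \<Lambda>)"

text \<open>The embedding of \<open>{\<Omega>} \<union> \<Lambda>\<^sup>*\<close> into \<open>X\<close>: \<open>\<mu>\<close> goes to the \<open>\<mu>\<close>-th diagonal entry.\<close>

definition pt :: "('o, 'm, 'r::finite) rgraph \<Rightarrow> 'm option \<Rightarrow> 'm point" where
  "pt \<Lambda> \<mu> = (\<lambda>T\<in>D_alg \<Lambda>. T (ket \<mu>) \<mu>)"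

text \<open>
  \<open>g\<close> is a continuous map from \<open>X\<close> to \<open>Y\<close> with \<open>g (e i) = f i\<close> on the index set \<open>I\<close>
  (and \<open>undefined\<close> off \<open>X\<close>).
\<close>

definition is_cont_ext ::
  "'a topology \<Rightarrow> 'b topology \<Rightarrow> 'i set \<Rightarrow> ('i \<Rightarrow> 'a) \<Rightarrow> ('i \<Rightarrow> 'b) \<Rightarrow> ('a \<Rightarrow> 'b) \<Rightarrow> bool" where
  "is_cont_ext X Y I e f g \<longleftrightarrow>
     g \<in> extensional (topspace X) \<and> continuous_map X Y g \<and> (\<forall>i\<in>I. g (e i) = f i)"

definition enat_vec :: "nat ^ 'r \<Rightarrow> enat ^ 'r" where
  "enat_vec n = (\<chi> i. enat (n $ i))"

definition shape_X :: "('o, 'm, 'r::finite) rgraph \<Rightarrow> 'm point \<Rightarrow> enat ^ 'r" where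
  "shape_X \<Lambda> = (THE g. is_cont_ext (X_top \<Lambda>) euclidean (mor_bar \<Lambda>) (pt \<Lambda>)
                         (\<lambda>\<mu>. enat_vec (shape_bar \<Lambda> \<mu>)) g)"

definition src_X :: "('o, 'm, 'r::finite) rgraph \<Rightarrow> 'm point \<Rightarrow> 'o" where
  "src_X \<Lambda> = (THE g. is_cont_ext (subtopology (X_top \<Lambda>) (X_set \<Lambda> - {pt \<Lambda> None}))
                       (discrete_topology (obj \<Lambda>)) (mor_star \<Lambda>) (\<lambda>a. pt \<Lambda> (Some a)) (src \<Lambda>) g)"

text \<open>
  The partial homeomorphisms \<open>l\<^sub>\<lambda>\<close> and \<open>r\<^sub>\<lambda>\<close>, from the clopen set where the character takes the
  value \<open>1\<close> on the initial projection of the partial isometry.  The isomorphism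
  \<open>f \<mapsto> L\<^sub>\<lambda> f L\<^sub>\<lambda>\<^sup>*\<close> between corners of \<open>D_alg\<close> has inverse \<open>f \<mapsto> L\<^sub>\<lambda>\<^sup>* f L\<^sub>\<lambda>\<close>; precomposition of
  characters with this inverse carries the point \<open>\<mu>\<close> to the point \<open>\<lambda>\<mu>\<close>.  Similarly for \<open>R\<^sub>\<lambda>\<close>.
\<close>

definition op_dom :: "('o, 'm, 'r::finite) rgraph \<Rightarrow> 'm option op \<Rightarrow> 'm point set" where
  "op_dom \<Lambda> U = {x \<in> X_set \<Lambda>. x (op_adj (mor_bar \<Lambda>) U \<circ> U) = 1}"

definition op_move :: "('o, 'm, 'r::finite) rgraph \<Rightarrow> 'm option op \<Rightarrow> 'm point \<Rightarrow> 'm point" where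
  "op_move \<Lambda> U x = (\<lambda>T\<in>D_alg \<Lambda>. x (op_adj (mor_bar \<Lambda>) U \<circ> T \<circ> U))"

fun l_dom :: "('o, 'm, 'r::finite) rgraph \<Rightarrow> 'm option \<Rightarrow> 'm point set" where
  "l_dom \<Lambda> None = X_set \<Lambda>"
| "l_dom \<Lambda> (Some a) = op_dom \<Lambda> (L_op \<Lambda> a)"

fun l_map :: "('o, 'm, 'r::finite) rgraph \<Rightarrow> 'm option \<Rightarrow> 'm point \<Rightarrow> 'm point" where
  "l_map \<Lambda> None x = x"
| "l_map \<Lambda> (Some a) x = op_move \<Lambda> (L_op \<Lambda> a) x"

fun r_dom :: "('o, 'm, 'r::finite) rgraph \<Rightarrow> 'm option \<Rightarrow> 'm point set" where
  "r_dom \<Lambda> None = X_set \<Lambda>"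
| "r_dom \<Lambda> (Some a) = op_dom \<Lambda> (R_op \<Lambda> a)"

fun r_map :: "('o, 'm, 'r::finite) rgraph \<Rightarrow> 'm option \<Rightarrow> 'm point \<Rightarrow> 'm point" where
  "r_map \<Lambda> None x = x"
| "r_map \<Lambda> (Some a) x = op_move \<Lambda> (R_op \<Lambda> a) x"

definition is_left_fact ::
  "('o, 'm, 'r::finite) rgraph \<Rightarrow> nat ^ 'r \<Rightarrow> 'm point \<Rightarrow> 'm option \<Rightarrow> 'm point \<Rightarrow> bool" where
  "is_left_fact \<Lambda> m x a x1 \<longleftrightarrow>
     a \<in> mor_bar \<Lambda> \<and> shape_bar \<Lambda> a = m \<and> x1 \<in> l_dom \<Lambda> a \<and> l_map \<Lambda> a x1 = x"

definition is_right_fact ::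
  "('o, 'm, 'r::finite) rgraph \<Rightarrow> nat ^ 'r \<Rightarrow> 'm point \<Rightarrow> 'm point \<Rightarrow> 'm option \<Rightarrow> bool" where
  "is_right_fact \<Lambda> m x x2 b \<longleftrightarrow>
     b \<in> mor_bar \<Lambda> \<and> shape_bar \<Lambda> b = m \<and> x2 \<in> r_dom \<Lambda> b \<and> r_map \<Lambda> b x2 = x"

definition shift_X :: "('o, 'm, 'r::finite) rgraph \<Rightarrow> nat ^ 'r \<Rightarrow> 'm point \<Rightarrow> 'm point" where
  "shift_X \<Lambda> m x = (THE x1. \<exists>a. is_left_fact \<Lambda> m x a x1)"


section \<open>Infinite paths\<close>

text \<open>
  A functor is given by its action on the morphisms \<open>(n, n')\<close>, \<open>n \<le> n'\<close>; it is \<open>undefined\<close> on other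
  pairs.  Its value on the object \<open>n\<close> is the object whose identity is \<open>y (n, n)\<close>.
\<close>

type_synonym ('m, 'r) path = "(nat ^ 'r) \<times> (nat ^ 'r) \<Rightarrow> 'm"

definition inf_paths :: "('o, 'm, 'r::finite) rgraph \<Rightarrow> ('m, 'r) path set" where
  "inf_paths \<Lambda> = {y \<in> extensional {(n, n'). n \<le> n'}.
     (\<forall>n n'. n \<le> n' \<longrightarrow> y (n, n') \<in> mor \<Lambda> \<and> shape \<Lambda> (y (n, n')) = n' - n) \<and>
     (\<forall>n. \<exists>v\<in>obj \<Lambda>. y (n, n) = ident \<Lambda> v) \<and>
     (\<forall>n k p. n \<le> k \<and> k \<le> p \<longrightarrow>
        src \<Lambda> (y (n, k)) = tgt \<Lambda> (y (k, p)) \<and> y (n, p) = cmp \<Lambda> (y (n, k)) (y (k, p)))}"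

definition path_top :: "('o, 'm, 'r::finite) rgraph \<Rightarrow> ('m, 'r) path topology" where
  "path_top \<Lambda> = topology_generated_by {{y \<in> inf_paths \<Lambda>. y (0, k) = a} |k a. a \<in> mor \<Lambda>}"

definition path_tgt :: "('o, 'm, 'r::finite) rgraph \<Rightarrow> ('m, 'r) path \<Rightarrow> 'o" where
  "path_tgt \<Lambda> y = tgt \<Lambda> (y (0, 0))"

definition path_shift :: "nat ^ 'r \<Rightarrow> ('m, 'r) path \<Rightarrow> ('m, 'r) path" where
  "path_shift m y = (\<lambda>(n, n'). y (n + m, n' + m))"

text \<open>The concatenation \<open>ay\<close> is the infinite path with initial segment \<open>a\<close> followed by \<open>y\<close>.\<close>

fun concat_path :: "('o, 'm, 'r::finite) rgraph \<Rightarrow> 'm option \<Rightarrow> ('m, 'r) path \<Rightarrow> ('m, 'r) path" where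
  "concat_path \<Lambda> None y = y"
| "concat_path \<Lambda> (Some a) y =
     (THE z. z \<in> inf_paths \<Lambda> \<and> z (0, shape \<Lambda> a) = a \<and> path_shift (shape \<Lambda> a) z = y)"


section \<open>The dynamical systems\<close>

text \<open>
  Partial maps are maps to the option type; their composition on natural domains is \<open>\<circ>\<^sub>m\<close>.
  \<open>partial_on\<close> turns a function into a partial map with domain \<open>A\<close>.
\<close>

definition partial_on :: "'a set \<Rightarrow> ('a \<Rightarrow> 'b) \<Rightarrow> 'a \<rightharpoonup> 'b" where
  "partial_on A f = (\<lambda>x. if x \<in> A then Some (f x) else None)"

definition partial_prod :: "('a \<rightharpoonup> 'c) \<Rightarrow> ('b \<rightharpoonup> 'd) \<Rightarrow> 'a \<times> 'b \<rightharpoonup> 'c \<times> 'd" where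
  "partial_prod f g = (\<lambda>(x, y). case (f x, g y) of
     (Some x', Some y') \<Rightarrow> Some (x', y') | _ \<Rightarrow> None)"

definition equivariant ::
  "('q \<Rightarrow> 'a \<rightharpoonup> 'a) \<Rightarrow> ('q \<Rightarrow> 'b \<rightharpoonup> 'b) \<Rightarrow> 'a set \<Rightarrow> ('a \<Rightarrow> 'b) \<Rightarrow> bool" where
  "equivariant A B X \<phi> \<longleftrightarrow> (\<forall>m. partial_on X \<phi> \<circ>\<^sub>m A m = B m \<circ>\<^sub>m partial_on X \<phi>)"

definition S_map :: "nat ^ 'r \<Rightarrow> enat ^ 'r \<rightharpoonup> enat ^ 'r" where
  "S_map k = partial_on {n. enat_vec k \<le> n} (\<lambda>n. n - enat_vec k)"

definition W_map ::
  "('o, 'm, 'r::finite) rgraph \<Rightarrow> nat ^ 'r \<Rightarrow> ('m, 'r) path \<rightharpoonup> ('m, 'r) path" where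
  "W_map \<Lambda> k = partial_on (inf_paths \<Lambda>) (path_shift k)"

definition Z_set :: "('o, 'm, 'r::finite) rgraph \<Rightarrow> ('m point \<times> ('m, 'r) path) set" where
  "Z_set \<Lambda> = {(x, y). x \<in> X_set \<Lambda> \<and> y \<in> inf_paths \<Lambda> \<and>
                      (x = pt \<Lambda> None \<or> src_X \<Lambda> x = path_tgt \<Lambda> y)}"

definition Z_top :: "('o, 'm, 'r::finite) rgraph \<Rightarrow> ('m point \<times> ('m, 'r) path) topology" where
  "Z_top \<Lambda> = subtopology (prod_topology (X_top \<Lambda>) (path_top \<Lambda>)) (Z_set \<Lambda>)"

definition T_map :: "('o, 'm, 'r::finite) rgraph \<Rightarrow> nat ^ 'r \<Rightarrow>
    'm point \<times> ('m, 'r) path \<rightharpoonup> 'm point \<times> ('m, 'r) path" where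
  "T_map \<Lambda> m = partial_on {(x, y) \<in> Z_set \<Lambda>. enat_vec m \<le> shape_X \<Lambda> x}
     (\<lambda>(x, y). let (x', x'') = (THE (x', x''). is_right_fact \<Lambda> m x x' x'')
               in (x', concat_path \<Lambda> x'' y))"

definition V_map :: "('o, 'm, 'r::finite) rgraph \<Rightarrow> nat ^ 'r \<Rightarrow>
    'm point \<times> ('m, 'r) path \<rightharpoonup> 'm point \<times> ('m, 'r) path" where
  "V_map \<Lambda> m = partial_on (Z_set \<Lambda>)
     (\<lambda>(x, y). (shift_X \<Lambda> m (r_map \<Lambda> (to_bar \<Lambda> (y (0, m))) x), path_shift m y))"

text \<open>\<open>\<phi>\<close> is a continuous extension to \<open>Z\<close> of \<open>(\<mu>, y) \<mapsto> (\<sigma>(\<mu>), \<mu>y)\<close> for \<open>\<mu> \<in> {\<Omega>} \<union> \<Lambda>\<^sup>*\<close>.\<close>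

definition is_phi :: "('o, 'm, 'r::finite) rgraph \<Rightarrow>
    ('m point \<times> ('m, 'r) path \<Rightarrow> (enat ^ 'r) \<times> ('m, 'r) path) \<Rightarrow> bool" where
  "is_phi \<Lambda> \<phi> \<longleftrightarrow> is_cont_ext (Z_top \<Lambda>) (prod_topology euclidean (path_top \<Lambda>))
     {(\<mu>, y). \<mu> \<in> mor_bar \<Lambda> \<and> (pt \<Lambda> \<mu>, y) \<in> Z_set \<Lambda>}
     (\<lambda>(\<mu>, y). (pt \<Lambda> \<mu>, y))
     (\<lambda>(\<mu>, y). (enat_vec (shape_bar \<Lambda> \<mu>), concat_path \<Lambda> \<mu> y)) \<phi>"

end

theory Submission
  imports Defs
begin

text \<open>
  A point \<open>x\<close> of \<open>X\<close> is handled through the ultrafilter of those sets \<open>S \<subseteq> {\<Omega>} \<union> \<Lambda>\<^sup>*\<close> whose projection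
  lies in the diagonal algebra and on which \<open>x\<close> takes the value \<open>1\<close>.  The points \<open>\<mu>\<close> are dense because
  a function in the algebra that is bounded below is invertible there.  Since \<open>L\<^sub>\<lambda>\<close> and \<open>R\<^sub>\<lambda>\<close>
  are weighted shifts along injective partial maps, \<open>l\<^sub>\<lambda>\<close> and \<open>r\<^sub>\<lambda>\<close> transport these ultrafilters along
  \<open>\<mu> \<mapsto> \<lambda>\<mu>\<close> and \<open>\<mu> \<mapsto> \<mu>\<lambda>\<close>.

  The segment \<open>(\<mu>y)(0, k)\<close> is the initial segment of \<open>\<mu> y(0, k)\<close>, so it is constant for \<open>\<mu>\<close> in a clopen
  neighbourhood of \<open>x\<close> and for \<open>y\<close> in a cylinder.  This defines \<open>xy\<close> and makes \<open>\<phi>(x, y) = (\<sigma>(x), xy)\<close>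
  continuous.  Equivariance then reduces to \<open>(\<mu>b)y = \<mu>(by)\<close> and, if \<open>\<mu> y(0, m) = a\<nu>\<close>, to
  \<open>\<mu>y = a(\<nu> L\<^sub>m y)\<close>, for \<open>\<mu>\<close> in a clopen neighbourhood.
\<close>

section \<open>Weighted shifts on square summable functions\<close>

text \<open>A priori the clopen sets record only part of a point. They suffice for what \<phi> needs
  of it: the shape and the finite segments of \<open>xy\<close>. The unique factorizations of a
  point, by contrast, concern the point itself; there injectivity and surjectivity come from the
  inverse partial isometry acting on all functions of the algebra.

  Two degeneracies around \<Omega> shape the statements. The generated algebra is not given a unit;
  it has one because there are finitely many objects, and the elements composable with a fixed
  object on their right form the support of an initial projection. Moreover {\<Omega>} \<union>
  \<Lambda>* identifies all morphisms of shape 0, so the segment of shape 0 of a path forgets its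
  base point. Values \<open>y (0, k)\<close> are therefore compared through segments of shape
  \<open>k + 1\<close>.\<close>

definition weighted_shift :: "'b set \<Rightarrow> 'b set \<Rightarrow> ('b \<Rightarrow> 'b) \<Rightarrow> ('b \<Rightarrow> complex) \<Rightarrow> 'b op" where
  "weighted_shift A d p w = (\<lambda>\<xi>. if \<xi> \<in> ell2 A
     then (\<lambda>\<nu>. if \<nu> \<in> p ` d then w \<nu> * \<xi> (inv_into d p \<nu>) else 0) else (\<lambda>\<nu>. 0))"

text \<open>Diagonal operators (\<open>p = id\<close>), \<open>L_op\<close> and \<open>R_op\<close>
  (\<open>w = 1\<close>) and their adjoints all have this form, so one estimate serves them.
  Reindexing along the injection \<open>p\<close> reduces the norm to a sum over \<open>d\<close>.
  The absolute value of \<open>C\<close> is there because \<open>C\<close> may be negative when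
  \<open>d\<close> is empty.\<close>

lemma weighted_shift_norm:
  assumes d: "d \<subseteq> A" and p: "p ` d \<subseteq> A" and inj: "inj_on p d"
    and w: "\<And>a. a \<in> p ` d \<Longrightarrow> cmod (w a) \<le> C" and \<xi>: "\<xi> \<in> ell2 A"
  shows "weighted_shift A d p w \<xi> \<in> ell2 A"
    and "ell2_norm A (weighted_shift A d p w \<xi>) \<le> \<bar>C\<bar> * ell2_norm A \<xi>"
proof -
  let ?T = "weighted_shift A d p w \<xi>"
  let ?g = "\<lambda>\<nu>. C\<^sup>2 * (cmod (\<xi> (inv_into d p \<nu>)))\<^sup>2"
  have s\<xi>: "(\<lambda>a. (cmod (\<xi> a))\<^sup>2) summable_on A" using \<xi> by (simp add: ell2_def)
  then have sd: "(\<lambda>a. (cmod (\<xi> a))\<^sup>2) summable_on d" using d by (rule summable_on_subset_banach)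
  have "(\<lambda>\<nu>. (cmod (\<xi> (inv_into d p \<nu>)))\<^sup>2) summable_on p ` d"
    unfolding summable_on_reindex[OF inj]
    using sd by (rule summable_on_cong[THEN iffD1, rotated]) (simp add: inj)
  then have g: "?g summable_on p ` d" by (rule summable_on_cmult_right)
  have le: "(cmod (?T \<nu>))\<^sup>2 \<le> ?g \<nu>" if "\<nu> \<in> p ` d" for \<nu>
  proof -
    have "(cmod (w \<nu>))\<^sup>2 \<le> C\<^sup>2" using w[OF that] by (simp add: power_mono)
    then show ?thesis using that \<xi>
      by (simp add: weighted_shift_def norm_mult power_mult_distrib mult_right_mono)
  qed
  have sT: "(\<lambda>\<nu>. (cmod (?T \<nu>))\<^sup>2) summable_on p ` d"
    by (rule summable_on_comparison_test[OF g le]) simp_all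
  have sTA: "(\<lambda>\<nu>. (cmod (?T \<nu>))\<^sup>2) summable_on A"
    by (rule summable_on_cong_neutral[THEN iffD1, OF _ _ _ sT])
      (use p \<xi> in \<open>auto simp: weighted_shift_def\<close>)
  then show "?T \<in> ell2 A" using p \<xi> by (auto simp: ell2_def weighted_shift_def)
  have "(\<Sum>\<^sub>\<infinity>\<nu>\<in>A. (cmod (?T \<nu>))\<^sup>2) = (\<Sum>\<^sub>\<infinity>\<nu>\<in>p ` d. (cmod (?T \<nu>))\<^sup>2)"
    by (rule infsum_cong_neutral) (use p \<xi> in \<open>auto simp: weighted_shift_def\<close>)
  also have "\<dots> \<le> infsum ?g (p ` d)" by (rule infsum_mono[OF sT g le])
  also have "\<dots> = C\<^sup>2 * (\<Sum>\<^sub>\<infinity>\<nu>\<in>p ` d. (cmod (\<xi> (inv_into d p \<nu>)))\<^sup>2)"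
    by (rule infsum_cmult_right')
  also have "(\<Sum>\<^sub>\<infinity>\<nu>\<in>p ` d. (cmod (\<xi> (inv_into d p \<nu>)))\<^sup>2) = (\<Sum>\<^sub>\<infinity>\<nu>\<in>d. (cmod (\<xi> \<nu>))\<^sup>2)"
    unfolding infsum_reindex[OF inj] by (rule infsum_cong) (simp add: inj)
  also have "C\<^sup>2 * \<dots> \<le> C\<^sup>2 * (\<Sum>\<^sub>\<infinity>\<nu>\<in>A. (cmod (\<xi> \<nu>))\<^sup>2)"
    by (intro mult_left_mono infsum_mono2[OF sd s\<xi> d]) simp_all
  finally have "ell2_norm A ?T \<le> sqrt (C\<^sup>2 * (\<Sum>\<^sub>\<infinity>\<nu>\<in>A. (cmod (\<xi> \<nu>))\<^sup>2))"
    unfolding ell2_norm_def by (rule real_sqrt_le_mono)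
  then show "ell2_norm A ?T \<le> \<bar>C\<bar> * ell2_norm A \<xi>"
    unfolding ell2_norm_def by (simp add: real_sqrt_mult)
qed

lemma ell2_scale: "\<xi> \<in> ell2 A \<Longrightarrow> (\<lambda>a. c * \<xi> a) \<in> ell2 A"
  by (auto simp: ell2_def norm_mult power_mult_distrib intro: summable_on_cmult_right)

lemma ell2_add:
  assumes "\<xi> \<in> ell2 A" "\<eta> \<in> ell2 A"
  shows "(\<lambda>a. \<xi> a + \<eta> a) \<in> ell2 A"
proof -
  have "(\<lambda>a. 2 * (cmod (\<xi> a))\<^sup>2 + 2 * (cmod (\<eta> a))\<^sup>2) summable_on A"
    using assms by (intro summable_on_add summable_on_cmult_right) (auto simp: ell2_def)
  then have "(\<lambda>a. (cmod (\<xi> a + \<eta> a))\<^sup>2) summable_on A"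
  proof (rule summable_on_comparison_test)
    fix a
    have "(cmod (\<xi> a + \<eta> a))\<^sup>2 \<le> (cmod (\<xi> a) + cmod (\<eta> a))\<^sup>2"
      by (simp add: norm_triangle_ineq power_mono)
    also have "\<dots> \<le> 2 * (cmod (\<xi> a))\<^sup>2 + 2 * (cmod (\<eta> a))\<^sup>2"
      using sum_squares_ge_zero[of "cmod (\<xi> a) - cmod (\<eta> a)" 0]
      by (simp add: power2_eq_square algebra_simps)
    finally show "(cmod (\<xi> a + \<eta> a))\<^sup>2 \<le> 2 * (cmod (\<xi> a))\<^sup>2 + 2 * (cmod (\<eta> a))\<^sup>2" .
  qed simp
  then show ?thesis using assms by (auto simp: ell2_def)
qed

lemma weighted_shift_bounded_op:
  assumes "d \<subseteq> A" "p ` d \<subseteq> A" "inj_on p d" "\<And>a. a \<in> p ` d \<Longrightarrow> cmod (w a) \<le> C"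
  shows "weighted_shift A d p w \<in> bounded_ops A"
  unfolding bounded_ops_def mem_Collect_eq
proof (intro conjI)
  note norm = weighted_shift_norm[OF assms(1-3), of w C, OF assms(4)]
  show "\<forall>\<xi>\<in>ell2 A. weighted_shift A d p w \<xi> \<in> ell2 A" using norm(1) by blast
  show "\<exists>C. \<forall>\<xi>\<in>ell2 A. ell2_norm A (weighted_shift A d p w \<xi>) \<le> C * ell2_norm A \<xi>"
    using norm(2) by blast
qed (auto simp: weighted_shift_def fun_eq_iff algebra_simps ell2_add ell2_scale)

text \<open>Both inner products are the sum over \<open>d\<close> of
  \<open>w (p a) * \<xi> a * cnj (\<eta> (p a))\<close>. The adjoint lands at \<open>a\<close>,
  hence its weight there is taken at \<open>p a\<close>.\<close>

lemma is_adjoint_weighted_shift: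
  assumes d: "d \<subseteq> A" and p: "p ` d \<subseteq> A" and inj: "inj_on p d"
    and w: "\<And>a. a \<in> p ` d \<Longrightarrow> cmod (w a) \<le> C"
  shows "is_adjoint A (weighted_shift A d p w)
           (weighted_shift A (p ` d) (inv_into d p) (\<lambda>a. cnj (w (p a))))"
proof -
  let ?q = "inv_into d p"
  have qd: "?q ` p ` d = d" using inj by (simp add: image_image)
  have injq: "inj_on ?q (p ` d)" by (simp add: inj_on_inv_into)
  have qq: "inv_into (p ` d) ?q a = p a" if "a \<in> d" for a
    using inv_into_f_f[OF injq, of "p a"] that inj by simp
  show ?thesis unfolding is_adjoint_def
  proof (intro conjI ballI)
    show "weighted_shift A (p ` d) ?q (\<lambda>a. cnj (w (p a))) \<in> bounded_ops A"
      by (rule weighted_shift_bounded_op[where C = C]) (use d p injq qd w in auto)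
    fix \<xi> \<eta> assume \<xi>: "\<xi> \<in> ell2 A" and \<eta>: "\<eta> \<in> ell2 A"
    have "ell2_inner A (weighted_shift A d p w \<xi>) \<eta>
        = (\<Sum>\<^sub>\<infinity>a\<in>p ` d. w a * \<xi> (?q a) * cnj (\<eta> a))"
      unfolding ell2_inner_def
      by (rule infsum_cong_neutral) (use p \<xi> in \<open>auto simp: weighted_shift_def\<close>)
    also have "\<dots> = (\<Sum>\<^sub>\<infinity>a\<in>d. w (p a) * \<xi> a * cnj (\<eta> (p a)))"
      unfolding infsum_reindex[OF inj] by (rule infsum_cong) (simp add: inj)
    also have "\<dots> = ell2_inner A \<xi> (weighted_shift A (p ` d) ?q (\<lambda>a. cnj (w (p a))) \<eta>)"
      unfolding ell2_inner_def
      by (rule infsum_cong_neutral) (use d \<eta> in \<open>auto simp: weighted_shift_def qd qq\<close>)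
    finally show "ell2_inner A (weighted_shift A d p w \<xi>) \<eta>
        = ell2_inner A \<xi> (weighted_shift A (p ` d) ?q (\<lambda>a. cnj (w (p a))) \<eta>)" .
  qed
qed

lemma ell2_inner_ket: "a \<in> A \<Longrightarrow> ell2_inner A (ket a) \<eta> = cnj (\<eta> a)"
proof -
  assume a: "a \<in> A"
  have "ell2_inner A (ket a) \<eta> = (\<Sum>\<^sub>\<infinity>b\<in>{a}. cnj (\<eta> b))"
    unfolding ell2_inner_def by (rule infsum_cong_neutral) (use a in \<open>auto simp: ket_def\<close>)
  then show ?thesis by simp
qed

text \<open>\<open>op_adj\<close> is a definite description. Testing against \<open>ket a\<close>
  determines the entries at points of \<open>A\<close>; the convention that operators vanish off
  \<open>ell2 A\<close> settles the remaining arguments.\<close>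

lemma is_adjoint_unique:
  assumes "is_adjoint A T S" "is_adjoint A T S'"
  shows "S = S'"
proof
  fix \<eta>
  show "S \<eta> = S' \<eta>"
  proof (cases "\<eta> \<in> ell2 A")
    case False
    then show ?thesis using assms by (simp add: is_adjoint_def bounded_ops_def)
  next
    case True
    show ?thesis
    proof
      fix a
      show "S \<eta> a = S' \<eta> a"
      proof (cases "a \<in> A")
        case aA: True
        have "ell2_inner A (ket a) (S \<eta>) = ell2_inner A (ket a) (S' \<eta>)"
          using assms True ket_in_ell2[OF aA] unfolding is_adjoint_def by metis
        then show ?thesis using aA by (simp add: ell2_inner_ket)
      next
        case False
        have "S \<eta> \<in> ell2 A" "S' \<eta> \<in> ell2 A"
          using assms True by (auto simp: is_adjoint_def bounded_ops_def)
        then show ?thesis using False by (simp add: ell2_def)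
      qed
    qed
  qed
qed

lemma op_adj_eqI: "is_adjoint A T S \<Longrightarrow> op_adj A T = S"
  unfolding op_adj_def using is_adjoint_unique by blast

section \<open>Diagonal operators and their conjugation by shifts\<close>

lemma diagonal_op_weighted_shift: "diagonal_op A f = weighted_shift A A id f"
  by (auto simp: diagonal_op_def weighted_shift_def ell2_def fun_eq_iff)

lemma diagonal_op_cong: "(\<And>a. a \<in> A \<Longrightarrow> f a = g a) \<Longrightarrow> diagonal_op A f = diagonal_op A g"
  unfolding diagonal_op_weighted_shift by (auto simp: weighted_shift_def fun_eq_iff)

lemma diagonal_op_ket: "a \<in> A \<Longrightarrow> diagonal_op A f (ket a) a = f a"
  by (simp add: diagonal_op_def ket_in_ell2) (simp add: ket_def)

lemma bounded_image_iff: "bounded (f ` A) \<longleftrightarrow> (\<exists>C. \<forall>a\<in>A. cmod (f a) \<le> C)"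
  by (auto simp: bounded_iff)

lemma diagonal_op_bounded_op: "bounded (f ` A) \<Longrightarrow> diagonal_op A f \<in> bounded_ops A"
  unfolding bounded_image_iff diagonal_op_weighted_shift
  by (elim exE) (rule weighted_shift_bounded_op, auto)

lemma diagonal_op_ell2: "bounded (f ` A) \<Longrightarrow> \<xi> \<in> ell2 A \<Longrightarrow> diagonal_op A f \<xi> \<in> ell2 A"
  using diagonal_op_bounded_op unfolding bounded_ops_def by blast

lemma is_adjoint_diagonal_op:
  assumes "bounded (f ` A)"
  shows "is_adjoint A (diagonal_op A f) (diagonal_op A (\<lambda>a. cnj (f a)))"
proof -
  obtain C where "\<forall>a\<in>A. cmod (f a) \<le> C" using assms by (auto simp: bounded_image_iff)
  then have "is_adjoint A (weighted_shift A A id f)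
      (weighted_shift A (id ` A) (inv_into A id) (\<lambda>a. cnj (f (id a))))"
    by (intro is_adjoint_weighted_shift) auto
  moreover have "weighted_shift A (id ` A) (inv_into A id) (\<lambda>a. cnj (f (id a)))
      = weighted_shift A A id (\<lambda>a. cnj (f a))"
  proof -
    have [simp]: "inv_into A id ` A = A"
      by (metis id_apply image_cong image_ident image_id inv_into_f_f inj_on_id)
    have [simp]: "inv_into A id a = a" if "a \<in> A" for a
      using that by (metis id_apply inv_into_f_f inj_on_id)
    have [simp]: "inv_into A (inv_into A id) a = a" if "a \<in> A" for a
      using that by (metis \<open>inv_into A id ` A = A\<close> f_inv_into_f inv_into_into
          \<open>\<And>a. a \<in> A \<Longrightarrow> inv_into A id a = a\<close>)
    show ?thesis by (auto simp: weighted_shift_def fun_eq_iff)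
  qed
  ultimately show ?thesis by (simp add: diagonal_op_weighted_shift)
qed

lemma diagonal_op_add:
  "op_add (diagonal_op A f) (diagonal_op A g) = diagonal_op A (\<lambda>a. f a + g a)"
  by (auto simp: op_add_def diagonal_op_def fun_eq_iff algebra_simps)

lemma diagonal_op_scale: "op_scale c (diagonal_op A f) = diagonal_op A (\<lambda>a. c * f a)"
  by (auto simp: op_scale_def diagonal_op_def fun_eq_iff algebra_simps)

lemma diagonal_op_comp:
  assumes "bounded (g ` A)"
  shows "diagonal_op A f \<circ> diagonal_op A g = diagonal_op A (\<lambda>a. f a * g a)"
proof
  fix \<xi>
  show "(diagonal_op A f \<circ> diagonal_op A g) \<xi> = diagonal_op A (\<lambda>a. f a * g a) \<xi>"
    using diagonal_op_ell2[OF assms]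
    by (cases "\<xi> \<in> ell2 A") (auto simp: diagonal_op_def fun_eq_iff algebra_simps)
qed

lemma zero_in_ell2: "(\<lambda>a. 0) \<in> ell2 A"
  by (simp add: ell2_def)

lemma ell2_norm_nonneg: "0 \<le> ell2_norm A \<xi>"
  by (simp add: ell2_norm_def infsum_nonneg)

text \<open>Turns uniform convergence of functions into the norm convergence demanded by the limit
  rule of \<open>cstar_gen\<close>. The zero vector shows that the supremum is taken over a nonempty
  set.\<close>

lemma op_norm_diagonal:
  assumes "\<And>a. a \<in> A \<Longrightarrow> cmod (f a) \<le> C" "0 \<le> C"
  shows "op_norm A (diagonal_op A f) \<le> C" "0 \<le> op_norm A (diagonal_op A f)"
proof -
  have le: "ell2_norm A (diagonal_op A f \<xi>) \<le> C" if "\<xi> \<in> ell2 A" "ell2_norm A \<xi> \<le> 1" for \<xi>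
  proof -
    have "ell2_norm A (diagonal_op A f \<xi>) \<le> \<bar>C\<bar> * ell2_norm A \<xi>"
      unfolding diagonal_op_weighted_shift using assms that
      by (intro weighted_shift_norm) auto
    also have "\<dots> \<le> C * 1" using assms(2) that(2) by (intro mult_mono) (auto simp: ell2_norm_nonneg)
    finally show ?thesis by simp
  qed
  have z: "(\<lambda>a. 0) \<in> {\<xi> \<in> ell2 A. ell2_norm A \<xi> \<le> 1}"
    by (simp add: zero_in_ell2 ell2_norm_def)
  show "op_norm A (diagonal_op A f) \<le> C"
    unfolding op_norm_def by (rule cSUP_least) (use z le in auto)
  have "ell2_norm A (diagonal_op A f (\<lambda>a. 0)) \<le> op_norm A (diagonal_op A f)"
    unfolding op_norm_def by (rule cSUP_upper[OF z]) (auto intro!: bdd_aboveI2 le)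
  then show "0 \<le> op_norm A (diagonal_op A f)" using ell2_norm_nonneg order_trans by blast
qed

text \<open>For the shift U, the operator U* f U multiplies by the pullback of \<open>f\<close>
  along \<open>p\<close>, cut off outside \<open>d\<close>. This is why \<open>op_move\<close>
  transports points along \<open>p\<close>.\<close>

lemma weighted_shift_conj_diagonal:
  assumes d: "d \<subseteq> A" and p: "p ` d \<subseteq> A" and inj: "inj_on p d" and f: "bounded (f ` A)"
  shows "weighted_shift A (p ` d) (inv_into d p) (\<lambda>a. 1) \<circ> diagonal_op A f \<circ> weighted_shift A d p (\<lambda>a. 1)
       = diagonal_op A (\<lambda>a. if a \<in> d then f (p a) else 0)"
proof
  fix \<xi>
  let ?q = "inv_into d p"
  have qd: "?q ` p ` d = d" using inj by (simp add: image_image)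
  have injq: "inj_on ?q (p ` d)" by (simp add: inj_on_inv_into)
  have qq: "inv_into (p ` d) ?q a = p a" if "a \<in> d" for a
    using inv_into_f_f[OF injq, of "p a"] that inj by simp
  show "(weighted_shift A (p ` d) ?q (\<lambda>a. 1) \<circ> diagonal_op A f \<circ> weighted_shift A d p (\<lambda>a. 1)) \<xi>
       = diagonal_op A (\<lambda>a. if a \<in> d then f (p a) else 0) \<xi>"
  proof (cases "\<xi> \<in> ell2 A")
    case True
    have 1: "weighted_shift A d p (\<lambda>a. 1) \<xi> \<in> ell2 A"
      using weighted_shift_norm(1)[OF d p inj _ True, of "\<lambda>a. 1" 1] by simp
    have 2: "diagonal_op A f (weighted_shift A d p (\<lambda>a. 1) \<xi>) \<in> ell2 A"
      using diagonal_op_ell2[OF f 1] .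
    have "weighted_shift A (p ` d) ?q (\<lambda>a. 1) (diagonal_op A f (weighted_shift A d p (\<lambda>a. 1) \<xi>))
        = (\<lambda>\<nu>. if \<nu> \<in> d then diagonal_op A f (weighted_shift A d p (\<lambda>a. 1) \<xi>) (p \<nu>) else 0)"
      unfolding weighted_shift_def[of A "p ` d" ?q] using 2 by (auto simp: qd qq fun_eq_iff)
    also have "\<dots> = diagonal_op A (\<lambda>a. if a \<in> d then f (p a) else 0) \<xi>"
      using True 1 inj by (auto simp: diagonal_op_def weighted_shift_def fun_eq_iff)
    finally show ?thesis by simp
  next
    case False
    then show ?thesis
      by (auto simp: diagonal_op_def weighted_shift_def fun_eq_iff)
  qed
qed

text \<open>The case f = 1 of the conjugation formula: the middle factor is the identity on the
  range of the shift.\<close>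

lemma weighted_shift_adjoint_comp:
  assumes d: "d \<subseteq> A" and p: "p ` d \<subseteq> A" and inj: "inj_on p d"
  shows "weighted_shift A (p ` d) (inv_into d p) (\<lambda>a. 1) \<circ> weighted_shift A d p (\<lambda>a. 1)
       = diagonal_op A (\<lambda>a. if a \<in> d then 1 else 0)"
proof -
  have "bounded ((\<lambda>a. 1 :: complex) ` A)" by (auto simp: bounded_image_iff)
  from weighted_shift_conj_diagonal[OF d p inj this]
  have "weighted_shift A (p ` d) (inv_into d p) (\<lambda>a. 1) \<circ> diagonal_op A (\<lambda>a. 1) \<circ> weighted_shift A d p (\<lambda>a. 1)
       = diagonal_op A (\<lambda>a. if a \<in> d then 1 else 0)" .
  moreover have "diagonal_op A (\<lambda>a. 1) \<circ> weighted_shift A d p (\<lambda>a. 1) = weighted_shift A d p (\<lambda>a. 1)"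
  proof
    fix \<xi>
    show "(diagonal_op A (\<lambda>a. 1) \<circ> weighted_shift A d p (\<lambda>a. 1)) \<xi> = weighted_shift A d p (\<lambda>a. 1) \<xi>"
    proof (cases "\<xi> \<in> ell2 A")
      case True
      then show ?thesis
        using weighted_shift_norm(1)[OF d p inj _ True, of "\<lambda>a. 1" 1]
        by (simp add: diagonal_op_def)
    next
      case False
      then show ?thesis by (simp add: diagonal_op_def weighted_shift_def)
    qed
  qed
  ultimately show ?thesis by (metis comp_assoc)
qed

text \<open>Brings the sums in \<open>L_op\<close> and \<open>R_op\<close> into the form of
  \<open>weighted_shift\<close>.\<close>

lemma sum_unique_preimage:
  assumes "inj_on p d"
  shows "(\<Sum>\<mu> | \<mu> \<in> d \<and> p \<mu> = \<nu>. \<xi> \<mu>) = (if \<nu> \<in> p ` d then \<xi> (inv_into d p \<nu>) else 0)"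
proof (cases "\<nu> \<in> p ` d")
  case True
  then obtain a where a: "a \<in> d" "\<nu> = p a" by blast
  then have "{\<mu>. \<mu> \<in> d \<and> p \<mu> = \<nu>} = {a}" using assms by (auto dest: inj_onD)
  then show ?thesis using a assms True by simp
next
  case False
  then have "{\<mu>. \<mu> \<in> d \<and> p \<mu> = \<nu>} = {}" by auto
  then show ?thesis using False by (simp only: if_False sum.empty)
qed


section \<open>Vectors over the natural numbers and continuous extensions\<close>

lemma nat_vec_add_eq_0: "a + b = 0 \<longleftrightarrow> a = 0 \<and> b = (0 :: nat ^ 'n::finite)"
  by (auto simp: vec_eq_iff)

lemma nat_vec_le_add_diff: "m \<le> n \<Longrightarrow> m + (n - m) = (n :: nat ^ 'n::finite)"
  by (simp add: vec_eq_iff less_eq_vec_def)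

lemma nat_vec_le_add: "m \<le> m + (n :: nat ^ 'n::finite)" "m \<le> n + m"
  by (simp_all add: less_eq_vec_def)

lemma nat_vec_zero_le [simp]: "0 \<le> (k :: nat ^ 'n::finite)"
  by (simp add: less_eq_vec_def)

lemma nat_vec_add_one_neq_0: "m + 1 \<noteq> (0 :: nat ^ 'n::finite)" "1 + m \<noteq> (0 :: nat ^ 'n::finite)"
  by (simp_all add: nat_vec_add_eq_0)

lemma bounded_times_comp:
  fixes f g :: "'a \<Rightarrow> complex"
  assumes "bounded (f ` B)" "bounded (g ` B)"
  shows "bounded ((\<lambda>a. f a * g a) ` B)"
proof -
  obtain C D where "\<forall>a\<in>B. cmod (f a) \<le> C" "\<forall>a\<in>B. cmod (g a) \<le> D"
    using assms by (auto simp: bounded_image_iff)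
  then have "\<forall>a\<in>B. cmod (f a * g a) \<le> C * D"
    by (auto simp: norm_mult intro!: mult_mono intro: order_trans[OF norm_ge_zero])
  then show ?thesis by (auto simp: bounded_image_iff)
qed

text \<open>Truncated subtraction makes the hypothesis necessary: for \<open>a < enat k\<close> and
  \<open>n = 0\<close> only the left side holds.\<close>

lemma le_enat_minus_iff: "enat k \<le> a \<Longrightarrow> enat n \<le> a - enat k \<longleftrightarrow> enat (n + k) \<le> a"
  by (cases a) auto

section \<open>Continuous extensions and continuity into the extended naturals\<close>

lemma cont_ext_unique:
  assumes dense: "topspace X \<subseteq> X closure_of (e ` I)" and "Hausdorff_space Y"
    and "is_cont_ext X Y I e f g" "is_cont_ext X Y I e f h"
  shows "g = h"
proof (rule extensionalityI[of _ "topspace X"])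
  fix x assume "x \<in> topspace X"
  then have "x \<in> X closure_of (e ` I)" using dense by blast
  then show "g x = h x"
    by (rule forall_in_closure_of_eq) (use assms in \<open>auto simp: is_cont_ext_def\<close>)
qed (use assms in \<open>auto simp: is_cont_ext_def\<close>)

lemma Hausdorff_enat_vec: "Hausdorff_space (euclidean :: (enat ^ 'n::finite) topology)"
  unfolding Hausdorff_space_def
proof (intro allI impI)
  fix x y :: "enat ^ 'n"
  assume "x \<in> topspace euclidean \<and> y \<in> topspace euclidean \<and> x \<noteq> y"
  then obtain i where "x $ i \<noteq> y $ i" by (auto simp: vec_eq_iff)
  then obtain U V where UV: "open U" "open V" "x $ i \<in> U" "y $ i \<in> V" "U \<inter> V = {}"
    by (metis hausdorff)
  have "open ((\<lambda>z. z $ i) -` U)" "open ((\<lambda>z. z $ i) -` V)"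
    using UV by (auto intro: open_vimage_vec_nth)
  then show "\<exists>U V. openin euclidean U \<and> openin euclidean V \<and> x \<in> U \<and> y \<in> V \<and> disjnt U V"
    using UV by (intro exI[of _ "(\<lambda>z. z $ i) -` U"] exI[of _ "(\<lambda>z. z $ i) -` V"])
      (auto simp: disjnt_def)
qed

lemma enat_eqI_le: 
  assumes "\<And>n. enat n \<le> a \<longleftrightarrow> enat n \<le> b"
  shows "a = b"
proof -
  have "x \<le> y" if "\<And>n. enat n \<le> x \<Longrightarrow> enat n \<le> y" for x y :: enat
  proof (cases x)
    case infinity
    then have le: "enat n \<le> y" for n using that by simp
    have "y \<noteq> enat k" for k using le[of "Suc k"] by auto
    then have "y = \<infinity>" by (cases y) auto
    then show ?thesis by simp
  qed (use that in auto)
  then show ?thesis using assms by (meson antisym)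
qed

text \<open>\<open>enat\<close> carries the order topology. Preimages of open rays are covered by
  sets of the two given kinds; for the ray below infinity one takes the union over all
  \<open>n\<close> of the second kind.\<close>

lemma continuous_map_enatI:
  assumes "\<And>n. openin X {x \<in> topspace X. enat n \<le> g x}" "\<And>n. openin X {x \<in> topspace X. \<not> enat n \<le> g x}"
  shows "continuous_map X (euclidean :: enat topology) g"
proof -
  have gt: "openin X {x \<in> topspace X. g x \<in> {a<..}}" for a
  proof (cases a)
    case (enat n)
    then show ?thesis using assms(1)[of "Suc n"] by (simp add: Suc_ile_eq)
  qed simp
  have lt: "openin X {x \<in> topspace X. g x \<in> {..<a}}" for a
  proof (cases a)
    case (enat n)
    then show ?thesis using assms(2)[of n] by (simp add: not_le)
  next
    case infinity
    have "{x \<in> topspace X. g x \<in> {..<a}} = (\<Union>n. {x \<in> topspace X. \<not> enat n \<le> g x})"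
    proof (intro equalityI subsetI)
      fix x assume x: "x \<in> {x \<in> topspace X. g x \<in> {..<a}}"
      then obtain n where "g x = enat n" using infinity by auto
      then show "x \<in> (\<Union>n. {x \<in> topspace X. \<not> enat n \<le> g x})"
        using x by (auto intro: exI[of _ "Suc n"])
    qed (use infinity in \<open>auto simp: not_le elim: less_enatE\<close>)
    then show ?thesis using assms(2) by auto
  qed
  show ?thesis
    unfolding continuous_map_atin limitin_canonical_iff
  proof (intro ballI order_tendstoI)
    fix x a assume x: "x \<in> topspace X"
    show "\<forall>\<^sub>F y in atin X x. a < g y" if "a < g x"
      unfolding eventually_atin
      using that x gt[of a] by (intro disjI2 exI[of _ "{x \<in> topspace X. g x \<in> {a<..}}"]) auto
    show "\<forall>\<^sub>F y in atin X x. g y < a" if "g x < a"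
      unfolding eventually_atin
      using that x lt[of a] by (intro disjI2 exI[of _ "{x \<in> topspace X. g x \<in> {..<a}}"]) auto
  qed
qed


section \<open>Higher rank graphs with condition (F)\<close>

locale rank_graph_F =
  fixes \<Lambda> :: "('o, 'm, 'r::finite) rgraph"
  assumes rank_graph: "rank_graph \<Lambda>" and condition_F: "condition_F \<Lambda>"
begin

lemma category: "small_category \<Lambda>"
  using rank_graph by (simp add: rank_graph_def)

lemma src_obj: "a \<in> mor \<Lambda> \<Longrightarrow> src \<Lambda> a \<in> obj \<Lambda>" and tgt_obj: "a \<in> mor \<Lambda> \<Longrightarrow> tgt \<Lambda> a \<in> obj \<Lambda>"
  using category by (simp_all add: small_category_def)

lemma ident_mor: "v \<in> obj \<Lambda> \<Longrightarrow> ident \<Lambda> v \<in> mor \<Lambda>"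
  and src_ident: "v \<in> obj \<Lambda> \<Longrightarrow> src \<Lambda> (ident \<Lambda> v) = v"
  and tgt_ident: "v \<in> obj \<Lambda> \<Longrightarrow> tgt \<Lambda> (ident \<Lambda> v) = v"
  and shape_ident: "v \<in> obj \<Lambda> \<Longrightarrow> shape \<Lambda> (ident \<Lambda> v) = 0"
  using category rank_graph by (simp_all add: small_category_def rank_graph_def)

lemma cmp_mor: "\<lbrakk>a \<in> mor \<Lambda>; b \<in> mor \<Lambda>; src \<Lambda> a = tgt \<Lambda> b\<rbrakk> \<Longrightarrow> cmp \<Lambda> a b \<in> mor \<Lambda>"
  and src_cmp: "\<lbrakk>a \<in> mor \<Lambda>; b \<in> mor \<Lambda>; src \<Lambda> a = tgt \<Lambda> b\<rbrakk> \<Longrightarrow> src \<Lambda> (cmp \<Lambda> a b) = src \<Lambda> b"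
  and tgt_cmp: "\<lbrakk>a \<in> mor \<Lambda>; b \<in> mor \<Lambda>; src \<Lambda> a = tgt \<Lambda> b\<rbrakk> \<Longrightarrow> tgt \<Lambda> (cmp \<Lambda> a b) = tgt \<Lambda> a"
  and shape_cmp: "\<lbrakk>a \<in> mor \<Lambda>; b \<in> mor \<Lambda>; src \<Lambda> a = tgt \<Lambda> b\<rbrakk> \<Longrightarrow>
    shape \<Lambda> (cmp \<Lambda> a b) = shape \<Lambda> a + shape \<Lambda> b"
  using category rank_graph by (simp_all add: small_category_def rank_graph_def)

lemma cmp_assoc:
  "\<lbrakk>a \<in> mor \<Lambda>; b \<in> mor \<Lambda>; c \<in> mor \<Lambda>; src \<Lambda> a = tgt \<Lambda> b; src \<Lambda> b = tgt \<Lambda> c\<rbrakk> \<Longrightarrow>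
    cmp \<Lambda> (cmp \<Lambda> a b) c = cmp \<Lambda> a (cmp \<Lambda> b c)"
  using category unfolding small_category_def by blast

lemma cmp_ident: "a \<in> mor \<Lambda> \<Longrightarrow> cmp \<Lambda> (ident \<Lambda> (tgt \<Lambda> a)) a = a"
  "a \<in> mor \<Lambda> \<Longrightarrow> cmp \<Lambda> a (ident \<Lambda> (src \<Lambda> a)) = a"
  using category unfolding small_category_def by blast+

lemma factorization:
  assumes "a \<in> mor \<Lambda>" "shape \<Lambda> a = m + n"
  obtains b c where "b \<in> mor \<Lambda>" "c \<in> mor \<Lambda>" "src \<Lambda> b = tgt \<Lambda> c" "a = cmp \<Lambda> b c"
    "shape \<Lambda> b = m" "shape \<Lambda> c = n"
proof -
  have "\<exists>!(b, c). b \<in> mor \<Lambda> \<and> c \<in> mor \<Lambda> \<and> src \<Lambda> b = tgt \<Lambda> c \<and> a = cmp \<Lambda> b c \<and>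
          shape \<Lambda> b = m \<and> shape \<Lambda> c = n"
    using rank_graph assms unfolding rank_graph_def by blast
  then show thesis using that by (auto dest: ex1_implies_ex)
qed

lemma factorization_cancel:
  assumes "a \<in> mor \<Lambda>" "b \<in> mor \<Lambda>" "src \<Lambda> a = tgt \<Lambda> b" "c \<in> mor \<Lambda>" "d \<in> mor \<Lambda>" "src \<Lambda> c = tgt \<Lambda> d"
    "cmp \<Lambda> a b = cmp \<Lambda> c d" "shape \<Lambda> a = shape \<Lambda> c \<or> shape \<Lambda> b = shape \<Lambda> d"
  shows "a = c" "b = d"
  using factorization_unique[OF rank_graph assms] by blast+

text \<open>Composing \<open>a\<close> with the identity on either side gives two factorizations of
  \<open>a\<close>. Their first factors, \<open>a\<close> and an identity, both have shape 0 and
  hence coincide.\<close>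

lemma shape_0_ident:
  assumes "a \<in> mor \<Lambda>" "shape \<Lambda> a = 0"
  shows "a = ident \<Lambda> (src \<Lambda> a)" "src \<Lambda> a = tgt \<Lambda> a"
proof -
  note o = src_obj[OF assms(1)] tgt_obj[OF assms(1)]
  have "a = ident \<Lambda> (tgt \<Lambda> a)"
    by (rule factorization_cancel(1)[of a "ident \<Lambda> (src \<Lambda> a)" _ a])
      (simp_all add: o assms ident_mor src_ident tgt_ident cmp_ident shape_ident)
  then show "src \<Lambda> a = tgt \<Lambda> a" using o(2) src_ident by metis
  with \<open>a = _\<close> show "a = ident \<Lambda> (src \<Lambda> a)" by simp
qed

section \<open>Factorization with \<Omega> in place of the identities\<close>

abbreviation bar :: "'m option set" where "bar \<equiv> mor_bar \<Lambda>"

lemma None_bar [simp]: "None \<in> bar"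
  by (simp add: mor_bar_def)

lemma Some_bar: "Some a \<in> bar \<longleftrightarrow> a \<in> mor \<Lambda> \<and> shape \<Lambda> a \<noteq> 0"
  by (auto simp: mor_bar_def mor_star_def)

lemma mor_star_iff: "a \<in> mor_star \<Lambda> \<longleftrightarrow> Some a \<in> bar"
  by (auto simp: Some_bar mor_star_def)

lemma cmp_bar_None [simp]: "cmp_bar \<Lambda> a None = a"
  by (cases a) auto

lemma shape_bar_0: "a \<in> bar \<Longrightarrow> shape_bar \<Lambda> a = 0 \<longleftrightarrow> a = None"
  by (cases a) (auto simp: Some_bar)

lemma cmp_bar_bar:
  assumes "a \<in> bar" "b \<in> bar" "composable_bar \<Lambda> a b"
  shows "cmp_bar \<Lambda> a b \<in> bar" "shape_bar \<Lambda> (cmp_bar \<Lambda> a b) = shape_bar \<Lambda> a + shape_bar \<Lambda> b"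
  using assms
  by (cases a; cases b; simp add: Some_bar cmp_mor shape_cmp nat_vec_add_eq_0)+

lemma to_bar_bar: "a \<in> mor \<Lambda> \<Longrightarrow> to_bar \<Lambda> a \<in> bar"
  and shape_to_bar: "shape_bar \<Lambda> (to_bar \<Lambda> a) = shape \<Lambda> a"
  by (simp_all add: to_bar_def Some_bar)

text \<open>A morphism of shape 0 is an identity, so dropping it from a composite agrees with
  reading it as \<Omega>.\<close>

lemma cmp_bar_to_bar:
  assumes "a \<in> mor \<Lambda>" "b \<in> mor \<Lambda>" "src \<Lambda> a = tgt \<Lambda> b"
  shows "composable_bar \<Lambda> (to_bar \<Lambda> a) (to_bar \<Lambda> b)"
    "cmp_bar \<Lambda> (to_bar \<Lambda> a) (to_bar \<Lambda> b) = to_bar \<Lambda> (cmp \<Lambda> a b)"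
proof -
  have "cmp \<Lambda> a b = b" if "shape \<Lambda> a = 0"
    using shape_0_ident[OF assms(1) that] cmp_ident(1)[OF assms(2)] assms(3) by metis
  moreover have "cmp \<Lambda> a b = a" if "shape \<Lambda> b = 0"
    using shape_0_ident[OF assms(2) that] cmp_ident(2)[OF assms(1)] assms(3) by metis
  ultimately show "composable_bar \<Lambda> (to_bar \<Lambda> a) (to_bar \<Lambda> b)"
    "cmp_bar \<Lambda> (to_bar \<Lambda> a) (to_bar \<Lambda> b) = to_bar \<Lambda> (cmp \<Lambda> a b)"
    using assms by (auto simp: to_bar_def shape_cmp nat_vec_add_eq_0)
qed

text \<open>Factors of shape 0 in \<Lambda> are replaced by \<Omega>, so both factors exist in
  \<open>bar\<close> even if \<open>m\<close> or \<open>n\<close> is 0.\<close>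

lemma bar_factorization:
  assumes "\<mu> \<in> bar" "shape_bar \<Lambda> \<mu> = m + n"
  obtains a b where "a \<in> bar" "b \<in> bar" "composable_bar \<Lambda> a b" "cmp_bar \<Lambda> a b = \<mu>"
    "shape_bar \<Lambda> a = m" "shape_bar \<Lambda> b = n"
proof (cases \<mu>)
  case None
  then show thesis using that[of None None] assms by (auto simp: nat_vec_add_eq_0 eq_commute[of 0])
next
  case (Some c)
  then have "c \<in> mor \<Lambda>" "shape \<Lambda> c = m + n" "shape \<Lambda> c \<noteq> 0" using assms by (simp_all add: Some_bar)
  then obtain a b where ab: "a \<in> mor \<Lambda>" "b \<in> mor \<Lambda>" "src \<Lambda> a = tgt \<Lambda> b" "c = cmp \<Lambda> a b"
    "shape \<Lambda> a = m" "shape \<Lambda> b = n"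
    by (rule_tac factorization)
  then have "to_bar \<Lambda> c = \<mu>" using \<open>shape \<Lambda> c \<noteq> 0\<close> Some by (simp add: to_bar_def)
  then show thesis
    using that[of "to_bar \<Lambda> a" "to_bar \<Lambda> b"] ab by (simp add: to_bar_bar shape_to_bar cmp_bar_to_bar)
qed

text \<open>The shapes decide which factors are \<Omega>, the only element of \<open>bar\<close> of
  shape 0. What remains is unique factorization in \<Lambda>.\<close>

lemma bar_factorization_cancel:
  assumes "a \<in> bar" "b \<in> bar" "composable_bar \<Lambda> a b" "a' \<in> bar" "b' \<in> bar" "composable_bar \<Lambda> a' b'"
    "cmp_bar \<Lambda> a b = cmp_bar \<Lambda> a' b'" "shape_bar \<Lambda> a = shape_bar \<Lambda> a' \<or> shape_bar \<Lambda> b = shape_bar \<Lambda> b'"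
  shows "a = a'" "b = b'"
proof -
  have "shape_bar \<Lambda> a + shape_bar \<Lambda> b = shape_bar \<Lambda> a' + shape_bar \<Lambda> b'"
    using cmp_bar_bar(2)[OF assms(1-3)] cmp_bar_bar(2)[OF assms(4-6)] assms(7) by simp
  then have s: "shape_bar \<Lambda> a = shape_bar \<Lambda> a'" "shape_bar \<Lambda> b = shape_bar \<Lambda> b'"
    using assms(8) by auto
  have n: "a = None \<longleftrightarrow> a' = None" "b = None \<longleftrightarrow> b' = None"
    using s assms shape_bar_0 by metis+
  have "a = a' \<and> b = b'"
  proof (cases a; cases b)
    fix c d assume a: "a = Some c" "b = Some d"
    then obtain c' d' where "a' = Some c'" "b' = Some d'" using n by auto
    then show ?thesis
      using a assms s factorization_cancel[of c d c' d'] by (simp add: Some_bar)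
  qed (use n assms(7) in auto)
  then show "a = a'" "b = b'" by auto
qed

definition left_ext :: "'m option \<Rightarrow> 'm option set" where
  "left_ext a = {\<mu> \<in> bar. composable_bar \<Lambda> a \<mu>}"

definition right_ext :: "'m option \<Rightarrow> 'm option set" where
  "right_ext b = {\<mu> \<in> bar. composable_bar \<Lambda> \<mu> b}"

lemma inj_on_left: "a \<in> bar \<Longrightarrow> inj_on (cmp_bar \<Lambda> a) (left_ext a)"
  by (rule inj_onI, rule bar_factorization_cancel(2)[of a _ a]) (auto simp: left_ext_def)

lemma inj_on_right: "b \<in> bar \<Longrightarrow> inj_on (\<lambda>\<mu>. cmp_bar \<Lambda> \<mu> b) (right_ext b)"
  by (rule inj_onI, rule bar_factorization_cancel(1)[of _ b _ b]) (auto simp: right_ext_def)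

lemma left_ext_bar: "left_ext a \<subseteq> bar" and right_ext_bar: "right_ext a \<subseteq> bar"
  by (auto simp: left_ext_def right_ext_def)

lemma left_image_bar: "a \<in> bar \<Longrightarrow> cmp_bar \<Lambda> a ` left_ext a \<subseteq> bar"
  and right_image_bar: "b \<in> bar \<Longrightarrow> (\<lambda>\<mu>. cmp_bar \<Lambda> \<mu> b) ` right_ext b \<subseteq> bar"
  by (auto simp: left_ext_def right_ext_def cmp_bar_bar)

lemma L_op_weighted_shift:
  assumes "Some l \<in> bar"
  shows "L_op \<Lambda> l = weighted_shift bar (left_ext (Some l)) (cmp_bar \<Lambda> (Some l)) (\<lambda>a. 1)"
proof -
  have "{\<mu> \<in> bar. composable_bar \<Lambda> (Some l) \<mu> \<and> cmp_bar \<Lambda> (Some l) \<mu> = \<nu>}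
      = {\<mu>. \<mu> \<in> left_ext (Some l) \<and> cmp_bar \<Lambda> (Some l) \<mu> = \<nu>}" for \<nu>
    by (auto simp: left_ext_def)
  then show ?thesis
    unfolding L_op_def weighted_shift_def
    by (auto intro!: ext simp: sum_unique_preimage[OF inj_on_left[OF assms]])
qed

lemma R_op_weighted_shift:
  assumes "Some l \<in> bar"
  shows "R_op \<Lambda> l = weighted_shift bar (right_ext (Some l)) (\<lambda>\<mu>. cmp_bar \<Lambda> \<mu> (Some l)) (\<lambda>a. 1)"
proof -
  have "{\<mu> \<in> bar. composable_bar \<Lambda> \<mu> (Some l) \<and> cmp_bar \<Lambda> \<mu> (Some l) = \<nu>}
      = {\<mu>. \<mu> \<in> right_ext (Some l) \<and> cmp_bar \<Lambda> \<mu> (Some l) = \<nu>}" for \<nu>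
    by (auto simp: right_ext_def)
  then show ?thesis
    unfolding R_op_def weighted_shift_def
    by (auto intro!: ext simp: sum_unique_preimage[OF inj_on_right[OF assms]])
qed


section \<open>The diagonal algebra\<close>

text \<open>A function stands for its restriction to \<open>bar\<close>; values elsewhere are
  arbitrary and leave the operator unchanged.\<close>

definition diag_functions :: "('m option \<Rightarrow> complex) set" where
  "diag_functions = {f. bounded (f ` bar) \<and> diagonal_op bar f \<in> E_alg \<Lambda>}"

lemma D_alg_eq: "D_alg \<Lambda> = diagonal_op bar ` diag_functions"
  by (auto simp: D_alg_def diagonal_ops_def diag_functions_def)

lemma diag_functions_cong:
  "f \<in> diag_functions \<Longrightarrow> (\<And>a. a \<in> bar \<Longrightarrow> g a = f a) \<Longrightarrow> g \<in> diag_functions"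
  unfolding diag_functions_def using diagonal_op_cong[of bar g f] image_cong[of bar bar g f] by auto

lemma diag_functions_add:
  assumes "f \<in> diag_functions" "g \<in> diag_functions"
  shows "(\<lambda>a. f a + g a) \<in> diag_functions"
  using assms bounded_plus_comp[of f bar g]
  by (auto simp: diag_functions_def E_alg_def diagonal_op_add[symmetric] intro: cstar_gen.add)

lemma diag_functions_mult:
  assumes "f \<in> diag_functions" "g \<in> diag_functions"
  shows "(\<lambda>a. f a * g a) \<in> diag_functions"
  using assms bounded_times_comp[of f bar g]
  by (auto simp: diag_functions_def E_alg_def diagonal_op_comp[symmetric] intro: cstar_gen.mult)

lemma diag_functions_scale:
  assumes "f \<in> diag_functions"
  shows "(\<lambda>a. c * f a) \<in> diag_functions"
  using assms bounded_times_comp[of "\<lambda>a. c" bar f]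
  by (auto simp: diag_functions_def E_alg_def diagonal_op_scale[symmetric] bounded_image_iff intro: cstar_gen.scale)

lemma diag_functions_cnj:
  assumes "f \<in> diag_functions"
  shows "(\<lambda>a. cnj (f a)) \<in> diag_functions"
  using assms is_adjoint_diagonal_op[of f bar]
  by (auto simp: diag_functions_def E_alg_def bounded_image_iff intro: cstar_gen.adj)

lemma diag_functions_diff:
  assumes "f \<in> diag_functions" "g \<in> diag_functions"
  shows "(\<lambda>a. f a - g a) \<in> diag_functions"
  using diag_functions_add[OF assms(1) diag_functions_scale[OF assms(2), of "-1"]] by simp

lemma diag_functions_limit:
  assumes f: "\<And>n::nat. f n \<in> diag_functions"
    and le: "\<And>n a. a \<in> bar \<Longrightarrow> cmod (f n a - g a) \<le> e n" and e: "e \<longlonglongrightarrow> 0"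
  shows "g \<in> diag_functions"
proof -
  have e0: "0 \<le> e n" for n using le[OF None_bar, of n] norm_ge_zero order_trans by blast
  obtain C where C: "\<forall>a\<in>bar. cmod (f 0 a) \<le> C"
    using f[of 0] by (auto simp: diag_functions_def bounded_image_iff)
  have "cmod (g a) \<le> C + e 0" if "a \<in> bar" for a
    using C[rule_format, OF that] le[OF that, of 0] norm_triangle_sub[of "g a" "f 0 a"]
    by (simp add: norm_minus_commute)
  then have b: "bounded (g ` bar)" by (auto simp: bounded_image_iff)
  have eq: "op_add (diagonal_op bar (f n)) (op_scale (-1) (diagonal_op bar g))
      = diagonal_op bar (\<lambda>a. f n a - g a)" for n
    by (simp add: diagonal_op_scale diagonal_op_add)
  have "(\<lambda>n. op_norm bar (op_add (diagonal_op bar (f n)) (op_scale (-1) (diagonal_op bar g)))) \<longlonglongrightarrow> 0"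
    unfolding eq
    by (rule tendsto_sandwich[OF _ _ tendsto_const e]) (auto intro!: always_eventually op_norm_diagonal le e0)
  then have "diagonal_op bar g \<in> E_alg \<Lambda>"
    unfolding E_alg_def
    by (rule cstar_gen.lim[rotated 2]) (use f b in \<open>auto simp: diag_functions_def E_alg_def intro: diagonal_op_bounded_op\<close>)
  then show ?thesis using b by (simp add: diag_functions_def)
qed

definition ind :: "'m option set \<Rightarrow> 'm option \<Rightarrow> complex" where
  "ind S a = (if a \<in> S then 1 else 0)"

text \<open>The traces on \<open>{\<Omega>} \<union> \<Lambda>\<^sup>*\<close> of the clopen subsets of \<open>X\<close>.\<close>

definition clopens :: "'m option set set" where
  "clopens = {S. S \<subseteq> bar \<and> ind S \<in> diag_functions}"

lemma clopens_bar: "S \<in> clopens \<Longrightarrow> S \<subseteq> bar"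
  by (simp add: clopens_def)

lemma clopens_Int:
  assumes "S \<in> clopens" "T \<in> clopens" shows "S \<inter> T \<in> clopens"
proof -
  have "ind (S \<inter> T) \<in> diag_functions"
    by (rule diag_functions_cong[OF diag_functions_mult[of "ind S" "ind T"]])
      (use assms in \<open>auto simp: clopens_def ind_def\<close>)
  then show ?thesis using assms by (auto simp: clopens_def)
qed

lemma clopens_Diff:
  assumes "S \<in> clopens" "T \<in> clopens" shows "S - T \<in> clopens"
proof -
  have "ind (S - T) \<in> diag_functions"
    by (rule diag_functions_cong[OF diag_functions_diff[of "ind S" "ind (S \<inter> T)"]])
      (use assms clopens_Int[OF assms] in \<open>auto simp: clopens_def ind_def\<close>)
  then show ?thesis using assms by (auto simp: clopens_def)
qed

lemma clopens_Un:
  assumes "S \<in> clopens" "T \<in> clopens" shows "S \<union> T \<in> clopens"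
proof -
  have "ind (S \<union> T) \<in> diag_functions"
    by (rule diag_functions_cong[OF diag_functions_add[of "ind S" "ind (T - S)"]])
      (use assms clopens_Diff[OF assms(2,1)] in \<open>auto simp: clopens_def ind_def\<close>)
  then show ?thesis using assms by (auto simp: clopens_def)
qed

text \<open>At this point the empty set is known to be clopen only if some clopen set is given,
  hence the nonempty index set.\<close>

lemma clopens_UN:
  assumes "finite I" "I \<noteq> {}" "\<And>i. i \<in> I \<Longrightarrow> S i \<in> clopens"
  shows "(\<Union>i\<in>I. S i) \<in> clopens"
  using assms by (induction I rule: finite_ne_induct) (auto intro: clopens_Un)

section \<open>Partial isometries of the algebra that come from injections\<close>

definition partial_iso :: "'m option set \<Rightarrow> ('m option \<Rightarrow> 'm option) \<Rightarrow> bool" where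
  "partial_iso d p \<longleftrightarrow> d \<subseteq> bar \<and> p ` d \<subseteq> bar \<and> inj_on p d \<and> weighted_shift bar d p (\<lambda>a. 1) \<in> E_alg \<Lambda>"

lemma partial_iso_adjoint:
  assumes "partial_iso d p"
  shows "is_adjoint bar (weighted_shift bar d p (\<lambda>a. 1)) (weighted_shift bar (p ` d) (inv_into d p) (\<lambda>a. 1))"
  using is_adjoint_weighted_shift[of d bar p "\<lambda>a. 1" 1] assms by (simp add: partial_iso_def)

lemma partial_iso_inverse:
  assumes "partial_iso d p"
  shows "partial_iso (p ` d) (inv_into d p)"
  using assms cstar_gen.adj[OF _ partial_iso_adjoint[OF assms]]
  by (auto simp: partial_iso_def E_alg_def inj_on_inv_into)

lemma partial_iso_pullback:
  assumes "partial_iso d p" "f \<in> diag_functions"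
  shows "(\<lambda>a. if a \<in> d then f (p a) else 0) \<in> diag_functions"
proof -
  have b: "bounded (f ` bar)" using assms by (simp add: diag_functions_def)
  then obtain C where "\<forall>a\<in>bar. cmod (f a) \<le> C" by (auto simp: bounded_image_iff)
  then have "\<forall>a\<in>bar. cmod (if a \<in> d then f (p a) else 0) \<le> max C 0"
    using assms by (auto simp: partial_iso_def le_max_iff_disj)
  then have "bounded ((\<lambda>a. if a \<in> d then f (p a) else 0) ` bar)" unfolding bounded_image_iff by blast
  moreover have "weighted_shift bar (p ` d) (inv_into d p) (\<lambda>a. 1) \<circ> diagonal_op bar f
      \<circ> weighted_shift bar d p (\<lambda>a. 1) \<in> E_alg \<Lambda>"
    using assms partial_iso_inverse[OF assms(1)] unfolding E_alg_def
    by (intro cstar_gen.mult) (auto simp: partial_iso_def E_alg_def diag_functions_def)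
  ultimately show ?thesis
    using weighted_shift_conj_diagonal[of d bar p f] assms b
    by (simp add: diag_functions_def partial_iso_def)
qed

text \<open>The initial projection \<open>U* U\<close> of the shift \<open>U\<close> is the
  indicator of \<open>d\<close>.\<close>

lemma partial_iso_clopen: 
  assumes "partial_iso d p" shows "d \<in> clopens"
proof -
  have "weighted_shift bar (p ` d) (inv_into d p) (\<lambda>a. 1) \<circ> weighted_shift bar d p (\<lambda>a. 1) \<in> E_alg \<Lambda>"
    using assms partial_iso_inverse[OF assms] unfolding E_alg_def
    by (intro cstar_gen.mult) (auto simp: partial_iso_def E_alg_def)
  moreover have "ind d = (\<lambda>a. if a \<in> d then 1 else 0)" by (auto simp: ind_def)
  ultimately show ?thesis
    using weighted_shift_adjoint_comp[of d bar p] assms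
    by (auto simp: clopens_def diag_functions_def partial_iso_def bounded_image_iff intro!: exI[of _ 1])
qed

lemma partial_iso_left: "Some a \<in> bar \<Longrightarrow> partial_iso (left_ext (Some a)) (cmp_bar \<Lambda> (Some a))"
  unfolding partial_iso_def
  by (simp add: left_ext_bar left_image_bar inj_on_left L_op_weighted_shift[symmetric] E_alg_def
      cstar_gen.gen mor_star_iff)

lemma partial_iso_right: "Some b \<in> bar \<Longrightarrow> partial_iso (right_ext (Some b)) (\<lambda>\<mu>. cmp_bar \<Lambda> \<mu> (Some b))"
  unfolding partial_iso_def
  by (simp add: right_ext_bar right_image_bar inj_on_right R_op_weighted_shift[symmetric] E_alg_def
      cstar_gen.gen mor_star_iff)

section \<open>Source sets and the unit of the algebra\<close>

lemma obj_finite: "finite (obj \<Lambda>)"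
proof -
  have "ident \<Lambda> ` obj \<Lambda> \<subseteq> {a \<in> mor \<Lambda>. shape \<Lambda> a = 0}" by (auto simp: ident_mor shape_ident)
  moreover have "finite {a \<in> mor \<Lambda>. shape \<Lambda> a = 0}" using condition_F by (simp add: condition_F_def)
  moreover have "inj_on (ident \<Lambda>) (obj \<Lambda>)" by (rule inj_on_inverseI[where g = "src \<Lambda>"]) (rule src_ident)
  ultimately show ?thesis by (meson finite_imageD finite_subset)
qed

lemma obj_nonempty: "obj \<Lambda> \<noteq> {}"
proof -
  have "{a \<in> mor \<Lambda>. shape \<Lambda> a = 0} \<noteq> {}" using condition_F unfolding condition_F_def by blast
  then show ?thesis using src_obj by blast
qed

text \<open>\<Omega> belongs to the set for every \<open>v\<close>, being composable with
  everything. This makes it the exact domain of right multiplication by a morphism with terminus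
  \<open>v\<close>.\<close>

definition src_set :: "'o \<Rightarrow> 'm option set" where
  "src_set v = {\<mu> \<in> bar. case \<mu> of None \<Rightarrow> True | Some a \<Rightarrow> src \<Lambda> a = v}"

lemma right_ext_Some: "right_ext (Some a) = src_set (tgt \<Lambda> a)"
  unfolding right_ext_def src_set_def by (rule Collect_cong) (auto split: option.splits)

lemma src_set_clopen:
  assumes "v \<in> obj \<Lambda>" shows "src_set v \<in> clopens"
proof -
  \<comment> \<open>Here 1 is the all-ones vector. A nonzero shape is required, since only such
    morphisms have an operator \<open>R_op\<close> among the generators.\<close>
  have "{a \<in> mor \<Lambda>. shape \<Lambda> a = 1 \<and> tgt \<Lambda> a = v} \<noteq> {}" 
    using assms condition_F unfolding condition_F_def by blast
  then obtain a where "a \<in> mor \<Lambda>" "shape \<Lambda> a = 1" "tgt \<Lambda> a = v" by blast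
  then show ?thesis using partial_iso_clopen[OF partial_iso_right[of a]]
    by (simp add: Some_bar right_ext_Some)
qed

lemma UN_src_set: "(\<Union>v\<in>obj \<Lambda>. src_set v) = bar"
proof
  show "bar \<subseteq> (\<Union>v\<in>obj \<Lambda>. src_set v)"
  proof
    fix \<mu> assume "\<mu> \<in> bar"
    then show "\<mu> \<in> (\<Union>v\<in>obj \<Lambda>. src_set v)"
      using obj_nonempty by (cases \<mu>) (auto simp: src_set_def Some_bar src_obj)
  qed
qed (auto simp: src_set_def)

text \<open>This is the unit of the diagonal algebra; it makes constant functions, and with them
  power series, available.\<close>

lemma bar_clopen: "bar \<in> clopens"
  using clopens_UN[OF obj_finite obj_nonempty, of src_set] src_set_clopen by (simp add: UN_src_set)

lemma diag_functions_const: "(\<lambda>a. c) \<in> diag_functions"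
  by (rule diag_functions_cong[OF diag_functions_scale[of "ind bar" c]])
    (use bar_clopen in \<open>auto simp: clopens_def ind_def\<close>)

lemma diag_functions_sum:
  assumes "finite I" "\<And>i. i \<in> I \<Longrightarrow> f i \<in> diag_functions"
  shows "(\<lambda>a. \<Sum>i\<in>I. f i a) \<in> diag_functions"
  using assms by (induction I rule: finite_induct) (auto intro: diag_functions_const diag_functions_add)

lemma diag_functions_power: "f \<in> diag_functions \<Longrightarrow> (\<lambda>a. f a ^ n) \<in> diag_functions"
  by (induction n) (auto intro: diag_functions_const diag_functions_mult)


section \<open>Characters evaluated on functions\<close>

definition ev :: "'m point \<Rightarrow> ('m option \<Rightarrow> complex) \<Rightarrow> complex" where
  "ev x f = x (diagonal_op bar f)"

lemma topspace_X: "X_set \<Lambda> = characters (D_alg \<Lambda>)"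
  by (auto simp: X_top_def gelfand_spectrum_def characters_def PiE_def)

lemma bounded_diag_function: "f \<in> diag_functions \<Longrightarrow> bounded (f ` bar)"
  by (simp add: diag_functions_def)

lemma diag_function_D: "f \<in> diag_functions \<Longrightarrow> diagonal_op bar f \<in> D_alg \<Lambda>"
  by (simp add: D_alg_eq)

lemma ev_cong: "(\<And>a. a \<in> bar \<Longrightarrow> f a = g a) \<Longrightarrow> ev x f = ev x g"
  unfolding ev_def using diagonal_op_cong[of bar f g] by auto

lemma ev_add: "x \<in> X_set \<Lambda> \<Longrightarrow> f \<in> diag_functions \<Longrightarrow> g \<in> diag_functions \<Longrightarrow>
    ev x (\<lambda>a. f a + g a) = ev x f + ev x g"
  by (simp add: topspace_X ev_def diagonal_op_add[symmetric] characters_def diag_function_D)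

lemma ev_scale: "x \<in> X_set \<Lambda> \<Longrightarrow> f \<in> diag_functions \<Longrightarrow> ev x (\<lambda>a. c * f a) = c * ev x f"
  by (simp add: topspace_X ev_def diagonal_op_scale[symmetric] characters_def diag_function_D)

lemma ev_mult: "x \<in> X_set \<Lambda> \<Longrightarrow> f \<in> diag_functions \<Longrightarrow> g \<in> diag_functions \<Longrightarrow>
    ev x (\<lambda>a. f a * g a) = ev x f * ev x g"
  by (simp add: topspace_X ev_def diagonal_op_comp[symmetric] bounded_diag_function characters_def diag_function_D)

lemma X_setI:
  assumes "x \<in> extensional (D_alg \<Lambda>)"
    and "\<And>f g. f \<in> diag_functions \<Longrightarrow> g \<in> diag_functions \<Longrightarrow> ev x (\<lambda>a. f a + g a) = ev x f + ev x g"
    and "\<And>c f. f \<in> diag_functions \<Longrightarrow> ev x (\<lambda>a. c * f a) = c * ev x f"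
    and "\<And>f g. f \<in> diag_functions \<Longrightarrow> g \<in> diag_functions \<Longrightarrow> ev x (\<lambda>a. f a * g a) = ev x f * ev x g"
    and "f \<in> diag_functions" "ev x f \<noteq> 0"
  shows "x \<in> X_set \<Lambda>"
  using assms
  by (auto simp: topspace_X characters_def D_alg_eq diagonal_op_add diagonal_op_scale diagonal_op_comp
      bounded_diag_function ev_def)

lemma X_eqI:
  assumes "x \<in> extensional (D_alg \<Lambda>)" "y \<in> extensional (D_alg \<Lambda>)"
    and "\<And>f. f \<in> diag_functions \<Longrightarrow> ev x f = ev y f"
  shows "x = y"
  by (rule extensionalityI[OF assms(1,2)]) (use assms(3) in \<open>auto simp: D_alg_eq ev_def\<close>)

lemma X_extensional: "x \<in> X_set \<Lambda> \<Longrightarrow> x \<in> extensional (D_alg \<Lambda>)"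
  by (simp add: topspace_X characters_def)

lemma ev_one:
  assumes x: "x \<in> X_set \<Lambda>" shows "ev x (\<lambda>a. 1) = 1"
proof -
  obtain f where f: "f \<in> diag_functions" "ev x f \<noteq> 0"
    using x by (auto simp: topspace_X characters_def D_alg_eq ev_def)
  have "ev x f * ev x (\<lambda>a. 1) = ev x f"
    using ev_mult[OF x f(1) diag_functions_const, of 1] by simp
  then show ?thesis using f(2) by simp
qed

lemma ev_const: "x \<in> X_set \<Lambda> \<Longrightarrow> ev x (\<lambda>a. c) = c"
  using ev_scale[OF _ diag_functions_const, of x c 1] ev_one[of x] by simp

lemma ev_diff: "x \<in> X_set \<Lambda> \<Longrightarrow> f \<in> diag_functions \<Longrightarrow> g \<in> diag_functions \<Longrightarrow>
    ev x (\<lambda>a. f a - g a) = ev x f - ev x g"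
  using ev_add[OF _ _ diag_functions_scale[of g "-1"], of x f] ev_scale[of x g "-1"] by simp

lemma ev_sum:
  assumes "x \<in> X_set \<Lambda>" "finite I" "\<And>i. i \<in> I \<Longrightarrow> f i \<in> diag_functions"
  shows "ev x (\<lambda>a. \<Sum>i\<in>I. f i a) = (\<Sum>i\<in>I. ev x (f i))"
  using assms(2,3)
  by (induction I rule: finite_induct) (simp_all add: ev_const ev_add diag_functions_sum assms(1))

text \<open>A function bounded below is inverted inside the algebra by a Neumann series.\<close>

lemma ev_nonzero:
  assumes x: "x \<in> X_set \<Lambda>" and f: "(\<lambda>a. complex_of_real (f a)) \<in> diag_functions"
    and \<delta>: "\<delta> > 0" "\<And>a. a \<in> bar \<Longrightarrow> f a \<ge> \<delta>"
  shows "ev x (\<lambda>a. complex_of_real (f a)) \<noteq> 0"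
proof -
  let ?f = "\<lambda>a. complex_of_real (f a)"
  obtain C where C: "\<forall>a\<in>bar. \<bar>f a\<bar> \<le> C"
    using bounded_diag_function[OF f] by (auto simp: bounded_image_iff)
  have "f None \<le> C" using C[rule_format, OF None_bar] by linarith
  then have C0: "\<delta> \<le> C" "C > 0" using \<delta>(1) \<delta>(2)[OF None_bar] by linarith+
  \<comment> \<open>Partial sums of the series for \<open>1 / f\<close> in powers of
    \<open>1 - f / C\<close>. On \<open>bar\<close> that ratio lies between 0 and
    \<open>1 - \<delta> / C\<close>, which gives a uniform rate of convergence.\<close>
  define h where "h n a = (\<Sum>i<n. complex_of_real (1 / C) * (1 - complex_of_real (1 / C) * ?f a) ^ i)" for n a
  have h: "h n \<in> diag_functions" for n
    unfolding h_def[abs_def]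
    by (intro diag_functions_sum diag_functions_scale diag_functions_power diag_functions_diff
        diag_functions_const f) simp
  have "cmod (h n a - 1 / ?f a) \<le> (1 - \<delta> / C) ^ n / \<delta>" if a: "a \<in> bar" for n a
  proof -
    have fa: "\<delta> \<le> f a" "f a \<le> C" "f a > 0" using \<delta> C a by force+
    define q where "q = 1 - f a / C"
    have q: "0 \<le> q" "q \<le> 1 - \<delta> / C" using fa C0 by (auto simp: q_def field_simps)
    have "h n a = complex_of_real (1 / C * (\<Sum>i<n. q ^ i))"
      by (simp add: h_def q_def sum_distrib_left)
    also have "(\<Sum>i<n. q ^ i) = (1 - q ^ n) / (1 - q)"
      using fa C0 by (subst sum_gp_strict) (auto simp: q_def)
    also have "1 / C * ((1 - q ^ n) / (1 - q)) = 1 / f a - q ^ n / f a"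
      using fa C0 by (simp add: q_def diff_divide_distrib)
    finally have "h n a - 1 / ?f a = complex_of_real (- (q ^ n / f a))" by simp
    also have "cmod \<dots> = q ^ n / f a" using fa q by (simp add: norm_divide norm_power)
    also have "\<dots> \<le> (1 - \<delta> / C) ^ n / \<delta>" using fa q \<delta>(1) by (intro frac_le power_mono) auto
    finally show ?thesis .
  qed
  moreover have "(\<lambda>n. (1 - \<delta> / C) ^ n / \<delta>) \<longlonglongrightarrow> 0"
    using C0 \<delta>(1) by (intro tendsto_divide_zero LIMSEQ_power_zero) (auto simp: field_simps)
  ultimately have g: "(\<lambda>a. 1 / ?f a) \<in> diag_functions"
    by (intro diag_functions_limit[OF h]) auto
  have "ev x ?f * ev x (\<lambda>a. 1 / ?f a) = ev x (\<lambda>a. 1)"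
    unfolding ev_mult[OF x f g, symmetric] by (rule ev_cong) (use \<delta> in force)
  then show ?thesis using ev_one[OF x] by auto
qed

lemma ev_pt: "\<mu> \<in> bar \<Longrightarrow> f \<in> diag_functions \<Longrightarrow> ev (pt \<Lambda> \<mu>) f = f \<mu>"
  by (simp add: ev_def pt_def diag_function_D diagonal_op_ket)

lemma pt_extensional: "pt \<Lambda> \<mu> \<in> extensional (D_alg \<Lambda>)"
  by (simp add: pt_def)

lemma pt_X: "\<mu> \<in> bar \<Longrightarrow> pt \<Lambda> \<mu> \<in> X_set \<Lambda>"
  by (rule X_setI[of _ "\<lambda>a. 1"])
    (simp_all add: ev_pt diag_functions_add diag_functions_scale diag_functions_mult diag_functions_const pt_extensional)

text \<open>A point of the spectrum acts on projections as an ultrafilter of clopen sets.\<close>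

definition lies_in :: "'m point \<Rightarrow> 'm option set \<Rightarrow> bool" where
  "lies_in x S \<longleftrightarrow> ev x (ind S) = 1"

lemma ind_diag: "S \<in> clopens \<Longrightarrow> ind S \<in> diag_functions"
  by (simp add: clopens_def)

lemma ev_ind_Int:
  assumes "x \<in> X_set \<Lambda>" "S \<in> clopens" "T \<in> clopens"
  shows "ev x (ind (S \<inter> T)) = ev x (ind S) * ev x (ind T)"
  unfolding ev_mult[OF assms(1) ind_diag[OF assms(2)] ind_diag[OF assms(3)], symmetric]
  by (rule ev_cong) (simp add: ind_def)

text \<open>The value of a character on an idempotent is an idempotent complex number.\<close>

lemma ev_ind_0_1:
  assumes "x \<in> X_set \<Lambda>" "S \<in> clopens"
  shows "ev x (ind S) = 0 \<or> ev x (ind S) = 1"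
  using ev_ind_Int[OF assms assms(2)] by auto

lemma lies_in_Int:
  assumes "x \<in> X_set \<Lambda>" "S \<in> clopens" "T \<in> clopens"
  shows "lies_in x (S \<inter> T) \<longleftrightarrow> lies_in x S \<and> lies_in x T"
  using ev_ind_Int[OF assms] ev_ind_0_1[OF assms(1,2)] ev_ind_0_1[OF assms(1,3)]
  by (auto simp: lies_in_def)

lemma lies_in_Diff:
  assumes "x \<in> X_set \<Lambda>" "S \<in> clopens" "T \<in> clopens"
  shows "lies_in x (S - T) \<longleftrightarrow> lies_in x S \<and> \<not> lies_in x T"
proof -
  note ST = clopens_Int[OF assms(2,3)]
  have "ev x (ind (S - T)) = ev x (ind S) - ev x (ind (S \<inter> T))"
    unfolding ev_diff[OF assms(1) ind_diag[OF assms(2)] ind_diag[OF ST], symmetric]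
    by (rule ev_cong) (simp add: ind_def)
  then show ?thesis
    using ev_ind_Int[OF assms] ev_ind_0_1[OF assms(1,2)] ev_ind_0_1[OF assms(1,3)]
    by (auto simp: lies_in_def)
qed

lemma lies_in_bar: "x \<in> X_set \<Lambda> \<Longrightarrow> lies_in x bar"
  unfolding lies_in_def by (subst ev_cong[of _ "\<lambda>a. 1"]) (auto simp: ind_def ev_one)

lemma lies_in_empty: "x \<in> X_set \<Lambda> \<Longrightarrow> \<not> lies_in x {}"
  using lies_in_Diff[of x bar bar] bar_clopen by simp

lemma lies_in_mono:
  assumes "x \<in> X_set \<Lambda>" "S \<in> clopens" "T \<in> clopens" "S \<subseteq> T" "lies_in x S"
  shows "lies_in x T"
  using lies_in_Int[OF assms(1-3)] assms(4,5) by (simp add: Int_absorb2)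

lemma lies_in_Un:
  assumes "x \<in> X_set \<Lambda>" "S \<in> clopens" "T \<in> clopens"
  shows "lies_in x (S \<union> T) \<longleftrightarrow> lies_in x S \<or> lies_in x T"
proof -
  have "S \<union> T - T = S - T" by auto
  then show ?thesis
    using lies_in_mono[OF assms(1,2) clopens_Un[OF assms(2,3)]] lies_in_mono[OF assms(1,3) clopens_Un[OF assms(2,3)]]
      lies_in_Diff[OF assms(1) clopens_Un[OF assms(2,3)] assms(3)] lies_in_Diff[OF assms] by auto
qed

lemma lies_in_UN:
  assumes "x \<in> X_set \<Lambda>" "finite I" "I \<noteq> {}" "\<And>i. i \<in> I \<Longrightarrow> S i \<in> clopens" "lies_in x (\<Union>i\<in>I. S i)"
  obtains i where "i \<in> I" "lies_in x (S i)"
proof -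
  have "\<exists>i\<in>I. lies_in x (S i)"
    using assms(2-5)
  proof (induction I rule: finite_ne_induct)
    case (insert i I)
    then show ?case using lies_in_Un[OF assms(1), of "S i" "\<Union>i\<in>I. S i"] clopens_UN[of I S] by auto
  qed simp
  then show thesis using that by blast
qed

lemma lies_in_pt: "\<mu> \<in> bar \<Longrightarrow> S \<in> clopens \<Longrightarrow> lies_in (pt \<Lambda> \<mu>) S \<longleftrightarrow> \<mu> \<in> S"
  by (simp add: lies_in_def ev_pt ind_diag) (simp add: ind_def)

section \<open>Density of the points of \<open>bar\<close>\<close>

lemma openin_X_eval:
  assumes f: "f \<in> diag_functions" and W: "open W"
  shows "openin (X_top \<Lambda>) {x \<in> X_set \<Lambda>. ev x f \<in> W}"
proof -
  have "continuous_map (X_top \<Lambda>) euclidean (\<lambda>x. x (diagonal_op bar f))"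
    unfolding X_top_def gelfand_spectrum_def
    by (intro continuous_map_from_subtopology continuous_map_product_projection diag_function_D f)
  then show ?thesis using W by (auto simp: continuous_map_def ev_def)
qed

lemma openin_lies_in:
  assumes "S \<in> clopens"
  shows "openin (X_top \<Lambda>) {x \<in> X_set \<Lambda>. lies_in x S}"
proof -
  have "{x \<in> X_set \<Lambda>. lies_in x S} = {x \<in> X_set \<Lambda>. ev x (ind S) \<in> - {0}}"
    using ev_ind_0_1[OF _ assms] by (auto simp: lies_in_def)
  then show ?thesis using openin_X_eval[OF ind_diag[OF assms], of "- {0}"] by (simp add: open_Compl)
qed

text \<open>A localized form of density: the approximating point can be chosen in any clopen set in
  which \<open>x\<close> lies. Otherwise each member of \<open>S\<close> violates one of the
  finitely many conditions of a basic neighbourhood. The sum of the squared deviations, plus the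
  indicator of the complement of \<open>S\<close>, is then bounded below on \<open>bar\<close>,
  although \<open>x\<close> takes the value 0 on it.\<close>

lemma pt_dense:
  assumes U: "openin (X_top \<Lambda>) U" "x \<in> U" and S: "S \<in> clopens" "lies_in x S"
  shows "\<exists>\<mu>\<in>S. pt \<Lambda> \<mu> \<in> U"
proof (rule ccontr)
  assume "\<not> ?thesis"
  then have not: "pt \<Lambda> \<mu> \<notin> U" if "\<mu> \<in> S" for \<mu> using that by blast
  have x: "x \<in> X_set \<Lambda>" using U openin_subset by blast
  obtain W where W: "openin (product_topology (\<lambda>T. euclidean) (D_alg \<Lambda>)) W"
    "U = W \<inter> characters (D_alg \<Lambda>)"
    using U(1) by (auto simp: X_top_def gelfand_spectrum_def openin_subtopology)
  then have "x \<in> W" using U(2) by simp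
  with W(1) obtain V where V: "finite {T \<in> D_alg \<Lambda>. V T \<noteq> UNIV}" "\<And>T. T \<in> D_alg \<Lambda> \<Longrightarrow> open (V T)"
    "x \<in> PiE (D_alg \<Lambda>) V" "PiE (D_alg \<Lambda>) V \<subseteq> W"
    unfolding openin_product_topology_alt by (auto simp: open_openin[symmetric])
  define F where "F = {T \<in> D_alg \<Lambda>. V T \<noteq> UNIV}"
  have "\<exists>e>0. ball (x T) e \<subseteq> V T" if "T \<in> F" for T
    using V that by (auto simp: F_def open_contains_ball)
  then obtain e where e: "\<And>T. T \<in> F \<Longrightarrow> e T > 0" "\<And>T. T \<in> F \<Longrightarrow> ball (x T) (e T) \<subseteq> V T" by metis
  \<comment> \<open>The inserted 1 keeps the minimum defined for empty \<open>F\<close> and gives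
    \<open>\<epsilon>\<^sup>2 \<le> 1\<close>, the bound needed off \<open>S\<close>.\<close>
  define \<epsilon> where "\<epsilon> = Min (insert 1 (e ` F))"
  have F: "finite F" using V(1) by (simp add: F_def)
  have \<epsilon>: "\<epsilon> > 0" "\<epsilon> \<le> 1" "\<And>T. T \<in> F \<Longrightarrow> \<epsilon> \<le> e T" using F e(1) by (auto simp: \<epsilon>_def)
  define c where "c T a = T (ket a) a" for T :: "'m option op" and a
  have cF: "c T \<in> diag_functions" "diagonal_op bar (c T) = T" if TF: "T \<in> F" for T
  proof -
    obtain f where f: "f \<in> diag_functions" "T = diagonal_op bar f"
      using TF unfolding F_def D_alg_eq by blast
    have "c T a = f a" if "a \<in> bar" for a using that by (simp add: c_def f diagonal_op_ket)
    then show "c T \<in> diag_functions" "diagonal_op bar (c T) = T"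
      using f diag_functions_cong[OF f(1)] diagonal_op_cong by metis+
  qed
  have far: "\<exists>T\<in>F. \<epsilon> \<le> cmod (c T \<mu> - x T)" if "\<mu> \<in> S" for \<mu>
  proof (rule ccontr)
    assume near: "\<not> ?thesis"
    have \<mu>: "\<mu> \<in> bar" using that clopens_bar[OF S(1)] by blast
    have "pt \<Lambda> \<mu> T \<in> V T" if T: "T \<in> D_alg \<Lambda>" for T
    proof (cases "T \<in> F")
      case True
      then have "dist (x T) (c T \<mu>) < e T" using near \<epsilon>(3)[OF True] by (force simp: dist_norm norm_minus_commute)
      then show ?thesis using e(2)[OF True] T by (auto simp: pt_def c_def)
    next
      case False
      then show ?thesis using T by (simp add: F_def)
    qed
    then have "pt \<Lambda> \<mu> \<in> W" using V(4) by (auto simp: pt_def)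
    then have "pt \<Lambda> \<mu> \<in> U" using pt_X[OF \<mu>] W(2) by (simp add: topspace_X)
    then show False using not[OF that] by blast
  qed
  define f where "f a = (\<Sum>T\<in>F. (cmod (c T a - x T))\<^sup>2) + (if a \<in> S then 0 else 1)" for a
  have S': "bar - S \<in> clopens" by (rule clopens_Diff[OF bar_clopen S(1)])
  have f_eq: "complex_of_real (f a) = (\<Sum>T\<in>F. (c T a - x T) * cnj (c T a - x T)) + ind (bar - S) a"
    if "a \<in> bar" for a using that by (simp add: f_def ind_def complex_norm_square[symmetric] del: complex_cnj_diff)
  have d: "(\<lambda>a. c T a - x T) \<in> diag_functions" "(\<lambda>a. cnj (c T a - x T)) \<in> diag_functions" if "T \<in> F" for T
    using diag_functions_diff[OF cF(1)[OF that] diag_functions_const]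
      diag_functions_cnj[OF diag_functions_diff[OF cF(1)[OF that] diag_functions_const]] by auto
  have s: "(\<lambda>a. \<Sum>T\<in>F. (c T a - x T) * cnj (c T a - x T)) \<in> diag_functions"
    by (intro diag_functions_sum[OF F] diag_functions_mult d)
  have "(\<lambda>a. (\<Sum>T\<in>F. (c T a - x T) * cnj (c T a - x T)) + ind (bar - S) a) \<in> diag_functions"
    by (intro diag_functions_add s ind_diag S')
  then have fD: "(\<lambda>a. complex_of_real (f a)) \<in> diag_functions"
    by (rule diag_functions_cong) (rule f_eq)
  have "ev x (\<lambda>a. complex_of_real (f a))
      = ev x (\<lambda>a. (\<Sum>T\<in>F. (c T a - x T) * cnj (c T a - x T)) + ind (bar - S) a)"
    by (rule ev_cong) (rule f_eq)
  also have "\<dots> = ev x (\<lambda>a. (\<Sum>T\<in>F. (c T a - x T) * cnj (c T a - x T))) + ev x (ind (bar - S))"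
    by (rule ev_add[OF x s ind_diag[OF S']])
  also have "ev x (ind (bar - S)) = 0"
    using lies_in_Diff[OF x bar_clopen S(1)] S(2) ev_ind_0_1[OF x S'] by (auto simp: lies_in_def)
  also have "ev x (\<lambda>a. (\<Sum>T\<in>F. (c T a - x T) * cnj (c T a - x T)))
      = (\<Sum>T\<in>F. ev x (\<lambda>a. c T a - x T) * ev x (\<lambda>a. cnj (c T a - x T)))"
    using ev_sum[OF x F, of "\<lambda>T a. (c T a - x T) * cnj (c T a - x T)"] ev_mult[OF x d]
    by (simp add: diag_functions_mult d del: complex_cnj_diff)
  also have "\<dots> = 0"
  proof (rule sum.neutral, rule ballI)
    \<comment> \<open>Characters are not assumed to respect conjugation. The value of the conjugate
      factor is never computed, as the other factor already evaluates to 0.\<close>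
    fix T assume T: "T \<in> F"
    have "ev x (\<lambda>a. c T a - x T) = x T - x T"
      unfolding ev_diff[OF x cF(1)[OF T] diag_functions_const] ev_const[OF x]
      by (simp add: ev_def cF(2)[OF T])
    then show "ev x (\<lambda>a. c T a - x T) * ev x (\<lambda>a. cnj (c T a - x T)) = 0" by simp
  qed
  finally have "ev x (\<lambda>a. complex_of_real (f a)) = 0" by simp
  moreover have "\<epsilon>\<^sup>2 \<le> f a" if "a \<in> bar" for a
  proof (cases "a \<in> S")
    case True
    then obtain T where T: "T \<in> F" "\<epsilon> \<le> cmod (c T a - x T)" using far by blast
    then have "\<epsilon>\<^sup>2 \<le> (cmod (c T a - x T))\<^sup>2" using \<epsilon>(1) by (simp add: power_mono)
    also have "\<dots> \<le> (\<Sum>T\<in>F. (cmod (c T a - x T))\<^sup>2)" using T(1) F by (intro member_le_sum) auto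
    finally show ?thesis using True by (simp add: f_def)
  next
    case False
    then show ?thesis using \<epsilon> by (simp add: f_def add_increasing sum_nonneg power_le_one)
  qed
  ultimately show False using ev_nonzero[OF x fD, of "\<epsilon>\<^sup>2"] \<epsilon>(1) by simp
qed


section \<open>Partial isometries acting on the spectrum\<close>

text \<open>The map of points induced by \<open>p\<close>, described by its effect on clopen sets alone.\<close>

definition induced :: "'m option set \<Rightarrow> ('m option \<Rightarrow> 'm option) \<Rightarrow> ('m point \<Rightarrow> 'm point) \<Rightarrow> bool" where
  "induced d p M \<longleftrightarrow> d \<in> clopens \<and> p ` d \<subseteq> bar \<and> inj_on p d \<and>
     (\<forall>S\<in>clopens. {\<mu> \<in> d. p \<mu> \<in> S} \<in> clopens) \<and>
     (\<forall>S\<in>clopens. S \<subseteq> d \<longrightarrow> p ` S \<in> clopens) \<and>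
     (\<forall>x\<in>X_set \<Lambda>. lies_in x d \<longrightarrow> M x \<in> X_set \<Lambda> \<and>
        (\<forall>S\<in>clopens. lies_in (M x) S \<longleftrightarrow> lies_in x {\<mu> \<in> d. p \<mu> \<in> S})) \<and>
     inj_on M {x \<in> X_set \<Lambda>. lies_in x d} \<and>
     (\<forall>x\<in>X_set \<Lambda>. lies_in x (p ` d) \<longrightarrow> (\<exists>x'\<in>X_set \<Lambda>. lies_in x' d \<and> M x' = x))"

lemma induced_identity: "induced bar (\<lambda>\<mu>. \<mu>) (\<lambda>x. x)"
proof -
  have "{\<mu> \<in> bar. \<mu> \<in> S} = S" if "S \<in> clopens" for S using clopens_bar[OF that] by auto
  then show ?thesis by (auto simp: induced_def bar_clopen lies_in_bar)
qed

lemma partial_iso_op_adj: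
  "partial_iso d p \<Longrightarrow>
    op_adj bar (weighted_shift bar d p (\<lambda>a. 1)) = weighted_shift bar (p ` d) (inv_into d p) (\<lambda>a. 1)"
  by (rule op_adj_eqI[OF partial_iso_adjoint])

lemma op_dom_iff:
  assumes "partial_iso d p"
  shows "x \<in> op_dom \<Lambda> (weighted_shift bar d p (\<lambda>a. 1)) \<longleftrightarrow> x \<in> X_set \<Lambda> \<and> lies_in x d"
proof -
  have "(\<lambda>a. if a \<in> d then 1 else 0) = ind d" by (auto simp: ind_def)
  then show ?thesis
    using assms weighted_shift_adjoint_comp[of d bar p]
    by (simp add: op_dom_def partial_iso_op_adj partial_iso_def lies_in_def ev_def)
qed

lemma ev_op_move:
  assumes "partial_iso d p" "f \<in> diag_functions"
  shows "ev (op_move \<Lambda> (weighted_shift bar d p (\<lambda>a. 1)) x) f = ev x (\<lambda>a. if a \<in> d then f (p a) else 0)"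
  using assms weighted_shift_conj_diagonal[of d bar p f]
  by (simp add: op_move_def ev_def diag_function_D partial_iso_op_adj bounded_diag_function partial_iso_def)

lemma ev_supported:
  assumes x: "x \<in> X_set \<Lambda>" and S: "S \<in> clopens" "lies_in x S" and f: "f \<in> diag_functions"
    and g: "\<And>a. a \<in> bar \<Longrightarrow> g a = ind S a * f a"
  shows "ev x g = ev x f"
proof -
  have "ev x g = ev x (\<lambda>a. ind S a * f a)" by (rule ev_cong) (rule g)
  then show ?thesis using S(2) by (simp add: ev_mult[OF x ind_diag[OF S(1)] f] lies_in_def)
qed

text \<open>Pullback along \<open>p\<close> is linear and multiplicative. It sends 1 to the
  indicator of \<open>d\<close>, so lying in \<open>d\<close> is what keeps the transported
  character nonzero.\<close>

lemma op_move_X: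
  assumes "partial_iso d p" "x \<in> X_set \<Lambda>" "lies_in x d"
  shows "op_move \<Lambda> (weighted_shift bar d p (\<lambda>a. 1)) x \<in> X_set \<Lambda>"
proof (rule X_setI[of _ "\<lambda>a. 1"])
  let ?M = "op_move \<Lambda> (weighted_shift bar d p (\<lambda>a. 1)) x"
  note pb = partial_iso_pullback[OF assms(1)]
  show "?M \<in> extensional (D_alg \<Lambda>)" by (simp add: op_move_def)
  show "ev ?M (\<lambda>a. f a + g a) = ev ?M f + ev ?M g"
    if f: "f \<in> diag_functions" and g: "g \<in> diag_functions" for f g
    unfolding ev_op_move[OF assms(1) f] ev_op_move[OF assms(1) g]
      ev_op_move[OF assms(1) diag_functions_add[OF f g]] ev_add[OF assms(2) pb[OF f] pb[OF g], symmetric]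
    by (rule ev_cong) simp
  show "ev ?M (\<lambda>a. c * f a) = c * ev ?M f" if f: "f \<in> diag_functions" for c f
    unfolding ev_op_move[OF assms(1) f]
      ev_op_move[OF assms(1) diag_functions_scale[OF f]] ev_scale[OF assms(2) pb[OF f], symmetric]
    by (rule ev_cong) simp
  show "ev ?M (\<lambda>a. f a * g a) = ev ?M f * ev ?M g"
    if f: "f \<in> diag_functions" and g: "g \<in> diag_functions" for f g
    unfolding ev_op_move[OF assms(1) f] ev_op_move[OF assms(1) g]
      ev_op_move[OF assms(1) diag_functions_mult[OF f g]] ev_mult[OF assms(2) pb[OF f] pb[OF g], symmetric]
    by (rule ev_cong) simp
  show "(\<lambda>a. 1) \<in> diag_functions" by (rule diag_functions_const)
  then have "ev ?M (\<lambda>a. 1) = ev x (\<lambda>a. if a \<in> d then 1 else 0)" by (rule ev_op_move[OF assms(1)])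
  also have "\<dots> = ev x (ind d)" by (rule ev_cong) (simp add: ind_def)
  finally show "ev ?M (\<lambda>a. 1) \<noteq> 0" using assms(3) by (simp add: lies_in_def)
qed

text \<open>The double transport pulls functions back along the composite of \<open>p\<close> and
  \<open>p'\<close>, which is the identity on \<open>d\<close>; values off \<open>d\<close> do not
  affect \<open>x\<close>.\<close>

lemma op_move_op_move:
  assumes "partial_iso d p" "partial_iso d' p'" and x: "x \<in> X_set \<Lambda>" "lies_in x d"
    and "p ` d \<subseteq> d'" "\<And>a. a \<in> d \<Longrightarrow> p' (p a) = a"
  shows "op_move \<Lambda> (weighted_shift bar d' p' (\<lambda>a. 1)) (op_move \<Lambda> (weighted_shift bar d p (\<lambda>a. 1)) x) = x"
proof (rule X_eqI)
  fix f assume f: "f \<in> diag_functions"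
  show "ev (op_move \<Lambda> (weighted_shift bar d' p' (\<lambda>a. 1)) (op_move \<Lambda> (weighted_shift bar d p (\<lambda>a. 1)) x)) f = ev x f"
    unfolding ev_op_move[OF assms(2) f] ev_op_move[OF assms(1) partial_iso_pullback[OF assms(2) f]]
    by (rule ev_supported[OF x(1) partial_iso_clopen[OF assms(1)] x(2) f])
      (use assms(5,6) in \<open>auto simp: ind_def\<close>)
qed (use x X_extensional in \<open>auto simp: op_move_def\<close>)

lemma pullback_clopen:
  assumes p: "partial_iso d p" and S: "S \<in> clopens"
  shows "{\<mu> \<in> d. p \<mu> \<in> S} \<in> clopens"
proof -
  have "ind {\<mu> \<in> d. p \<mu> \<in> S} \<in> diag_functions"
    by (rule diag_functions_cong[OF partial_iso_pullback[OF p ind_diag[OF S]]]) (simp add: ind_def)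
  then show ?thesis using p by (auto simp: clopens_def partial_iso_def)
qed

lemma lies_in_op_move:
  assumes p: "partial_iso d p" and S: "S \<in> clopens"
  shows "lies_in (op_move \<Lambda> (weighted_shift bar d p (\<lambda>a. 1)) x) S \<longleftrightarrow> lies_in x {\<mu> \<in> d. p \<mu> \<in> S}"
  unfolding lies_in_def ev_op_move[OF p ind_diag[OF S]]
  by (subst ev_cong[of _ "ind {\<mu> \<in> d. p \<mu> \<in> S}"]) (auto simp: ind_def)

text \<open>Images of clopen sets are preimages under the inverse isometry. Its transport also
  inverts the map of points, which gives injectivity and surjectivity.\<close>

lemma induced_op_move:
  assumes p: "partial_iso d p"
  shows "induced d p (op_move \<Lambda> (weighted_shift bar d p (\<lambda>a. 1)))"
  unfolding induced_def
proof (intro conjI ballI impI)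
  let ?q = "inv_into d p"
  note q = partial_iso_inverse[OF p]
  show inj: "inj_on p d" and "p ` d \<subseteq> bar" using p by (simp_all add: partial_iso_def)
  show "d \<in> clopens" by (rule partial_iso_clopen[OF p])
  fix S assume S: "S \<in> clopens"
  show "{\<mu> \<in> d. p \<mu> \<in> S} \<in> clopens" by (rule pullback_clopen[OF p S])
  show "p ` S \<in> clopens" if "S \<subseteq> d"
  proof -
    have "p ` S = {\<mu> \<in> p ` d. ?q \<mu> \<in> S}" using that inj by (auto simp: inv_into_f_f subset_iff)
    then show ?thesis using pullback_clopen[OF q S] by simp
  qed
next
  let ?M = "op_move \<Lambda> (weighted_shift bar d p (\<lambda>a. 1))"
  let ?q = "inv_into d p"
  let ?N = "op_move \<Lambda> (weighted_shift bar (p ` d) ?q (\<lambda>a. 1))"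
  note q = partial_iso_inverse[OF p]
  have inj: "inj_on p d" using p by (simp add: partial_iso_def)
  show "inj_on ?M {x \<in> X_set \<Lambda>. lies_in x d}"
    by (rule inj_on_inverseI[where g = ?N]) (use op_move_op_move[OF p q] inj in auto)
  fix x assume x: "x \<in> X_set \<Lambda>"
  show "?M x \<in> X_set \<Lambda>" if "lies_in x d" using op_move_X[OF p x that] .
  show "lies_in (?M x) S \<longleftrightarrow> lies_in x {\<mu> \<in> d. p \<mu> \<in> S}" if "S \<in> clopens" for S
    by (rule lies_in_op_move[OF p that])
  show "\<exists>x'\<in>X_set \<Lambda>. lies_in x' d \<and> ?M x' = x" if xr: "lies_in x (p ` d)"
  proof (intro bexI conjI)
    show "?N x \<in> X_set \<Lambda>" by (rule op_move_X[OF q x xr])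
    have "{\<mu> \<in> p ` d. ?q \<mu> \<in> d} = p ` d" using inj by auto
    then show "lies_in (?N x) d" using lies_in_op_move[OF q partial_iso_clopen[OF p]] xr by simp
    show "?M (?N x) = x" by (rule op_move_op_move[OF q p x xr]) (use inj in auto)
  qed
qed

lemma induced_l_map: 
  assumes "a \<in> bar"
  shows "induced (left_ext a) (cmp_bar \<Lambda> a) (l_map \<Lambda> a)"
proof (cases a)
  case None
  moreover have "left_ext None = bar" by (auto simp: left_ext_def)
  moreover have "cmp_bar \<Lambda> None = (\<lambda>\<mu>. \<mu>)" "l_map \<Lambda> None = (\<lambda>x. x)" by auto
  ultimately show ?thesis using induced_identity by simp
next
  case (Some l)
  moreover have "l_map \<Lambda> (Some l) = op_move \<Lambda> (L_op \<Lambda> l)" by auto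
  ultimately show ?thesis
    using induced_op_move[OF partial_iso_left[of l]] assms by (simp add: L_op_weighted_shift)
qed

lemma induced_r_map: 
  assumes "b \<in> bar"
  shows "induced (right_ext b) (\<lambda>\<mu>. cmp_bar \<Lambda> \<mu> b) (r_map \<Lambda> b)"
proof (cases b)
  case None
  moreover have "right_ext None = bar" by (auto simp: right_ext_def)
  moreover have "r_map \<Lambda> None = (\<lambda>x. x)" by auto
  ultimately show ?thesis using induced_identity by simp
next
  case (Some l)
  moreover have "r_map \<Lambda> (Some l) = op_move \<Lambda> (R_op \<Lambda> l)" by auto
  ultimately show ?thesis
    using induced_op_move[OF partial_iso_right[of l]] assms by (simp add: R_op_weighted_shift)
qed

lemma l_dom_iff:
  assumes "a \<in> bar"
  shows "x \<in> l_dom \<Lambda> a \<longleftrightarrow> x \<in> X_set \<Lambda> \<and> lies_in x (left_ext a)"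
proof (cases a)
  case None
  moreover have "left_ext None = bar" by (auto simp: left_ext_def)
  ultimately show ?thesis using lies_in_bar by auto
next
  case (Some l)
  then show ?thesis using op_dom_iff[OF partial_iso_left[of l]] assms by (simp add: L_op_weighted_shift)
qed

lemma r_dom_iff:
  assumes "b \<in> bar"
  shows "x \<in> r_dom \<Lambda> b \<longleftrightarrow> x \<in> X_set \<Lambda> \<and> lies_in x (right_ext b)"
proof (cases b)
  case None
  moreover have "right_ext None = bar" by (auto simp: right_ext_def)
  ultimately show ?thesis using lies_in_bar by auto
next
  case (Some l)
  then show ?thesis using op_dom_iff[OF partial_iso_right[of l]] assms by (simp add: R_op_weighted_shift)
qed


section \<open>Shape and source on the spectrum\<close>

definition shape_ge :: "nat ^ 'r \<Rightarrow> 'm option set" where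
  "shape_ge m = {\<mu> \<in> bar. m \<le> shape_bar \<Lambda> \<mu>}"

definition bar_of_shape :: "nat ^ 'r \<Rightarrow> 'm option set" where
  "bar_of_shape m = {\<mu> \<in> bar. shape_bar \<Lambda> \<mu> = m}"

lemma bar_of_shape_finite: "finite (bar_of_shape m)"
proof -
  have "bar_of_shape m \<subseteq> insert None (Some ` {a \<in> mor \<Lambda>. shape \<Lambda> a = m})"
    by (auto simp: bar_of_shape_def mor_bar_def mor_star_def)
  moreover have "finite {a \<in> mor \<Lambda>. shape \<Lambda> a = m}" using condition_F by (simp add: condition_F_def)
  ultimately show ?thesis by (meson finite_imageI finite_insert finite_subset)
qed

lemma bar_of_shape_nonempty: "bar_of_shape m \<noteq> {}"
proof -
  have "{a \<in> mor \<Lambda>. shape \<Lambda> a = m} \<noteq> {}" using condition_F unfolding condition_F_def by blast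
  then obtain a where "a \<in> mor \<Lambda>" "shape \<Lambda> a = m" by blast
  then have "to_bar \<Lambda> a \<in> bar_of_shape m" by (simp add: bar_of_shape_def to_bar_bar shape_to_bar)
  then show ?thesis by blast
qed

definition left_range :: "'m option \<Rightarrow> 'm option set" where
  "left_range a = cmp_bar \<Lambda> a ` left_ext a"

definition right_range :: "'m option \<Rightarrow> 'm option set" where
  "right_range b = (\<lambda>\<mu>. cmp_bar \<Lambda> \<mu> b) ` right_ext b"

lemma left_ext_clopen: "a \<in> bar \<Longrightarrow> left_ext a \<in> clopens"
  and right_ext_clopen: "a \<in> bar \<Longrightarrow> right_ext a \<in> clopens"
  using induced_l_map[of a] induced_r_map[of a] by (simp_all add: induced_def)

lemma left_range_clopen: "a \<in> bar \<Longrightarrow> left_range a \<in> clopens"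
  and right_range_clopen: "a \<in> bar \<Longrightarrow> right_range a \<in> clopens"
  using induced_l_map[of a] induced_r_map[of a] left_ext_clopen[of a] right_ext_clopen[of a]
  by (simp_all add: induced_def left_range_def right_range_def)

lemma shape_ge_left: "shape_ge m = (\<Union>a\<in>bar_of_shape m. left_range a)"
proof (intro equalityI subsetI)
  fix \<mu> assume "\<mu> \<in> shape_ge m"
  then have "\<mu> \<in> bar" "shape_bar \<Lambda> \<mu> = m + (shape_bar \<Lambda> \<mu> - m)"
    by (simp_all add: shape_ge_def nat_vec_le_add_diff)
  then show "\<mu> \<in> (\<Union>a\<in>bar_of_shape m. left_range a)"
    by (rule bar_factorization) (auto simp: bar_of_shape_def left_range_def left_ext_def)
qed (auto simp: shape_ge_def bar_of_shape_def left_range_def left_ext_def cmp_bar_bar nat_vec_le_add)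

text \<open>Splitting off the final factor instead of the initial one serves the right factorization
  in \<open>T_map\<close>.\<close>

lemma shape_ge_right: "shape_ge m = (\<Union>b\<in>bar_of_shape m. right_range b)"
proof (intro equalityI subsetI)
  fix \<mu> assume "\<mu> \<in> shape_ge m"
  then have "\<mu> \<in> bar" "shape_bar \<Lambda> \<mu> = (shape_bar \<Lambda> \<mu> - m) + m"
    by (simp_all add: shape_ge_def nat_vec_le_add_diff add.commute)
  then show "\<mu> \<in> (\<Union>a\<in>bar_of_shape m. right_range a)"
    by (rule bar_factorization) (auto simp: bar_of_shape_def right_range_def right_ext_def)
qed (auto simp: shape_ge_def bar_of_shape_def right_range_def right_ext_def cmp_bar_bar nat_vec_le_add)

text \<open>By the finiteness in condition (F), finitely many ranges of left multiplications make up
  this set.\<close>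

lemma shape_ge_clopen: "shape_ge m \<in> clopens"
  unfolding shape_ge_left
  by (intro clopens_UN bar_of_shape_finite bar_of_shape_nonempty left_range_clopen) (simp add: bar_of_shape_def)

lemma shape_ge_axis: "\<mu> \<in> bar \<Longrightarrow> \<mu> \<in> shape_ge (axis i n) \<longleftrightarrow> n \<le> shape_bar \<Lambda> \<mu> $ i"
  by (auto simp: shape_ge_def less_eq_vec_def axis_def)

text \<open>\<Omega> is the only element of \<open>bar\<close> whose shape dominates no unit
  vector.\<close>

lemma None_clopen: "{None} \<in> clopens"
proof -
  have "bar - (\<Union>i\<in>UNIV. shape_ge (axis i 1)) = {None}"
  proof (intro equalityI subsetI)
    fix \<mu> assume \<mu>: "\<mu> \<in> bar - (\<Union>i\<in>UNIV. shape_ge (axis i 1))"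
    then have "\<not> 1 \<le> shape_bar \<Lambda> \<mu> $ i" for i using shape_ge_axis[of \<mu> i 1] by blast
    then have "shape_bar \<Lambda> \<mu> = 0" by (simp add: vec_eq_iff not_le)
    then show "\<mu> \<in> {None}" using \<mu> shape_bar_0 by auto
  next
    fix \<mu> :: "'m option" assume "\<mu> \<in> {None}"
    moreover have "\<not> axis i 1 \<le> (0 :: nat ^ 'r)" for i by (auto simp: less_eq_vec_def axis_def)
    ultimately show "\<mu> \<in> bar - (\<Union>i\<in>UNIV. shape_ge (axis i 1))" by (auto simp: shape_ge_def)
  qed
  moreover have "(\<Union>i\<in>UNIV. shape_ge (axis i 1)) \<in> clopens" by (intro clopens_UN shape_ge_clopen) auto
  ultimately show ?thesis using clopens_Diff[OF bar_clopen] by metis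
qed

text \<open>Multiplication by the indicator of {\<Omega>} replaces \<open>f\<close> by the multiple
  \<open>f None\<close> of that indicator, so \<open>x\<close> evaluates exactly as the point
  \<Omega> does.\<close>

lemma lies_in_None:
  assumes x: "x \<in> X_set \<Lambda>" shows "lies_in x {None} \<longleftrightarrow> x = pt \<Lambda> None"
proof
  assume l: "lies_in x {None}"
  show "x = pt \<Lambda> None"
  proof (rule X_eqI[OF X_extensional[OF x] pt_extensional])
    fix f assume f: "f \<in> diag_functions"
    have "ev x (\<lambda>a. f None) = ev x f"
    proof -
      have "ev x (\<lambda>a. f None * ind {None} a) = ev x f"
        by (rule ev_supported[OF x None_clopen l f]) (simp add: ind_def)
      moreover have "ev x (\<lambda>a. f None * ind {None} a) = f None"
        using ev_scale[OF x ind_diag[OF None_clopen], of "f None"] l by (simp add: lies_in_def)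
      ultimately show ?thesis by (simp add: ev_const[OF x])
    qed
    then show "ev x f = ev (pt \<Lambda> None) f" by (simp add: ev_const[OF x] ev_pt f)
  qed
qed (simp add: lies_in_pt None_clopen)

lemma pt_closure: "topspace (X_top \<Lambda>) \<subseteq> X_top \<Lambda> closure_of (pt \<Lambda> ` bar)"
proof
  fix x assume x: "x \<in> X_set \<Lambda>"
  then show "x \<in> X_top \<Lambda> closure_of (pt \<Lambda> ` bar)"
    unfolding in_closure_of using pt_dense[OF _ _ bar_clopen lies_in_bar[OF x]] by blast
qed

text \<open>Coordinate \<open>i\<close> at \<open>x\<close> is the supremum of the thresholds
  \<open>n\<close> for which \<open>x\<close> lies in the clopen set of elements whose shape is at
  least \<open>n\<close> in direction \<open>i\<close>. The second conjunct describes the extension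
  at limit points, where the values on \<open>bar\<close> alone give no formula.\<close>

lemma shape_X_ex:
  "\<exists>g. is_cont_ext (X_top \<Lambda>) euclidean bar (pt \<Lambda>) (\<lambda>\<mu>. enat_vec (shape_bar \<Lambda> \<mu>)) g \<and>
    (\<forall>x\<in>X_set \<Lambda>. \<forall>i n. enat n \<le> g x $ i \<longleftrightarrow> lies_in x (shape_ge (axis i n)))"
proof -
  define g where "g = (\<lambda>x\<in>X_set \<Lambda>. \<chi> i. SUP n\<in>{n. lies_in x (shape_ge (axis i n))}. enat n)"
  have ge: "enat n \<le> g x $ i \<longleftrightarrow> lies_in x (shape_ge (axis i n))" if x: "x \<in> X_set \<Lambda>" for x i n
  proof
    assume "lies_in x (shape_ge (axis i n))"
    then show "enat n \<le> g x $ i" using x by (auto simp: g_def intro: SUP_upper)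
  next
    assume n: "enat n \<le> g x $ i"
    show "lies_in x (shape_ge (axis i n))"
    proof (cases n)
      case 0
      have "shape_ge (axis i 0) = bar" by (auto simp: shape_ge_def less_eq_vec_def axis_def)
      then show ?thesis using lies_in_bar[OF x] 0 by simp
    next
      case (Suc k)
      \<comment> \<open>The supremum may be infinite and not attained; being above \<open>k\<close>,
        it still has a threshold \<open>l \<ge> n\<close> below it.\<close>
      then have "enat k < g x $ i" using n by (simp add: Suc_ile_eq)
      then obtain l where l: "lies_in x (shape_ge (axis i l))" "k < l"
        using x by (auto simp: g_def less_SUP_iff)
      then have "shape_ge (axis i l) \<subseteq> shape_ge (axis i n)"
        using Suc shape_ge_axis clopens_bar[OF shape_ge_clopen] by fastforce
      then show ?thesis using l(1) lies_in_mono[OF x shape_ge_clopen shape_ge_clopen] by blast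
    qed
  qed
  have "continuous_map (X_top \<Lambda>) euclidean g"
  proof -
    have c: "continuous_map (X_top \<Lambda>) euclidean (\<lambda>x. g x $ i)" for i
    proof (rule continuous_map_enatI)
      fix n
      have "{x \<in> X_set \<Lambda>. enat n \<le> g x $ i} = {x \<in> X_set \<Lambda>. lies_in x (shape_ge (axis i n))}"
        using ge by auto
      then show "openin (X_top \<Lambda>) {x \<in> X_set \<Lambda>. enat n \<le> g x $ i}"
        by (simp add: openin_lies_in shape_ge_clopen)
      have "{x \<in> X_set \<Lambda>. \<not> enat n \<le> g x $ i} = {x \<in> X_set \<Lambda>. lies_in x (bar - shape_ge (axis i n))}"
        using ge lies_in_Diff[OF _ bar_clopen shape_ge_clopen] lies_in_bar by auto
      then show "openin (X_top \<Lambda>) {x \<in> X_set \<Lambda>. \<not> enat n \<le> g x $ i}"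
        by (simp add: openin_lies_in clopens_Diff bar_clopen shape_ge_clopen)
    qed
    show ?thesis unfolding continuous_map_atin limitin_canonical_iff
    proof (intro ballI vec_tendstoI)
      fix x i assume "x \<in> X_set \<Lambda>"
      then show "((\<lambda>x. g x $ i) \<longlongrightarrow> g x $ i) (atin (X_top \<Lambda>) x)"
        using c[of i] unfolding continuous_map_atin limitin_canonical_iff by blast
    qed
  qed
  moreover have "g (pt \<Lambda> \<mu>) = enat_vec (shape_bar \<Lambda> \<mu>)" if "\<mu> \<in> bar" for \<mu>
    unfolding vec_eq_iff
    by (intro allI enat_eqI_le) (simp add: ge pt_X lies_in_pt shape_ge_clopen shape_ge_axis that enat_vec_def)
  ultimately show ?thesis
    using ge by (intro exI[of _ g]) (auto simp: is_cont_ext_def g_def)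
qed

lemma shape_X_cont_ext:
    "is_cont_ext (X_top \<Lambda>) euclidean bar (pt \<Lambda>) (\<lambda>\<mu>. enat_vec (shape_bar \<Lambda> \<mu>)) (shape_X \<Lambda>)"
  and shape_X_ge_enat: 
    "x \<in> X_set \<Lambda> \<Longrightarrow> enat n \<le> shape_X \<Lambda> x $ i \<longleftrightarrow> lies_in x (shape_ge (axis i n))"
proof -
  obtain g where g: "is_cont_ext (X_top \<Lambda>) euclidean bar (pt \<Lambda>) (\<lambda>\<mu>. enat_vec (shape_bar \<Lambda> \<mu>)) g"
    "\<forall>x\<in>X_set \<Lambda>. \<forall>i n. enat n \<le> g x $ i \<longleftrightarrow> lies_in x (shape_ge (axis i n))"
    using shape_X_ex by blast
  then have "shape_X \<Lambda> = g"
    unfolding shape_X_def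
    by (intro the_equality) (auto intro: cont_ext_unique[OF pt_closure Hausdorff_enat_vec])
  then show "is_cont_ext (X_top \<Lambda>) euclidean bar (pt \<Lambda>) (\<lambda>\<mu>. enat_vec (shape_bar \<Lambda> \<mu>)) (shape_X \<Lambda>)"
    "x \<in> X_set \<Lambda> \<Longrightarrow> enat n \<le> shape_X \<Lambda> x $ i \<longleftrightarrow> lies_in x (shape_ge (axis i n))"
    using g by auto
qed

lemma shape_X_ge:
  assumes x: "x \<in> X_set \<Lambda>"
  shows "enat_vec m \<le> shape_X \<Lambda> x \<longleftrightarrow> lies_in x (shape_ge m)"
proof -
  have "(\<Inter>i\<in>I. shape_ge (axis i (m $ i))) \<in> clopens \<and>
      (lies_in x (\<Inter>i\<in>I. shape_ge (axis i (m $ i))) \<longleftrightarrow> (\<forall>i\<in>I. lies_in x (shape_ge (axis i (m $ i)))))"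
    if "finite I" "I \<noteq> {}" for I
    using that
    by (induction I rule: finite_ne_induct)
      (simp_all add: lies_in_Int[OF x shape_ge_clopen] shape_ge_clopen clopens_Int)
  from this[of UNIV] have "lies_in x (\<Inter>i. shape_ge (axis i (m $ i))) \<longleftrightarrow> (\<forall>i. lies_in x (shape_ge (axis i (m $ i))))"
    by simp
  moreover have "(\<Inter>i. shape_ge (axis i (m $ i))) = shape_ge m"
    by (auto simp: shape_ge_def less_eq_vec_def axis_def)
  ultimately show ?thesis
    by (simp add: less_eq_vec_def enat_vec_def shape_X_ge_enat[OF x])
qed

text \<open>The source sets cover \<open>bar\<close>, and distinct ones meet only in \<Omega>. A
  point other than \<Omega> therefore lies in exactly one of them, and the object so selected is the
  continuous extension of the source. The left side builds in that \<Omega> is composable with every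
  path.\<close>

lemma src_X_iff:
  assumes x: "x \<in> X_set \<Lambda>" and v: "v \<in> obj \<Lambda>"
  shows "x = pt \<Lambda> None \<or> src_X \<Lambda> x = v \<longleftrightarrow> lies_in x (src_set v)"
proof -
  let ?Y = "subtopology (X_top \<Lambda>) (X_set \<Lambda> - {pt \<Lambda> None})"
  let ?ext = "is_cont_ext ?Y (discrete_topology (obj \<Lambda>)) (mor_star \<Lambda>) (\<lambda>a. pt \<Lambda> (Some a)) (src \<Lambda>)"
  have top: "topspace ?Y = X_set \<Lambda> - {pt \<Lambda> None}" by auto
  have None_src: "None \<in> src_set w" for w by (simp add: src_set_def)
  have Int: "src_set w \<inter> src_set w' = {None}" if "w \<noteq> w'" for w w'
    using that by (auto simp: src_set_def split: option.splits)
  have ex1: "\<exists>!w. w \<in> obj \<Lambda> \<and> lies_in y (src_set w)" if y: "y \<in> X_set \<Lambda>" "y \<noteq> pt \<Lambda> None" for y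
  proof -
    have "lies_in y (\<Union>v\<in>obj \<Lambda>. src_set v)" using y by (simp add: UN_src_set lies_in_bar)
    then obtain w where w: "w \<in> obj \<Lambda>" "lies_in y (src_set w)"
      using lies_in_UN[OF y(1) obj_finite obj_nonempty, of src_set] src_set_clopen by blast
    moreover have "w' = w" if "w' \<in> obj \<Lambda>" "lies_in y (src_set w')" for w'
    proof (rule ccontr)
      assume "w' \<noteq> w"
      then have "lies_in y {None}"
        using lies_in_Int[OF y(1) src_set_clopen[OF that(1)] src_set_clopen[OF w(1)]] Int[of w' w] that(2) w(2)
        by simp
      then show False using lies_in_None[OF y(1)] y(2) by simp
    qed
    ultimately show ?thesis by blast
  qed
  define g where "g = (\<lambda>y\<in>X_set \<Lambda> - {pt \<Lambda> None}. THE w. w \<in> obj \<Lambda> \<and> lies_in y (src_set w))"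
  have g: "g y \<in> obj \<Lambda>" "w \<in> obj \<Lambda> \<Longrightarrow> g y = w \<longleftrightarrow> lies_in y (src_set w)"
    if y: "y \<in> X_set \<Lambda>" "y \<noteq> pt \<Lambda> None" for y w
    using theI'[OF ex1[OF y]] ex1[OF y] y by (auto simp: g_def)
  have gl: "lies_in y (src_set (g y))" if "y \<in> X_set \<Lambda>" "y \<noteq> pt \<Lambda> None" for y
    using g(2)[OF that g(1)[OF that]] by simp
  have pS: "pt \<Lambda> (Some a) \<noteq> pt \<Lambda> None" if "Some a \<in> bar" for a
    using lies_in_pt[OF that None_clopen] lies_in_None[OF pt_X[OF that]] by auto
  have gext: "?ext g"
    unfolding is_cont_ext_def top
  proof (intro conjI ballI)
    show "g \<in> extensional (X_set \<Lambda> - {pt \<Lambda> None})" by (simp add: g_def)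
    show "g (pt \<Lambda> (Some a)) = src \<Lambda> a" if "a \<in> mor_star \<Lambda>" for a
      using that g(2)[of "pt \<Lambda> (Some a)" "src \<Lambda> a"]
      by (simp add: mor_star_iff pt_X pS src_obj Some_bar lies_in_pt src_set_clopen)
        (simp add: src_set_def Some_bar)
    show "continuous_map ?Y (discrete_topology (obj \<Lambda>)) g"
      unfolding continuous_map_def top
    proof (intro conjI allI impI)
      show "g \<in> X_set \<Lambda> - {pt \<Lambda> None} \<rightarrow> topspace (discrete_topology (obj \<Lambda>))" using g(1) by auto
      fix U assume U: "openin (discrete_topology (obj \<Lambda>)) U"
      have eq: "{y \<in> X_set \<Lambda> - {pt \<Lambda> None}. g y \<in> U}
          = (\<Union>w\<in>U. {y \<in> X_set \<Lambda>. lies_in y (src_set w)}) \<inter> (X_set \<Lambda> - {pt \<Lambda> None})"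
        using U g gl by auto
      show "openin ?Y {y \<in> X_set \<Lambda> - {pt \<Lambda> None}. g y \<in> U}"
        unfolding eq openin_subtopology using U
        by (intro exI conjI openin_clauses(3) refl) (auto intro!: openin_lies_in src_set_clopen)
    qed
  qed
  \<comment> \<open>Uniqueness of the extension needs density of \<open>mor_star\<close> away from
    \<Omega>; this is \<open>pt_dense\<close> applied to the clopen complement of \<Omega>.\<close>
  have dense: "topspace ?Y \<subseteq> ?Y closure_of ((\<lambda>a. pt \<Lambda> (Some a)) ` mor_star \<Lambda>)"
  proof
    fix y assume "y \<in> topspace ?Y"
    then have y: "y \<in> X_set \<Lambda>" "y \<noteq> pt \<Lambda> None" by auto
    have "lies_in y (bar - {None})"
      using y lies_in_Diff[OF y(1) bar_clopen None_clopen] lies_in_bar lies_in_None by blast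
    then show "y \<in> ?Y closure_of ((\<lambda>a. pt \<Lambda> (Some a)) ` mor_star \<Lambda>)"
      unfolding in_closure_of top
    proof (intro conjI allI impI)
      fix T assume "y \<in> T \<and> openin ?Y T"
      then obtain U where U: "openin (X_top \<Lambda>) U" "T = U \<inter> (X_set \<Lambda> - {pt \<Lambda> None})" "y \<in> U"
        by (auto simp: openin_subtopology)
      from pt_dense[OF U(1,3) clopens_Diff[OF bar_clopen None_clopen]] \<open>lies_in y (bar - {None})\<close>
      obtain \<mu> where \<mu>: "\<mu> \<in> bar - {None}" "pt \<Lambda> \<mu> \<in> U" by blast
      then obtain a where "\<mu> = Some a" by (cases \<mu>) auto
      then show "\<exists>z. z \<in> (\<lambda>a. pt \<Lambda> (Some a)) ` mor_star \<Lambda> \<and> z \<in> T"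
        using \<mu> U(2) by (auto simp: mor_star_iff pt_X pS)
    qed (use y in auto)
  qed
  have "src_X \<Lambda> = g"
    unfolding src_X_def using gext
    by (intro the_equality) (auto intro: cont_ext_unique[OF dense Hausdorff_space_discrete_topology])
  then show ?thesis using g(2)[OF x _ v] lies_in_pt[OF None_bar src_set_clopen[OF v]] None_src by auto
qed


section \<open>Infinite paths\<close>

lemma path_mor:
  assumes "y \<in> inf_paths \<Lambda>" "n \<le> n'"
  shows "y (n, n') \<in> mor \<Lambda>" "shape \<Lambda> (y (n, n')) = n' - n"
  using assms by (auto simp: inf_paths_def)

lemma path_init:
  assumes "y \<in> inf_paths \<Lambda>"
  shows "y (0, k) \<in> mor \<Lambda>" "shape \<Lambda> (y (0, k)) = k"
  using path_mor[OF assms, of 0 k] by auto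

lemma path_cmp:
  assumes "y \<in> inf_paths \<Lambda>" "n \<le> k" "k \<le> p"
  shows "src \<Lambda> (y (n, k)) = tgt \<Lambda> (y (k, p))" "y (n, p) = cmp \<Lambda> (y (n, k)) (y (k, p))"
  using assms by (auto simp: inf_paths_def)

lemma path_init_cmp:
  assumes "y \<in> inf_paths \<Lambda>" "k \<le> p"
  shows "src \<Lambda> (y (0, k)) = tgt \<Lambda> (y (k, p))" "y (0, p) = cmp \<Lambda> (y (0, k)) (y (k, p))"
  using path_cmp[OF assms(1) _ assms(2), of 0] by auto

lemma path_tgt_init:
  assumes "y \<in> inf_paths \<Lambda>" shows "tgt \<Lambda> (y (0, k)) = path_tgt \<Lambda> y"
  using path_init_cmp[OF assms, of 0 k] path_mor[OF assms, of 0 k] path_mor[OF assms, of 0 0]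
  by (simp add: path_tgt_def) (metis tgt_cmp)

lemma path_tgt_obj: "y \<in> inf_paths \<Lambda> \<Longrightarrow> path_tgt \<Lambda> y \<in> obj \<Lambda>"
  using path_init(1)[of y 0] tgt_obj by (simp add: path_tgt_def)

lemma path_init_0: "y \<in> inf_paths \<Lambda> \<Longrightarrow> y (0, 0) = ident \<Lambda> (path_tgt \<Lambda> y)"
  using shape_0_ident[OF path_init(1)[of y 0]] path_init(2)[of y 0] by (metis path_tgt_def)

text \<open>\<open>y (0, k)\<close> is the initial factor of \<open>y (0, m + k)\<close>, and
  \<open>y (n, n')\<close> is the final factor of \<open>y (0, n')\<close>. The offset
  \<open>m\<close> admits equations known only beyond some shape, such as those for
  concatenations.\<close>

lemma path_eqI:
  assumes y: "y \<in> inf_paths \<Lambda>" and z: "z \<in> inf_paths \<Lambda>"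
    and eq: "\<And>k. y (0, m + k) = z (0, m + k)"
  shows "y = z"
proof -
  have eq0: "y (0, k) = z (0, k)" for k
  proof -
    have "k \<le> m + k" by (rule nat_vec_le_add)
    then show ?thesis
      using path_init_cmp[OF y, of k "m + k"] path_init_cmp[OF z, of k "m + k"] eq[of k]
        path_mor[OF y, of k "m + k"] path_mor[OF z, of k "m + k"] path_init[OF y] path_init[OF z]
      by (intro factorization_cancel(1)[of "y (0, k)" "y (k, m + k)" "z (0, k)" "z (k, m + k)"]) auto
  qed
  show ?thesis
  proof (rule extensionalityI[of _ "{(n, n'). n \<le> n'}"])
    fix p :: "(nat ^ 'r) \<times> (nat ^ 'r)" assume "p \<in> {(n, n'). n \<le> n'}"
    then obtain n n' where p: "p = (n, n')" and le: "n \<le> n'" by auto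
    show "y p = z p" unfolding p
      using path_init_cmp[OF y le] path_init_cmp[OF z le] eq0
        path_mor[OF y le] path_mor[OF z le] path_init[OF y] path_init[OF z]
      by (intro factorization_cancel(2)[of "y (0, n)" "y (n, n')" "z (0, n)" "z (n, n')"]) auto
  qed (use y z in \<open>auto simp: inf_paths_def\<close>)
qed

text \<open>By cancellation \<open>w k'\<close> has exactly one complement of \<open>w k\<close>.
  These complements are the values at \<open>(k, k')\<close>, and their uniqueness yields
  functoriality.\<close>

lemma path_exists:
  assumes w: "\<And>k. w k \<in> mor \<Lambda>" "\<And>k. shape \<Lambda> (w k) = k"
    and compat: "\<And>k k'. k \<le> k' \<Longrightarrow> \<exists>e\<in>mor \<Lambda>. src \<Lambda> (w k) = tgt \<Lambda> e \<and> w k' = cmp \<Lambda> (w k) e"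
  shows "\<exists>z\<in>inf_paths \<Lambda>. \<forall>k. z (0, k) = w k"
proof -
  obtain e where e: "\<And>k k'. k \<le> k' \<Longrightarrow> e k k' \<in> mor \<Lambda>" "\<And>k k'. k \<le> k' \<Longrightarrow> src \<Lambda> (w k) = tgt \<Lambda> (e k k')"
    "\<And>k k'. k \<le> k' \<Longrightarrow> w k' = cmp \<Lambda> (w k) (e k k')"
    using compat by metis
  have e_eq: "e n k = f" if "n \<le> k" "f \<in> mor \<Lambda>" "src \<Lambda> (w n) = tgt \<Lambda> f" "w k = cmp \<Lambda> (w n) f" for n k f
    using factorization_cancel(2)[of "w n" "e n k" "w n" f] that e[OF that(1)] w by simp
  have e_shape: "shape \<Lambda> (e n k) = k - n" if "n \<le> k" for n k
  proof -
    have "n + shape \<Lambda> (e n k) = k"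
      using shape_cmp[OF w(1) e(1)[OF that] e(2)[OF that]] e(3)[OF that] w(2) by metis
    then show ?thesis by (metis add_diff_cancel_left')
  qed
  have e_src: "src \<Lambda> (e n k) = src \<Lambda> (w k)" if "n \<le> k" for n k
    using src_cmp[OF w(1) e(1)[OF that] e(2)[OF that]] e(3)[OF that] by simp
  have e_ident: "e n n = ident \<Lambda> (src \<Lambda> (w n))" for n
    by (rule e_eq) (simp_all add: w src_obj ident_mor tgt_ident cmp_ident)
  have e_cmp: "src \<Lambda> (e n k) = tgt \<Lambda> (e k p) \<and> e n p = cmp \<Lambda> (e n k) (e k p)" if "n \<le> k" "k \<le> p" for n k p
  proof -
    have st: "src \<Lambda> (e n k) = tgt \<Lambda> (e k p)" using e_src[OF that(1)] e(2)[OF that(2)] by simp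
    have "e n p = cmp \<Lambda> (e n k) (e k p)"
    proof (rule e_eq)
      show "n \<le> p" using that by simp
      show "cmp \<Lambda> (e n k) (e k p) \<in> mor \<Lambda>" by (rule cmp_mor) (use e that st in auto)
      show "src \<Lambda> (w n) = tgt \<Lambda> (cmp \<Lambda> (e n k) (e k p))" using e that st by (simp add: tgt_cmp)
      show "w p = cmp \<Lambda> (w n) (cmp \<Lambda> (e n k) (e k p))"
        using cmp_assoc[OF w(1) e(1)[OF that(1)] e(1)[OF that(2)] e(2)[OF that(1)] st]
          e(3)[OF that(1)] e(3)[OF that(2)] by simp
    qed
    then show ?thesis using st by simp
  qed
  define z where "z = (\<lambda>(n, k)\<in>{(n, k). n \<le> k}. e n k)"
  have z: "z (n, k) = e n k" if "n \<le> k" for n k using that by (simp add: z_def)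
  have "z \<in> inf_paths \<Lambda>"
    unfolding inf_paths_def mem_Collect_eq
  proof (intro conjI allI impI)
    show "z \<in> extensional {(n, n'). n \<le> n'}" by (simp add: z_def)
    show "\<exists>v\<in>obj \<Lambda>. z (n, n) = ident \<Lambda> v" for n using src_obj[OF w(1)[of n]] by (auto simp: z e_ident)
    fix n k :: "nat ^ 'r" assume le: "n \<le> k"
    show "z (n, k) \<in> mor \<Lambda>" "shape \<Lambda> (z (n, k)) = k - n"
      using e(1)[OF le] e_shape[OF le] by (simp_all add: z le)
  next
    fix n k p :: "nat ^ 'r" assume "n \<le> k \<and> k \<le> p"
    then show "src \<Lambda> (z (n, k)) = tgt \<Lambda> (z (k, p))" "z (n, p) = cmp \<Lambda> (z (n, k)) (z (k, p))"
      using e_cmp[of n k p] z[of n k] z[of k p] z[of n p] by auto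
  qed
  moreover have "z (0, k) = w k" for k
  proof -
    have "w 0 = ident \<Lambda> (tgt \<Lambda> (e 0 k))" using shape_0_ident[OF w(1)[of 0]] w(2)[of 0] e(2)[of 0 k] by simp
    then show ?thesis using e(3)[of 0 k] e(1)[of 0 k] by (simp add: z cmp_ident)
  qed
  ultimately show ?thesis by blast
qed

lemma path_shift_inf_paths: "y \<in> inf_paths \<Lambda> \<Longrightarrow> path_shift m y \<in> inf_paths \<Lambda>"
  unfolding inf_paths_def mem_Collect_eq
  by (intro conjI allI impI)
    (auto simp: path_shift_def extensional_def less_eq_vec_def vec_eq_iff split: prod.splits)

section \<open>Initial segments of paths in \<open>bar\<close>\<close>

definition seg :: "('m, 'r) path \<Rightarrow> nat ^ 'r \<Rightarrow> 'm option" where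
  "seg y k = to_bar \<Lambda> (y (0, k))"

lemma seg_bar: "y \<in> inf_paths \<Lambda> \<Longrightarrow> seg y k \<in> bar"
  and shape_seg: "y \<in> inf_paths \<Lambda> \<Longrightarrow> shape_bar \<Lambda> (seg y k) = k"
  using path_init[of y k] by (simp_all add: seg_def to_bar_bar shape_to_bar)

lemma seg_add:
  assumes y: "y \<in> inf_paths \<Lambda>"
  shows "composable_bar \<Lambda> (seg y m) (seg (path_shift m y) k)"
    "seg y (m + k) = cmp_bar \<Lambda> (seg y m) (seg (path_shift m y) k)"
proof -
  have le: "m \<le> m + k" by (rule nat_vec_le_add)
  have s: "path_shift m y (0, k) = y (m, m + k)" by (simp add: path_shift_def add.commute)
  show "composable_bar \<Lambda> (seg y m) (seg (path_shift m y) k)"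
    "seg y (m + k) = cmp_bar \<Lambda> (seg y m) (seg (path_shift m y) k)"
    unfolding seg_def s
    using cmp_bar_to_bar[OF path_init(1)[OF y] path_mor(1)[OF y le] path_init_cmp(1)[OF y le]]
      path_init_cmp(2)[OF y le] by auto
qed

lemma seg_Some: "y \<in> inf_paths \<Lambda> \<Longrightarrow> k \<noteq> 0 \<Longrightarrow> seg y k = Some (y (0, k))"
  using path_init(2)[of y k] by (simp add: seg_def to_bar_def)

text \<open>At \<open>k = 0\<close> the segment of every path is \<Omega>. The shape
  \<open>k + 1\<close> is never 0, and \<open>y (0, k)\<close> is the initial factor of the value
  there.\<close>

lemma path_init_eqI:
  assumes y: "y \<in> inf_paths \<Lambda>" and z: "z \<in> inf_paths \<Lambda>" and eq: "seg y (k + 1) = seg z (k + 1)"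
  shows "y (0, k) = z (0, k)"
proof -
  have le: "k \<le> k + 1" by (rule nat_vec_le_add)
  have "y (0, k + 1) = z (0, k + 1)" using eq y z by (simp add: seg_Some nat_vec_add_one_neq_0)
  then show ?thesis
    using path_init_cmp[OF y le] path_init_cmp[OF z le]
      path_mor[OF y le] path_mor[OF z le] path_init[OF y] path_init[OF z]
    by (intro factorization_cancel(1)[of "y (0, k)" "y (k, k + 1)" "z (0, k)" "z (k, k + 1)"]) auto
qed

lemma seg_eqI:
  assumes "y \<in> inf_paths \<Lambda>" "z \<in> inf_paths \<Lambda>" "\<And>k. seg y (m + k) = seg z (m + k)"
  shows "y = z"
  by (rule path_eqI[OF assms(1,2), of m], rule path_init_eqI[OF assms(1,2)])
    (use assms(3) in \<open>simp add: add.assoc\<close>)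

section \<open>Concatenation of an element of \<open>bar\<close> with a path\<close>

lemma src_set_composable_seg:
  assumes "y \<in> inf_paths \<Lambda>" "a \<in> src_set (path_tgt \<Lambda> y)"
  shows "composable_bar \<Lambda> a (seg y k)"
  using assms path_tgt_init[OF assms(1), of k]
  by (cases a) (auto simp: seg_def to_bar_def src_set_def)

text \<open>The required values are prescribed only from the shape of \<open>a\<close> on. For
  arbitrary \<open>k\<close> the value is the initial factor of shape \<open>k\<close> of
  \<open>cmp \<Lambda> a (y (0, k))\<close>, whose shape always exceeds or equals
  \<open>k\<close>.\<close>

lemma concat_exists:
  assumes y: "y \<in> inf_paths \<Lambda>" and a: "a \<in> mor \<Lambda>" and ay: "src \<Lambda> a = path_tgt \<Lambda> y"
  shows "\<exists>z\<in>inf_paths \<Lambda>. \<forall>k. z (0, shape \<Lambda> a + k) = cmp \<Lambda> a (y (0, k))"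
proof -
  define c where "c k = cmp \<Lambda> a (y (0, k))" for k
  have st: "src \<Lambda> a = tgt \<Lambda> (y (0, k))" for k using ay path_tgt_init[OF y] by simp
  have c: "c k \<in> mor \<Lambda>" "shape \<Lambda> (c k) = k + shape \<Lambda> a" "src \<Lambda> (c k) = src \<Lambda> (y (0, k))" for k
    using cmp_mor[OF a path_init(1)[OF y] st] shape_cmp[OF a path_init(1)[OF y] st]
      src_cmp[OF a path_init(1)[OF y] st]
    by (simp_all add: c_def path_init[OF y] add.commute)
  have ck: "src \<Lambda> (c k) = tgt \<Lambda> (y (k, k'))" "c k' = cmp \<Lambda> (c k) (y (k, k'))" if le: "k \<le> k'" for k k'
    using path_init_cmp[OF y le] cmp_assoc[OF a path_init(1)[OF y] path_mor(1)[OF y le] st]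
    by (simp_all only: c) (simp add: c_def st)
  have "\<exists>b e. b \<in> mor \<Lambda> \<and> e \<in> mor \<Lambda> \<and> src \<Lambda> b = tgt \<Lambda> e \<and> c k = cmp \<Lambda> b e \<and> shape \<Lambda> b = k" for k
    using factorization[OF c(1,2)] by metis
  then obtain w f where w: "\<And>k. w k \<in> mor \<Lambda>" "\<And>k. f k \<in> mor \<Lambda>" "\<And>k. src \<Lambda> (w k) = tgt \<Lambda> (f k)"
    "\<And>k. c k = cmp \<Lambda> (w k) (f k)" "\<And>k. shape \<Lambda> (w k) = k" by metis
  have compat: "\<exists>e\<in>mor \<Lambda>. src \<Lambda> (w k) = tgt \<Lambda> e \<and> w k' = cmp \<Lambda> (w k) e" if le: "k \<le> k'" for k k'
  proof -
    \<comment> \<open>Cutting \<open>w k'\<close> at shape \<open>k\<close> gives an initial factor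
      of \<open>c k'\<close>. So is \<open>w k\<close>, because \<open>c k'\<close> extends
      \<open>c k\<close>; hence the two coincide.\<close>
    have "shape \<Lambda> (w k') = k + (k' - k)" using w(5) nat_vec_le_add_diff[OF le] by simp
    then obtain u e where ue: "u \<in> mor \<Lambda>" "e \<in> mor \<Lambda>" "src \<Lambda> u = tgt \<Lambda> e" "w k' = cmp \<Lambda> u e" "shape \<Lambda> u = k"
      using factorization[OF w(1)] by metis
    have ef: "src \<Lambda> e = tgt \<Lambda> (f k')" using w(3)[of k'] ue src_cmp by simp
    have fy: "src \<Lambda> (f k) = tgt \<Lambda> (y (k, k'))" using ck(1)[OF le] w src_cmp by metis
    have yk: "y (k, k') \<in> mor \<Lambda>" by (rule path_mor(1)[OF y le])
    have "cmp \<Lambda> u (cmp \<Lambda> e (f k')) = c k'"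
      using cmp_assoc[OF ue(1,2) w(2) ue(3) ef] w(4)[of k'] ue(4) by simp
    also have "c k' = cmp \<Lambda> (w k) (cmp \<Lambda> (f k) (y (k, k')))"
      using ck(2)[OF le] w(4)[of k] cmp_assoc[OF w(1) w(2) yk w(3) fy] by simp
    finally have "u = w k"
      using factorization_cancel(1)[of u "cmp \<Lambda> e (f k')" "w k" "cmp \<Lambda> (f k) (y (k, k'))"]
        ue w ef fy yk by (simp add: cmp_mor tgt_cmp)
    then show ?thesis using ue by auto
  qed
  obtain z where z: "z \<in> inf_paths \<Lambda>" "\<And>k. z (0, k) = w k"
    using path_exists[of w, OF w(1,5) compat] by blast
  have "z (0, shape \<Lambda> a + k) = c k" for k
  proof -
    let ?K = "shape \<Lambda> a + k"
    have le: "k \<le> ?K" by (rule nat_vec_le_add)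
    \<comment> \<open>Both \<open>w ?K\<close> and \<open>c k\<close> are initial factors of
      \<open>c ?K\<close>, and their shapes agree.\<close>
    have "cmp \<Lambda> (w ?K) (f ?K) = cmp \<Lambda> (c k) (y (k, ?K))" using w(4) ck(2)[OF le] by metis
    then have "w ?K = c k"
      using factorization_cancel(1)[of "w ?K" "f ?K" "c k" "y (k, ?K)"] w c ck(1)[OF le] path_mor(1)[OF y le]
      by (simp add: add.commute)
    then show ?thesis by (simp add: z)
  qed
  then have "\<forall>k. z (0, shape \<Lambda> a + k) = cmp \<Lambda> a (y (0, k))" by (simp add: c_def)
  then show ?thesis using z(1) by blast
qed

text \<open>The definite description is traded for the equations on values from the shape of
  \<open>a\<close> on. These have a solution by \<open>concat_exists\<close> and at most one by
  \<open>path_eqI\<close> with that offset.\<close>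

lemma concat_path:
  assumes y: "y \<in> inf_paths \<Lambda>" and a: "a \<in> src_set (path_tgt \<Lambda> y)"
  shows concat_inf_paths: "concat_path \<Lambda> a y \<in> inf_paths \<Lambda>"
    and seg_concat: "seg (concat_path \<Lambda> a y) (shape_bar \<Lambda> a + k) = cmp_bar \<Lambda> a (seg y k)"
    and path_shift_concat: "path_shift (shape_bar \<Lambda> a) (concat_path \<Lambda> a y) = y"
proof -
  have "concat_path \<Lambda> a y \<in> inf_paths \<Lambda> \<and> (\<forall>k. seg (concat_path \<Lambda> a y) (shape_bar \<Lambda> a + k) = cmp_bar \<Lambda> a (seg y k))
    \<and> path_shift (shape_bar \<Lambda> a) (concat_path \<Lambda> a y) = y"
  proof (cases a)
    case None
    then show ?thesis using y by (simp add: path_shift_def)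
  next
    case (Some b)
    then have b: "b \<in> mor \<Lambda>" "src \<Lambda> b = path_tgt \<Lambda> y" "shape \<Lambda> b \<noteq> 0"
      using a by (auto simp: src_set_def Some_bar)
    have st: "src \<Lambda> b = tgt \<Lambda> (y (0, k))" for k using b path_tgt_init[OF y] by simp
    have char: "z (0, shape \<Lambda> b) = b \<and> path_shift (shape \<Lambda> b) z = y \<longleftrightarrow>
        (\<forall>k. z (0, shape \<Lambda> b + k) = cmp \<Lambda> b (y (0, k)))" if z: "z \<in> inf_paths \<Lambda>" for z
    proof
      have le: "shape \<Lambda> b \<le> shape \<Lambda> b + k" for k by (rule nat_vec_le_add)
      have s: "path_shift (shape \<Lambda> b) z (0, k) = z (shape \<Lambda> b, shape \<Lambda> b + k)" for k
        by (simp add: path_shift_def add.commute)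
      show "\<forall>k. z (0, shape \<Lambda> b + k) = cmp \<Lambda> b (y (0, k))"
        if "z (0, shape \<Lambda> b) = b \<and> path_shift (shape \<Lambda> b) z = y"
        using path_init_cmp(2)[OF z le] s that by simp
      assume eq: "\<forall>k. z (0, shape \<Lambda> b + k) = cmp \<Lambda> b (y (0, k))"
      have zb: "z (0, shape \<Lambda> b) = b"
        using eq[rule_format, of 0] b cmp_ident(2)[of b] by (simp add: path_init_0[OF y])
      have "path_shift (shape \<Lambda> b) z (0, 0 + k) = y (0, 0 + k)" for k
      proof -
        have "cmp \<Lambda> b (z (shape \<Lambda> b, shape \<Lambda> b + k)) = cmp \<Lambda> b (y (0, k))"
          using path_init_cmp(2)[OF z le, of k] eq[rule_format, of k] unfolding zb by metis
        moreover have "src \<Lambda> b = tgt \<Lambda> (z (shape \<Lambda> b, shape \<Lambda> b + k))"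
          using path_init_cmp(1)[OF z le, of k] unfolding zb by metis
        ultimately have "z (shape \<Lambda> b, shape \<Lambda> b + k) = y (0, k)"
          using factorization_cancel(2)[OF b(1) path_mor(1)[OF z le] _ b(1) path_init(1)[OF y] st] by blast
        then show ?thesis by (simp only: s add_0_left)
      qed
      then show "z (0, shape \<Lambda> b) = b \<and> path_shift (shape \<Lambda> b) z = y"
        using zb path_eqI[OF path_shift_inf_paths[OF z] y] by blast
    qed
    obtain z where z: "z \<in> inf_paths \<Lambda>" "\<forall>k. z (0, shape \<Lambda> b + k) = cmp \<Lambda> b (y (0, k))"
      using concat_exists[OF y b(1,2)] by blast
    have c: "concat_path \<Lambda> a y = z"
      unfolding Some concat_path.simps
    proof (rule the_equality)
      show "z \<in> inf_paths \<Lambda> \<and> z (0, shape \<Lambda> b) = b \<and> path_shift (shape \<Lambda> b) z = y"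
        using z char by blast
      fix z' assume z': "z' \<in> inf_paths \<Lambda> \<and> z' (0, shape \<Lambda> b) = b \<and> path_shift (shape \<Lambda> b) z' = y"
      then have "\<forall>k. z' (0, shape \<Lambda> b + k) = cmp \<Lambda> b (y (0, k))" using char by blast
      then show "z' = z" using path_eqI[of z' z "shape \<Lambda> b"] z z' by simp
    qed
    have "seg z (shape \<Lambda> b + k) = cmp_bar \<Lambda> a (seg y k)" for k
      using cmp_bar_to_bar(2)[OF b(1) path_init(1)[OF y] st, of k] z(2) b(3)
      by (simp add: seg_def Some to_bar_def[of _ b])
    then show ?thesis using c z char[OF z(1)] by (simp add: Some)
  qed
  then show "concat_path \<Lambda> a y \<in> inf_paths \<Lambda>"
    "seg (concat_path \<Lambda> a y) (shape_bar \<Lambda> a + k) = cmp_bar \<Lambda> a (seg y k)"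
    "path_shift (shape_bar \<Lambda> a) (concat_path \<Lambda> a y) = y" by blast+
qed

lemma concat_eqI:
  assumes "y \<in> inf_paths \<Lambda>" "a \<in> src_set (path_tgt \<Lambda> y)" "z \<in> inf_paths \<Lambda>"
    and "\<And>k. seg z (shape_bar \<Lambda> a + k) = cmp_bar \<Lambda> a (seg y k)"
  shows "concat_path \<Lambda> a y = z"
  by (rule seg_eqI[OF concat_inf_paths[OF assms(1,2)] assms(3), of "shape_bar \<Lambda> a"])
    (simp add: seg_concat[OF assms(1,2)] assms(4))

lemma seg_concat_shape:
  assumes "y \<in> inf_paths \<Lambda>" "a \<in> src_set (path_tgt \<Lambda> y)"
  shows "seg (concat_path \<Lambda> a y) (shape_bar \<Lambda> a) = a"
proof -
  have "seg y 0 = None" using shape_bar_0[OF seg_bar[OF assms(1)]] shape_seg[OF assms(1)] by blast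
  then show ?thesis using seg_concat[OF assms, of 0] by simp
qed

lemma path_tgt_concat:
  assumes y: "y \<in> inf_paths \<Lambda>" and a: "Some a \<in> src_set (path_tgt \<Lambda> y)"
  shows "path_tgt \<Lambda> (concat_path \<Lambda> (Some a) y) = tgt \<Lambda> a"
proof -
  have "seg (concat_path \<Lambda> (Some a) y) (shape \<Lambda> a) = Some a" using seg_concat_shape[OF assms] by simp
  moreover have "shape \<Lambda> a \<noteq> 0" using a by (simp add: src_set_def Some_bar)
  ultimately have "concat_path \<Lambda> (Some a) y (0, shape \<Lambda> a) = a"
    using concat_inf_paths[OF assms] by (simp add: seg_Some)
  then show ?thesis using path_tgt_init[OF concat_inf_paths[OF assms]] by metis
qed

lemma seg_src_set:
  assumes y: "y \<in> inf_paths \<Lambda>" shows "seg y m \<in> src_set (path_tgt \<Lambda> (path_shift m y))"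
proof (cases "m = 0")
  case True
  then show ?thesis using shape_bar_0[OF seg_bar[OF y]] shape_seg[OF y, of m] by (simp add: src_set_def)
next
  case False
  have "path_tgt \<Lambda> (path_shift m y) = src \<Lambda> (y (0, m))"
    using path_init_cmp(1)[OF y, of m m] by (simp add: path_tgt_def path_shift_def)
  then show ?thesis using False seg_bar[OF y, of m] by (simp add: src_set_def seg_Some y)
qed

lemma concat_seg_shift:
  assumes y: "y \<in> inf_paths \<Lambda>" shows "concat_path \<Lambda> (seg y m) (path_shift m y) = y"
  by (rule concat_eqI[OF path_shift_inf_paths[OF y] seg_src_set[OF y] y])
    (simp add: shape_seg[OF y] seg_add[OF y])

text \<open>The junk value of \<open>cmp \<Lambda>\<close> on non-composable \<open>\<mu>\<close> and \<open>c\<close> occurs on both sides when \<open>a = \<Omega>\<close>.\<close>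

lemma cmp_bar_assoc:
  assumes "\<mu> \<in> bar" "a \<in> bar" "c \<in> bar" "composable_bar \<Lambda> \<mu> a" "composable_bar \<Lambda> a c"
  shows "cmp_bar \<Lambda> (cmp_bar \<Lambda> \<mu> a) c = cmp_bar \<Lambda> \<mu> (cmp_bar \<Lambda> a c)"
  using assms by (cases \<mu>; cases a; cases c) (simp_all add: Some_bar cmp_assoc)

lemma cmp_bar_src_set:
  assumes "\<mu> \<in> bar" "Some b \<in> src_set v" "composable_bar \<Lambda> \<mu> (Some b)"
  shows "cmp_bar \<Lambda> \<mu> (Some b) \<in> src_set v"
  using assms cmp_bar_bar(1)[of \<mu> "Some b"]
  by (cases \<mu>) (simp_all add: src_set_def Some_bar src_cmp)

text \<open>For b = \<Omega> membership in \<open>right_ext\<close> says nothing about the source of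
  \<mu>; there the last hypothesis supplies it.\<close>

lemma concat_concat:
  assumes y: "y \<in> inf_paths \<Lambda>" and b: "b \<in> src_set (path_tgt \<Lambda> y)" and \<mu>: "\<mu> \<in> right_ext b"
    and \<mu>b: "cmp_bar \<Lambda> \<mu> b \<in> src_set (path_tgt \<Lambda> y)"
  shows "\<mu> \<in> src_set (path_tgt \<Lambda> (concat_path \<Lambda> b y))"
    "concat_path \<Lambda> (cmp_bar \<Lambda> \<mu> b) y = concat_path \<Lambda> \<mu> (concat_path \<Lambda> b y)"
proof -
  have bars: "\<mu> \<in> bar" "b \<in> bar" "composable_bar \<Lambda> \<mu> b" using \<mu> b by (auto simp: right_ext_def src_set_def)
  show m: "\<mu> \<in> src_set (path_tgt \<Lambda> (concat_path \<Lambda> b y))"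
  proof (cases b)
    case (Some c)
    then show ?thesis using \<mu> path_tgt_concat[OF y, of c] b by (simp add: right_ext_Some)
  qed (use \<mu>b in simp)
  show "concat_path \<Lambda> (cmp_bar \<Lambda> \<mu> b) y = concat_path \<Lambda> \<mu> (concat_path \<Lambda> b y)"
  proof (rule concat_eqI[OF y \<mu>b concat_inf_paths[OF concat_inf_paths[OF y b] m]])
    fix k
    show "seg (concat_path \<Lambda> \<mu> (concat_path \<Lambda> b y)) (shape_bar \<Lambda> (cmp_bar \<Lambda> \<mu> b) + k)
        = cmp_bar \<Lambda> (cmp_bar \<Lambda> \<mu> b) (seg y k)"
      using cmp_bar_assoc[OF bars(1,2) seg_bar[OF y] bars(3) src_set_composable_seg[OF y b], of k]
        cmp_bar_bar(2)[OF bars] seg_concat[OF concat_inf_paths[OF y b] m] seg_concat[OF y b]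
      by (simp add: add.assoc)
  qed
qed


section \<open>Limits of concatenations\<close>

text \<open>Since every \<open>src_set\<close> contains \<Omega>, the exceptional clause for
  \<Omega> in \<open>Z_set\<close> is absorbed.\<close>

lemma Z_set_iff:
  "(x, y) \<in> Z_set \<Lambda> \<longleftrightarrow> x \<in> X_set \<Lambda> \<and> y \<in> inf_paths \<Lambda> \<and> lies_in x (src_set (path_tgt \<Lambda> y))"
  using src_X_iff path_tgt_obj by (auto simp: Z_set_def)

lemma lies_in_nonempty:
  assumes "x \<in> X_set \<Lambda>" "lies_in x S" shows "\<exists>\<mu>. \<mu> \<in> S"
  using assms lies_in_empty by (cases "S = {}") auto

text \<open>Allows every approximating \<mu> near \<open>x\<close> to be taken composable with
  \<open>y\<close>.\<close>

lemma lies_in_path_src: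
  assumes "(x, y) \<in> Z_set \<Lambda>" "S \<in> clopens" "lies_in x S"
  shows "S \<inter> src_set (path_tgt \<Lambda> y) \<in> clopens" "lies_in x (S \<inter> src_set (path_tgt \<Lambda> y))"
  using assms src_set_clopen[OF path_tgt_obj[of y]]
  by (auto simp: Z_set_iff lies_in_Int intro: clopens_Int)

lemma induced_lies_in:
  assumes "induced d p M" "x \<in> X_set \<Lambda>" "lies_in x d" "S \<in> clopens"
  shows "{\<mu> \<in> d. p \<mu> \<in> S} \<in> clopens" "lies_in (M x) S \<longleftrightarrow> lies_in x {\<mu> \<in> d. p \<mu> \<in> S}"
  using assms unfolding induced_def by blast+

lemma induced_X: "induced d p M \<Longrightarrow> x \<in> X_set \<Lambda> \<Longrightarrow> lies_in x d \<Longrightarrow> M x \<in> X_set \<Lambda>"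
  unfolding induced_def by blast

lemma induced_image:
  assumes "induced d p M" "S \<in> clopens" "S \<subseteq> d"
  shows "p ` S \<in> clopens" "x \<in> X_set \<Lambda> \<Longrightarrow> lies_in x d \<Longrightarrow> lies_in (M x) (p ` S) \<longleftrightarrow> lies_in x S"
proof -
  show c: "p ` S \<in> clopens" using assms unfolding induced_def by blast
  have "inj_on p d" using assms unfolding induced_def by blast
  then have "{\<mu> \<in> d. p \<mu> \<in> p ` S} = S" using assms(3) by (auto dest: inj_onD)
  then show "x \<in> X_set \<Lambda> \<Longrightarrow> lies_in x d \<Longrightarrow> lies_in (M x) (p ` S) \<longleftrightarrow> lies_in x S"
    using induced_lies_in(2)[OF assms(1) _ _ c] by simp
qed

lemma src_set_subset_right_ext:
  "y \<in> inf_paths \<Lambda> \<Longrightarrow> src_set (path_tgt \<Lambda> y) \<subseteq> right_ext (seg y k)"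
  using src_set_composable_seg by (auto simp: right_ext_def) (auto simp: src_set_def)

text \<open>The initial segment of \<open>\<mu>y'\<close> of shape \<open>k\<close> is that of \<open>\<mu> y(0, k)\<close>, hence constant for \<open>\<mu>\<close> in a
  clopen set determined by \<open>x\<close> and \<open>y(0, k)\<close>.\<close>

lemma seg_concat_locally_constant:
  assumes xy: "(x, y) \<in> Z_set \<Lambda>"
  shows "\<exists>c. \<exists>S\<in>clopens. lies_in x S \<and> (\<forall>y'\<in>inf_paths \<Lambda>. seg y' k = seg y k \<longrightarrow>
    (\<forall>\<mu>\<in>S \<inter> src_set (path_tgt \<Lambda> y'). seg (concat_path \<Lambda> \<mu> y') k = c))"
proof -
  let ?b = "seg y k"
  have x: "x \<in> X_set \<Lambda>" and y: "y \<in> inf_paths \<Lambda>" and xs: "lies_in x (src_set (path_tgt \<Lambda> y))"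
    using xy by (simp_all add: Z_set_iff)
  have b: "?b \<in> bar" "shape_bar \<Lambda> ?b = k" using seg_bar[OF y] shape_seg[OF y] by auto
  note ind = induced_r_map[OF b(1)]
  have xd: "lies_in x (right_ext ?b)"
    using lies_in_mono[OF x src_set_clopen[OF path_tgt_obj[OF y]] right_ext_clopen[OF b(1)]
        src_set_subset_right_ext[OF y] xs] .
  \<comment> \<open>Appending \<open>?b\<close> makes every shape at least \<open>k\<close>, so the
    point \<open>r_map \<Lambda> ?b x\<close> lies in one of finitely many left ranges. The
    corresponding \<open>c\<close> is the constant sought.\<close>
  have "{\<mu> \<in> right_ext ?b. cmp_bar \<Lambda> \<mu> ?b \<in> shape_ge k} = right_ext ?b"
    using b by (auto simp: right_ext_def shape_ge_def cmp_bar_bar nat_vec_le_add)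
  then have "lies_in (r_map \<Lambda> ?b x) (shape_ge k)"
    using induced_lies_in(2)[OF ind x xd shape_ge_clopen] xd by simp
  moreover have "left_range c \<in> clopens" if "c \<in> bar_of_shape k" for c
    using that left_range_clopen by (simp add: bar_of_shape_def)
  ultimately obtain c where c: "c \<in> bar_of_shape k" "lies_in (r_map \<Lambda> ?b x) (left_range c)"
    unfolding shape_ge_left
    using lies_in_UN[OF induced_X[OF ind x xd] bar_of_shape_finite bar_of_shape_nonempty, where S = left_range] by metis
  then have cb: "c \<in> bar" "shape_bar \<Lambda> c = k" by (simp_all add: bar_of_shape_def)
  define S where "S = {\<mu> \<in> right_ext ?b. cmp_bar \<Lambda> \<mu> ?b \<in> left_range c}"
  have S: "S \<in> clopens" "lies_in x S"
    using induced_lies_in[OF ind x xd left_range_clopen[OF cb(1)]] c(2) by (simp_all add: S_def)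
  have "seg (concat_path \<Lambda> \<mu> y') k = c"
    if y': "y' \<in> inf_paths \<Lambda>" "seg y' k = ?b" and \<mu>: "\<mu> \<in> S" "\<mu> \<in> src_set (path_tgt \<Lambda> y')" for y' \<mu>
  proof -
    let ?z = "concat_path \<Lambda> \<mu> y'"
    have z: "?z \<in> inf_paths \<Lambda>" by (rule concat_inf_paths[OF y'(1) \<mu>(2)])
    obtain \<nu> where \<nu>: "\<nu> \<in> left_ext c" "cmp_bar \<Lambda> \<mu> ?b = cmp_bar \<Lambda> c \<nu>"
      using \<mu>(1) by (auto simp: S_def left_range_def)
    \<comment> \<open>This segment now has two factorizations whose first factors, \<open>c\<close>
      and \<open>seg ?z k\<close>, have shape \<open>k\<close>.\<close>
    have "cmp_bar \<Lambda> c \<nu> = seg ?z (k + shape_bar \<Lambda> \<mu>)"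
      using seg_concat[OF y'(1) \<mu>(2), of k] y'(2) \<nu>(2) by (simp add: add.commute)
    also have "\<dots> = cmp_bar \<Lambda> (seg ?z k) (seg (path_shift k ?z) (shape_bar \<Lambda> \<mu>))" by (rule seg_add(2)[OF z])
    finally have "c = seg ?z k"
      using bar_factorization_cancel(1)[of c \<nu> "seg ?z k" "seg (path_shift k ?z) (shape_bar \<Lambda> \<mu>)"]
        \<nu>(1) cb seg_bar[OF z] seg_bar[OF path_shift_inf_paths[OF z]] seg_add(1)[OF z] shape_seg[OF z]
      by (simp add: left_ext_def)
    then show ?thesis by simp
  qed
  then show ?thesis using S by (intro exI[of _ c] bexI[OF _ S(1)] conjI) auto
qed

text \<open>Expresses that \<mu>y' tends to \<open>z\<close>, segment by segment, as \<mu> tends to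
  \<open>x\<close>. Letting \<open>y'\<close> vary over the paths that share a segment with
  \<open>y\<close> builds in joint continuity.\<close>

definition concat_limit :: "'m point \<Rightarrow> ('m, 'r) path \<Rightarrow> ('m, 'r) path \<Rightarrow> bool" where
  "concat_limit x y z \<longleftrightarrow> z \<in> inf_paths \<Lambda> \<and>
    (\<forall>k. \<exists>S\<in>clopens. lies_in x S \<and> (\<forall>y'\<in>inf_paths \<Lambda>. seg y' k = seg y k \<longrightarrow>
      (\<forall>\<mu>\<in>S \<inter> src_set (path_tgt \<Lambda> y'). seg (concat_path \<Lambda> \<mu> y') k = seg z k)))"

text \<open>The locally constant values \<open>c k\<close> must fit together. Finitely many clopen
  sets in which \<open>x\<close> lies share some \<mu> composable with \<open>y\<close>, so the
  values compared are segments of one genuine path \<mu>y and inherit its compatibility.\<close>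

lemma concat_limit_exists:
  assumes xy: "(x, y) \<in> Z_set \<Lambda>" shows "\<exists>z. concat_limit x y z"
proof -
  have x: "x \<in> X_set \<Lambda>" and y: "y \<in> inf_paths \<Lambda>" using xy by (simp_all add: Z_set_iff)
  obtain c S where S: "\<And>k. S k \<in> clopens" "\<And>k. lies_in x (S k)"
    and c: "\<And>k y' \<mu>. y' \<in> inf_paths \<Lambda> \<Longrightarrow> seg y' k = seg y k \<Longrightarrow> \<mu> \<in> S k \<Longrightarrow>
      \<mu> \<in> src_set (path_tgt \<Lambda> y') \<Longrightarrow> seg (concat_path \<Lambda> \<mu> y') k = c k"
    using seg_concat_locally_constant[OF xy] by (metis (no_types, lifting) IntI)
  have common: "\<exists>p\<in>inf_paths \<Lambda>. seg p j = c j \<and> seg p k = c k \<and> seg p l = c l" for j k l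
  proof -
    have "S j \<inter> (S k \<inter> S l) \<in> clopens" "lies_in x (S j \<inter> (S k \<inter> S l))"
      using S by (simp_all add: clopens_Int lies_in_Int[OF x])
    then obtain \<mu> where "\<mu> \<in> S j" "\<mu> \<in> S k" "\<mu> \<in> S l" "\<mu> \<in> src_set (path_tgt \<Lambda> y)"
      using lies_in_nonempty[OF x lies_in_path_src(2)[OF xy]] by blast
    then show ?thesis
      using c[OF y refl] concat_inf_paths[OF y] by (intro bexI[of _ "concat_path \<Lambda> \<mu> y"]) auto
  qed
  have "\<forall>k. \<exists>p. p \<in> inf_paths \<Lambda> \<and> seg p (k + 1) = c (k + 1)" using common by blast
  then obtain q where q: "\<And>k. q k \<in> inf_paths \<Lambda>" "\<And>k. seg (q k) (k + 1) = c (k + 1)"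
    by metis
  \<comment> \<open>\<open>q k\<close> agrees with the constants at shape \<open>k + 1\<close>,
    which fixes its value at \<open>(0, k)\<close> even for \<open>k = 0\<close>.\<close>
  define w where "w k = q k (0, k)" for k
  have w: "p (0, k) = w k" if "p \<in> inf_paths \<Lambda>" "seg p (k + 1) = c (k + 1)" for p k
    unfolding w_def by (rule path_init_eqI[OF that(1) q(1)]) (simp add: that(2) q(2))
  have "\<exists>z\<in>inf_paths \<Lambda>. \<forall>k. z (0, k) = w k"
  proof (rule path_exists)
    show "w k \<in> mor \<Lambda>" "shape \<Lambda> (w k) = k" for k by (simp_all add: w_def path_init[OF q(1)])
    show "\<exists>e\<in>mor \<Lambda>. src \<Lambda> (w k) = tgt \<Lambda> e \<and> w k' = cmp \<Lambda> (w k) e" if "k \<le> k'" for k k'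
    proof -
      obtain p where p: "p \<in> inf_paths \<Lambda>" "seg p (k + 1) = c (k + 1)" "seg p (k' + 1) = c (k' + 1)"
        using common by metis
      then show ?thesis
        using path_init_cmp[OF p(1) that] path_mor(1)[OF p(1) that] w[OF p(1,2)] w[OF p(1,3)] by auto
    qed
  qed
  then obtain z where z: "z \<in> inf_paths \<Lambda>" "\<And>k. z (0, k) = w k" by blast
  have "seg z k = c k" for k
  proof -
    obtain p where p: "p \<in> inf_paths \<Lambda>" "seg p k = c k" "seg p (k + 1) = c (k + 1)"
      using common by metis
    then show ?thesis using w[OF p(1,3)] z(2) by (simp add: seg_def)
  qed
  then have "concat_limit x y z"
    unfolding concat_limit_def using z(1) S c by (metis (no_types, lifting) IntD1 IntD2)
  then show ?thesis by blast
qed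

text \<open>The rule by which limits are computed: the segments of \<mu>y need to be known on just
  one clopen set in which \<open>x\<close> lies.\<close>

lemma concat_limit_segI:
  assumes xy: "(x, y) \<in> Z_set \<Lambda>" and z: "concat_limit x y z" and S: "S \<in> clopens" "lies_in x S"
    and c: "\<And>\<mu>. \<mu> \<in> S \<Longrightarrow> \<mu> \<in> src_set (path_tgt \<Lambda> y) \<Longrightarrow> seg (concat_path \<Lambda> \<mu> y) k = c"
  shows "seg z k = c"
proof -
  have x: "x \<in> X_set \<Lambda>" and y: "y \<in> inf_paths \<Lambda>" using xy by (simp_all add: Z_set_iff)
  obtain S' where S': "S' \<in> clopens" "lies_in x S'"
    "\<And>\<mu>. \<mu> \<in> S' \<inter> src_set (path_tgt \<Lambda> y) \<Longrightarrow> seg (concat_path \<Lambda> \<mu> y) k = seg z k"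
    using z y unfolding concat_limit_def by metis
  have "S \<inter> S' \<in> clopens" "lies_in x (S \<inter> S')" using S S' by (simp_all add: clopens_Int lies_in_Int[OF x])
  then obtain \<mu> where "\<mu> \<in> S" "\<mu> \<in> S'" "\<mu> \<in> src_set (path_tgt \<Lambda> y)"
    using lies_in_nonempty[OF x lies_in_path_src(2)[OF xy]] by blast
  then show ?thesis using c[of \<mu>] S'(3)[of \<mu>] by simp
qed

lemma concat_limit_unique:
  assumes xy: "(x, y) \<in> Z_set \<Lambda>" and z: "concat_limit x y z" and z': "concat_limit x y z'"
  shows "z = z'"
proof (rule seg_eqI[of _ _ 0])
  show "z \<in> inf_paths \<Lambda>" "z' \<in> inf_paths \<Lambda>" using z z' by (simp_all add: concat_limit_def)
  fix k
  have y: "y \<in> inf_paths \<Lambda>" using xy by (simp add: Z_set_iff)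
  obtain S where S: "S \<in> clopens" "lies_in x S"
    "\<And>\<mu>. \<mu> \<in> S \<Longrightarrow> \<mu> \<in> src_set (path_tgt \<Lambda> y) \<Longrightarrow> seg (concat_path \<Lambda> \<mu> y) (0 + k) = seg z' (0 + k)"
    using z' y unfolding concat_limit_def by (metis IntI)
  then show "seg z (0 + k) = seg z' (0 + k)" by (rule concat_limit_segI[OF xy z])
qed

definition concat_X :: "'m point \<Rightarrow> ('m, 'r) path \<Rightarrow> ('m, 'r) path" where
  "concat_X x y = (THE z. concat_limit x y z)"

lemma concat_X: "(x, y) \<in> Z_set \<Lambda> \<Longrightarrow> concat_limit x y (concat_X x y)"
  unfolding concat_X_def using concat_limit_exists concat_limit_unique by (metis (no_types, lifting) theI)

lemma concat_X_path: "(x, y) \<in> Z_set \<Lambda> \<Longrightarrow> concat_X x y \<in> inf_paths \<Lambda>"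
  using concat_X by (simp add: concat_limit_def)

lemma concat_X_clopen:
  assumes "(x, y) \<in> Z_set \<Lambda>"
  obtains S where "S \<in> clopens" "lies_in x S" "\<And>y' \<mu>. y' \<in> inf_paths \<Lambda> \<Longrightarrow> seg y' k = seg y k \<Longrightarrow> \<mu> \<in> S \<Longrightarrow>
    \<mu> \<in> src_set (path_tgt \<Lambda> y') \<Longrightarrow> seg (concat_path \<Lambda> \<mu> y') k = seg (concat_X x y) k"
  using concat_X[OF assms] unfolding concat_limit_def by (metis IntI)

lemma pt_Z: "\<mu> \<in> bar \<Longrightarrow> (pt \<Lambda> \<mu>, y) \<in> Z_set \<Lambda> \<longleftrightarrow> y \<in> inf_paths \<Lambda> \<and> \<mu> \<in> src_set (path_tgt \<Lambda> y)"
  using lies_in_pt[OF _ src_set_clopen[OF path_tgt_obj]] pt_X by (auto simp: Z_set_iff)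

text \<open>Every clopen set in which the point \<mu> lies contains \<mu> itself, so the limit is
  attained.\<close>

lemma concat_X_pt:
  assumes "\<mu> \<in> bar" "(pt \<Lambda> \<mu>, y) \<in> Z_set \<Lambda>"
  shows "concat_X (pt \<Lambda> \<mu>) y = concat_path \<Lambda> \<mu> y"
proof (rule seg_eqI[of _ _ 0])
  have y: "y \<in> inf_paths \<Lambda>" "\<mu> \<in> src_set (path_tgt \<Lambda> y)" using assms by (simp_all add: pt_Z)
  show "concat_X (pt \<Lambda> \<mu>) y \<in> inf_paths \<Lambda>" "concat_path \<Lambda> \<mu> y \<in> inf_paths \<Lambda>"
    using concat_X_path[OF assms(2)] concat_inf_paths[OF y] by auto
  fix k
  show "seg (concat_X (pt \<Lambda> \<mu>) y) (0 + k) = seg (concat_path \<Lambda> \<mu> y) (0 + k)"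
    using concat_X_clopen[OF assms(2), of "0 + k"] lies_in_pt[OF assms(1)] y by metis
qed


section \<open>The extension \<open>\<phi>\<close>\<close>

lemma topspace_path_top: "topspace (path_top \<Lambda>) = inf_paths \<Lambda>"
  unfolding path_top_def topology_generated_by_topspace
proof (intro equalityI subsetI)
  fix y assume y: "y \<in> inf_paths \<Lambda>"
  show "y \<in> \<Union> {{y \<in> inf_paths \<Lambda>. y (0, k) = a} |k a. a \<in> mor \<Lambda>}"
    by (rule UnionI[of "{z \<in> inf_paths \<Lambda>. z (0, 0) = y (0, 0)}"]) (use y path_init(1)[OF y] in auto)
qed auto

lemma openin_cylinder: "a \<in> mor \<Lambda> \<Longrightarrow> openin (path_top \<Lambda>) {y \<in> inf_paths \<Lambda>. y (0, k) = a}"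
  unfolding path_top_def by (rule topology_generated_by_Basis) auto

lemma topspace_Z: "topspace (Z_top \<Lambda>) = Z_set \<Lambda>"
  by (auto simp: Z_top_def topspace_path_top Z_set_def)

lemma Hausdorff_path_top: "Hausdorff_space (path_top \<Lambda>)"
  unfolding Hausdorff_space_def topspace_path_top
proof (intro allI impI)
  fix y z assume "y \<in> inf_paths \<Lambda> \<and> z \<in> inf_paths \<Lambda> \<and> y \<noteq> z"
  then have y: "y \<in> inf_paths \<Lambda>" and z: "z \<in> inf_paths \<Lambda>" and "y \<noteq> z" by auto
  then obtain k where k: "y (0, k) \<noteq> z (0, k)" using path_eqI[of y z] by blast
  have "openin (path_top \<Lambda>) {p \<in> inf_paths \<Lambda>. p (0, k) = y (0, k)}"
    "openin (path_top \<Lambda>) {p \<in> inf_paths \<Lambda>. p (0, k) = z (0, k)}"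
    using openin_cylinder path_init(1) y z by auto
  moreover have "disjnt {p \<in> inf_paths \<Lambda>. p (0, k) = y (0, k)} {p \<in> inf_paths \<Lambda>. p (0, k) = z (0, k)}"
    using k by (auto simp: disjnt_def)
  ultimately show "\<exists>U V. openin (path_top \<Lambda>) U \<and> openin (path_top \<Lambda>) V \<and> y \<in> U \<and> z \<in> V \<and> disjnt U V"
    using y z by blast
qed

lemma continuous_fst_Z: "continuous_map (Z_top \<Lambda>) (X_top \<Lambda>) fst"
  and continuous_snd_Z: "continuous_map (Z_top \<Lambda>) (path_top \<Lambda>) snd"
  unfolding Z_top_def
  by (auto intro: continuous_map_from_subtopology continuous_map_fst continuous_map_snd)

text \<open>A clopen set times a cylinder of shape \<open>k + 1\<close> keeps the segment of shape
  \<open>k + 1\<close> of \<open>xy\<close> fixed, and with it the value at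
  \<open>(0, k)\<close>.\<close>

lemma continuous_concat_X: "continuous_map (Z_top \<Lambda>) (path_top \<Lambda>) (\<lambda>(x, y). concat_X x y)"
  unfolding path_top_def
proof (rule continuous_on_generated_topo)
  let ?f = "\<lambda>(x, y). concat_X x y"
  show "?f ` topspace (Z_top \<Lambda>) \<subseteq> \<Union> {{y \<in> inf_paths \<Lambda>. y (0, k) = a} |k a. a \<in> mor \<Lambda>}"
    unfolding topology_generated_by_topspace[symmetric] path_top_def[symmetric] topspace_path_top topspace_Z
    using concat_X_path by auto
  fix U assume "U \<in> {{y \<in> inf_paths \<Lambda>. y (0, k) = a} |k a. a \<in> mor \<Lambda>}"
  then obtain k a where U: "U = {y \<in> inf_paths \<Lambda>. y (0, k) = a}" by blast
  show "openin (Z_top \<Lambda>) (?f -` U \<inter> topspace (Z_top \<Lambda>))"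
  proof (subst openin_subopen, intro ballI)
    fix p assume p: "p \<in> ?f -` U \<inter> topspace (Z_top \<Lambda>)"
    obtain x y where xy: "p = (x, y)" by (cases p)
    have Z: "(x, y) \<in> Z_set \<Lambda>" and a: "concat_X x y (0, k) = a" using p by (auto simp: xy topspace_Z U)
    have x: "x \<in> X_set \<Lambda>" and y: "y \<in> inf_paths \<Lambda>" using Z by (simp_all add: Z_set_iff)
    obtain S where S: "S \<in> clopens" "lies_in x S"
      "\<And>y' \<mu>. y' \<in> inf_paths \<Lambda> \<Longrightarrow> seg y' (k + 1) = seg y (k + 1) \<Longrightarrow> \<mu> \<in> S \<Longrightarrow>
        \<mu> \<in> src_set (path_tgt \<Lambda> y') \<Longrightarrow> seg (concat_path \<Lambda> \<mu> y') (k + 1) = seg (concat_X x y) (k + 1)"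
      using concat_X_clopen[OF Z] by metis
    let ?V = "{q \<in> topspace (Z_top \<Lambda>). fst q \<in> {x \<in> X_set \<Lambda>. lies_in x S}}
      \<inter> {q \<in> topspace (Z_top \<Lambda>). snd q \<in> {y' \<in> inf_paths \<Lambda>. y' (0, k + 1) = y (0, k + 1)}}"
    have "openin (Z_top \<Lambda>) ?V"
      by (intro openin_Int openin_continuous_map_preimage[OF continuous_fst_Z openin_lies_in[OF S(1)]]
          openin_continuous_map_preimage[OF continuous_snd_Z openin_cylinder] path_init(1)[OF y])
    moreover have "p \<in> ?V" using Z x y S(2) by (simp add: xy topspace_Z)
    moreover have "?V \<subseteq> ?f -` U \<inter> topspace (Z_top \<Lambda>)"
    proof
      fix q assume q: "q \<in> ?V"
      obtain x' y' where xy': "q = (x', y')" by (cases q)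
      have Z': "(x', y') \<in> Z_set \<Lambda>" and S': "lies_in x' S" and y': "y' \<in> inf_paths \<Lambda>" "y' (0, k + 1) = y (0, k + 1)"
        using q by (simp_all add: xy' topspace_Z)
      have "seg y' (k + 1) = seg y (k + 1)" using y'(2) by (simp add: seg_def)
      then have "seg (concat_X x' y') (k + 1) = seg (concat_X x y) (k + 1)"
        using concat_limit_segI[OF Z' concat_X[OF Z'] S(1) S'] S(3)[OF y'(1)] by metis
      then have "concat_X x' y' (0, k) = a"
        using path_init_eqI[OF concat_X_path[OF Z'] concat_X_path[OF Z]] a by simp
      then show "q \<in> ?f -` U \<inter> topspace (Z_top \<Lambda>)" using Z' concat_X_path[OF Z'] by (simp add: xy' topspace_Z U)
    qed
    ultimately show "\<exists>T. openin (Z_top \<Lambda>) T \<and> p \<in> T \<and> T \<subseteq> ?f -` U \<inter> topspace (Z_top \<Lambda>)" by blast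
  qed
qed

definition phi :: "'m point \<times> ('m, 'r) path \<Rightarrow> (enat ^ 'r) \<times> ('m, 'r) path" where
  "phi = (\<lambda>(x, y)\<in>Z_set \<Lambda>. (shape_X \<Lambda> x, concat_X x y))"

lemma phi_eq: "(x, y) \<in> Z_set \<Lambda> \<Longrightarrow> phi (x, y) = (shape_X \<Lambda> x, concat_X x y)"
  by (simp add: phi_def)

lemma is_phi_phi: "is_phi \<Lambda> phi"
  unfolding is_phi_def is_cont_ext_def topspace_Z
proof (intro conjI ballI)
  show "phi \<in> extensional (Z_set \<Lambda>)" by (simp add: phi_def)
  have "continuous_map (X_top \<Lambda>) euclidean (shape_X \<Lambda>)" using shape_X_cont_ext by (simp add: is_cont_ext_def)
  from continuous_map_compose[OF continuous_fst_Z this]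
  have "continuous_map (Z_top \<Lambda>) euclidean (\<lambda>p. shape_X \<Lambda> (fst p))" by (simp add: o_def)
  then have "continuous_map (Z_top \<Lambda>) (prod_topology euclidean (path_top \<Lambda>))
      (\<lambda>p. (shape_X \<Lambda> (fst p), (\<lambda>(x, y). concat_X x y) p))"
    by (rule continuous_map_pairedI) (rule continuous_concat_X)
  then show "continuous_map (Z_top \<Lambda>) (prod_topology euclidean (path_top \<Lambda>)) phi"
    by (rule continuous_map_eq) (auto simp: topspace_Z phi_eq)
next
  fix i assume "i \<in> {(\<mu>, y). \<mu> \<in> bar \<and> (pt \<Lambda> \<mu>, y) \<in> Z_set \<Lambda>}"
  then obtain \<mu> y where "i = (\<mu>, y)" "\<mu> \<in> bar" "(pt \<Lambda> \<mu>, y) \<in> Z_set \<Lambda>" by blast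
  then show "phi (case i of (\<mu>, y) \<Rightarrow> (pt \<Lambda> \<mu>, y)) =
      (case i of (\<mu>, y) \<Rightarrow> (enat_vec (shape_bar \<Lambda> \<mu>), concat_path \<Lambda> \<mu> y))"
    using shape_X_cont_ext by (simp add: phi_eq concat_X_pt is_cont_ext_def)
qed

text \<open>Only the first coordinate is approximated. The localized form of
  \<open>pt_dense\<close>, applied to the elements composable with \<open>y\<close>, keeps the
  approximating pair in \<open>Z_set\<close>.\<close>

lemma Z_dense:
  "topspace (Z_top \<Lambda>) \<subseteq> Z_top \<Lambda> closure_of
    ((\<lambda>(\<mu>, y). (pt \<Lambda> \<mu>, y)) ` {(\<mu>, y). \<mu> \<in> bar \<and> (pt \<Lambda> \<mu>, y) \<in> Z_set \<Lambda>})"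
proof
  fix p assume "p \<in> topspace (Z_top \<Lambda>)"
  then obtain x y where p: "p = (x, y)" "(x, y) \<in> Z_set \<Lambda>" by (cases p) (auto simp: topspace_Z)
  have y: "y \<in> inf_paths \<Lambda>" and xs: "lies_in x (src_set (path_tgt \<Lambda> y))" using p by (simp_all add: Z_set_iff)
  show "p \<in> Z_top \<Lambda> closure_of ((\<lambda>(\<mu>, y). (pt \<Lambda> \<mu>, y)) ` {(\<mu>, y). \<mu> \<in> bar \<and> (pt \<Lambda> \<mu>, y) \<in> Z_set \<Lambda>})"
    unfolding in_closure_of topspace_Z
  proof (intro conjI allI impI)
    show "p \<in> Z_set \<Lambda>" using p by simp
    fix T assume "p \<in> T \<and> openin (Z_top \<Lambda>) T"
    then obtain W where W: "openin (prod_topology (X_top \<Lambda>) (path_top \<Lambda>)) W" "T = W \<inter> Z_set \<Lambda>" "(x, y) \<in> W"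
      using p by (auto simp: Z_top_def openin_subtopology)
    then obtain U V where UV: "openin (X_top \<Lambda>) U" "x \<in> U" "y \<in> V" "U \<times> V \<subseteq> W"
      unfolding openin_prod_topology_alt by metis
    obtain \<mu> where \<mu>: "\<mu> \<in> src_set (path_tgt \<Lambda> y)" "pt \<Lambda> \<mu> \<in> U"
      using pt_dense[OF UV(1,2) src_set_clopen[OF path_tgt_obj[OF y]] xs] by blast
    then have "\<mu> \<in> bar" by (simp add: src_set_def)
    then show "\<exists>q. q \<in> (\<lambda>(\<mu>, y). (pt \<Lambda> \<mu>, y)) ` {(\<mu>, y). \<mu> \<in> bar \<and> (pt \<Lambda> \<mu>, y) \<in> Z_set \<Lambda>} \<and> q \<in> T"
      using \<mu> UV W(2) y by (intro exI[of _ "(pt \<Lambda> \<mu>, y)"]) (auto simp: pt_Z)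
  qed
qed

lemma is_phi_iff: "is_phi \<Lambda> \<phi> \<longleftrightarrow> \<phi> = phi"
  using is_phi_phi cont_ext_unique[OF Z_dense, of "prod_topology euclidean (path_top \<Lambda>)"]
    Hausdorff_enat_vec Hausdorff_path_top
  unfolding is_phi_def by (auto simp: Hausdorff_space_prod_topology)


section \<open>Equivariance\<close>

text \<open>The source of unique factorization on the spectrum. The ranges are disjoint clopen sets,
  so \<open>x\<close> lies in exactly one, which fixes \<open>b\<close>; the injectivity recorded in
  \<open>induced\<close> then fixes \<open>x'\<close>.\<close>

lemma induced_factor_ex1:
  assumes "finite B" "B \<noteq> {}" and ind: "\<And>b. b \<in> B \<Longrightarrow> induced (d b) (p b) (M b)"
    and disj: "\<And>b b' \<mu> \<mu>'. \<lbrakk>b \<in> B; b' \<in> B; \<mu> \<in> d b; \<mu>' \<in> d b'; p b \<mu> = p b' \<mu>'\<rbrakk> \<Longrightarrow> b = b'"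
    and x: "x \<in> X_set \<Lambda>" "lies_in x (\<Union>b\<in>B. p b ` d b)"
  shows "\<exists>!(b, x'). b \<in> B \<and> x' \<in> X_set \<Lambda> \<and> lies_in x' (d b) \<and> M b x' = x"
proof -
  have d: "d b \<in> clopens" "p b ` d b \<in> clopens" if "b \<in> B" for b
    using ind[OF that] by (auto simp: induced_def)
  obtain b where b: "b \<in> B" "lies_in x (p b ` d b)"
    using lies_in_UN[OF x(1) assms(1,2) _ x(2)] d(2) by blast
  then obtain x' where x': "x' \<in> X_set \<Lambda>" "lies_in x' (d b)" "M b x' = x"
    using ind[OF b(1)] x(1) unfolding induced_def by blast
  have unique: "c = b \<and> u = x'" if c: "c \<in> B" "u \<in> X_set \<Lambda>" "lies_in u (d c)" "M c u = x" for c u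
  proof -
    have "lies_in x (p c ` d c)" using induced_image(2)[OF ind[OF c(1)] d(1)[OF c(1)] order_refl c(2,3)] c(3,4) by simp
    then have "lies_in x (p c ` d c \<inter> p b ` d b)" using b d c(1) by (simp add: lies_in_Int[OF x(1)])
    then obtain \<nu> where "\<nu> \<in> p c ` d c" "\<nu> \<in> p b ` d b" using lies_in_nonempty[OF x(1)] by blast
    then have cb: "c = b" using disj b(1) c(1) by blast
    have "inj_on (M b) {x \<in> X_set \<Lambda>. lies_in x (d b)}" using ind[OF b(1)] unfolding induced_def by blast
    then have "u = x'" using c x' cb by (auto dest: inj_onD)
    then show ?thesis using cb by simp
  qed
  show ?thesis
  proof (rule ex1I)
    show "case (b, x') of (b, x') \<Rightarrow> b \<in> B \<and> x' \<in> X_set \<Lambda> \<and> lies_in x' (d b) \<and> M b x' = x"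
      using b(1) x' by simp
    fix q assume "case q of (b, x') \<Rightarrow> b \<in> B \<and> x' \<in> X_set \<Lambda> \<and> lies_in x' (d b) \<and> M b x' = x"
    then show "q = (b, x')" using unique[of "fst q" "snd q"] by (simp add: case_prod_beta prod_eq_iff)
  qed
qed

lemma left_fact_ex1:
  assumes x: "x \<in> X_set \<Lambda>" "lies_in x (shape_ge m)"
  shows "\<exists>!(a, x1). is_left_fact \<Lambda> m x a x1"
proof -
  have "\<exists>!(a, x1). a \<in> bar_of_shape m \<and> x1 \<in> X_set \<Lambda> \<and> lies_in x1 (left_ext a) \<and> l_map \<Lambda> a x1 = x"
  proof (rule induced_factor_ex1[OF bar_of_shape_finite bar_of_shape_nonempty, where p = "cmp_bar \<Lambda>"])
    show "induced (left_ext a) (cmp_bar \<Lambda> a) (l_map \<Lambda> a)" if "a \<in> bar_of_shape m" for a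
      using that by (simp add: bar_of_shape_def induced_l_map)
    show "a = a'" if "a \<in> bar_of_shape m" "a' \<in> bar_of_shape m" "\<mu> \<in> left_ext a" "\<mu>' \<in> left_ext a'"
      "cmp_bar \<Lambda> a \<mu> = cmp_bar \<Lambda> a' \<mu>'" for a a' \<mu> \<mu>'
      using that bar_factorization_cancel(1)[of a \<mu> a' \<mu>'] by (simp add: bar_of_shape_def left_ext_def)
    show "lies_in x (\<Union>a\<in>bar_of_shape m. cmp_bar \<Lambda> a ` left_ext a)"
      using x(2) by (simp add: shape_ge_left left_range_def)
  qed (rule x(1))
  moreover have "is_left_fact \<Lambda> m x a x1 \<longleftrightarrow>
      a \<in> bar_of_shape m \<and> x1 \<in> X_set \<Lambda> \<and> lies_in x1 (left_ext a) \<and> l_map \<Lambda> a x1 = x" for a x1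
    using l_dom_iff by (auto simp: is_left_fact_def bar_of_shape_def)
  ultimately show ?thesis by simp
qed

lemma right_fact_ex1:
  assumes x: "x \<in> X_set \<Lambda>" "lies_in x (shape_ge m)"
  shows "\<exists>!(b, x2). is_right_fact \<Lambda> m x x2 b"
proof -
  have "\<exists>!(b, x2). b \<in> bar_of_shape m \<and> x2 \<in> X_set \<Lambda> \<and> lies_in x2 (right_ext b) \<and> r_map \<Lambda> b x2 = x"
  proof (rule induced_factor_ex1[OF bar_of_shape_finite bar_of_shape_nonempty, where p = "\<lambda>b \<mu>. cmp_bar \<Lambda> \<mu> b"])
    show "induced (right_ext a) (\<lambda>\<mu>. cmp_bar \<Lambda> \<mu> a) (r_map \<Lambda> a)" if "a \<in> bar_of_shape m" for a
      using that by (simp add: bar_of_shape_def induced_r_map)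
    show "a = a'" if "a \<in> bar_of_shape m" "a' \<in> bar_of_shape m" "\<mu> \<in> right_ext a" "\<mu>' \<in> right_ext a'"
      "cmp_bar \<Lambda> \<mu> a = cmp_bar \<Lambda> \<mu>' a'" for a a' \<mu> \<mu>'
      using that bar_factorization_cancel(2)[of \<mu> a \<mu>' a'] by (simp add: bar_of_shape_def right_ext_def)
    show "lies_in x (\<Union>a\<in>bar_of_shape m. (\<lambda>\<mu>. cmp_bar \<Lambda> \<mu> a) ` right_ext a)"
      using x(2) by (simp add: shape_ge_right right_range_def)
  qed (rule x(1))
  moreover have "is_right_fact \<Lambda> m x x2 b \<longleftrightarrow>
      b \<in> bar_of_shape m \<and> x2 \<in> X_set \<Lambda> \<and> lies_in x2 (right_ext b) \<and> r_map \<Lambda> b x2 = x" for b x2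
    using r_dom_iff by (auto simp: is_right_fact_def bar_of_shape_def)
  ultimately show ?thesis by simp
qed

text \<open>Comparing thresholds serves both the subtraction in \<open>T_map\<close> and the
  cancellation of \<open>m\<close> in \<open>V_map\<close>.\<close>

lemma induced_shape:
  assumes ind: "induced d p M" and x: "x \<in> X_set \<Lambda>" "lies_in x d"
    and shape: "\<And>\<mu>. \<mu> \<in> d \<Longrightarrow> shape_bar \<Lambda> (p \<mu>) = shape_bar \<Lambda> \<mu> + m"
  shows "enat (n + m $ i) \<le> shape_X \<Lambda> (M x) $ i \<longleftrightarrow> enat n \<le> shape_X \<Lambda> x $ i"
proof -
  have d: "d \<in> clopens" "p ` d \<subseteq> bar" using ind by (simp_all add: induced_def)
  have "{\<mu> \<in> d. p \<mu> \<in> shape_ge (axis i (n + m $ i))} = d \<inter> shape_ge (axis i n)"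
    using d clopens_bar[OF d(1)] by (auto simp: shape_ge_axis shape subset_iff)
  then show ?thesis
    using induced_lies_in(2)[OF ind x shape_ge_clopen] lies_in_Int[OF x(1) d(1) shape_ge_clopen] x(2)
    by (simp add: shape_X_ge_enat x(1) induced_X[OF ind x])
qed

lemma src_set_of_cmp_bar:
  assumes "\<mu> \<in> bar" "b \<in> bar" "composable_bar \<Lambda> \<mu> b" "cmp_bar \<Lambda> \<mu> b \<in> src_set v"
  shows "b \<in> src_set v"
  using assms by (cases \<mu>; cases b) (auto simp: src_set_def Some_bar src_cmp)

text \<open>A clopen set around \<open>x'\<close> on which a segment is constant is pushed forward
  by right multiplication with \<open>b\<close>; by \<open>induced_image\<close> the result is a
  clopen set around \<open>x\<close>.\<close>

lemma T_map_phi: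
  assumes Z: "(x, y) \<in> Z_set \<Lambda>" and m: "enat_vec m \<le> shape_X \<Lambda> x"
  obtains x' y' where "T_map \<Lambda> m (x, y) = Some (x', y')" "(x', y') \<in> Z_set \<Lambda>"
    "phi (x', y') = (shape_X \<Lambda> x - enat_vec m, concat_X x y)"
proof -
  have x: "x \<in> X_set \<Lambda>" and y: "y \<in> inf_paths \<Lambda>" and xs: "lies_in x (src_set (path_tgt \<Lambda> y))"
    using Z by (simp_all add: Z_set_iff)
  have "lies_in x (shape_ge m)" using m shape_X_ge[OF x] by simp
  then have ex1: "\<exists>!(b, x'). is_right_fact \<Lambda> m x x' b" by (rule right_fact_ex1[OF x])
  then obtain b x' where fact: "is_right_fact \<Lambda> m x x' b" by auto
  have "(THE (x', b). is_right_fact \<Lambda> m x x' b) = (x', b)"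
    using ex1 fact by (intro the_equality) auto
  then have T: "T_map \<Lambda> m (x, y) = Some (x', concat_path \<Lambda> b y)"
    using Z m by (simp add: T_map_def partial_on_def)
  have b: "b \<in> bar" "shape_bar \<Lambda> b = m" and xb: "r_map \<Lambda> b x' = x"
    using fact by (simp_all add: is_right_fact_def)
  have x': "x' \<in> X_set \<Lambda>" "lies_in x' (right_ext b)" using fact r_dom_iff[OF b(1)] by (simp_all add: is_right_fact_def)
  note ind = induced_r_map[OF b(1)]
  have sc: "src_set (path_tgt \<Lambda> y) \<in> clopens" by (rule src_set_clopen[OF path_tgt_obj[OF y]])
  \<comment> \<open>That \<open>b\<close> is composable with \<open>y\<close> is read off from a
    single \<mu> near \<open>x'\<close>: \<mu>b lies in the source set of \<open>y\<close>, and
    \<mu>b has the source of \<open>b\<close> unless b = \<Omega>.\<close>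
  have "lies_in x' {\<mu> \<in> right_ext b. cmp_bar \<Lambda> \<mu> b \<in> src_set (path_tgt \<Lambda> y)}"
    using induced_lies_in(2)[OF ind x' sc] xs xb by simp
  then obtain \<mu> where "\<mu> \<in> right_ext b" "cmp_bar \<Lambda> \<mu> b \<in> src_set (path_tgt \<Lambda> y)"
    using lies_in_nonempty[OF x'(1)] by blast
  then have bs: "b \<in> src_set (path_tgt \<Lambda> y)" using src_set_of_cmp_bar[of \<mu> b] b(1) by (auto simp: right_ext_def)
  note by_path = concat_inf_paths[OF y bs]
  have Z': "(x', concat_path \<Lambda> b y) \<in> Z_set \<Lambda>"
  proof (cases b)
    case None
    then show ?thesis using Z xb by simp
  next
    case (Some c)
    then show ?thesis
      using x' by_path path_tgt_concat[OF y, of c] bs by (simp add: Z_set_iff right_ext_Some)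
  qed
  have "concat_X x' (concat_path \<Lambda> b y) = concat_X x y"
  proof (rule seg_eqI[OF concat_X_path[OF Z'] concat_X_path[OF Z], of 0])
    fix k
    obtain S where S: "S \<in> clopens" "lies_in x' S"
      "\<And>\<mu>. \<mu> \<in> S \<Longrightarrow> \<mu> \<in> src_set (path_tgt \<Lambda> (concat_path \<Lambda> b y)) \<Longrightarrow>
        seg (concat_path \<Lambda> \<mu> (concat_path \<Lambda> b y)) (0 + k) = seg (concat_X x' (concat_path \<Lambda> b y)) (0 + k)"
      using concat_X_clopen[OF Z'] by_path by metis
    have Sr: "S \<inter> right_ext b \<in> clopens" "lies_in x' (S \<inter> right_ext b)"
      using S x' right_ext_clopen[OF b(1)] by (simp_all add: clopens_Int lies_in_Int[OF x'(1)])
    have img: "(\<lambda>\<mu>. cmp_bar \<Lambda> \<mu> b) ` (S \<inter> right_ext b) \<in> clopens" "lies_in x ((\<lambda>\<mu>. cmp_bar \<Lambda> \<mu> b) ` (S \<inter> right_ext b))"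
      using induced_image[OF ind Sr(1) Int_lower2] x' Sr(2) xb by auto
    have "seg (concat_X x y) (0 + k) = seg (concat_X x' (concat_path \<Lambda> b y)) (0 + k)"
    proof (rule concat_limit_segI[OF Z concat_X[OF Z] img])
      fix \<nu> assume "\<nu> \<in> (\<lambda>\<mu>. cmp_bar \<Lambda> \<mu> b) ` (S \<inter> right_ext b)" and \<nu>: "\<nu> \<in> src_set (path_tgt \<Lambda> y)"
      then obtain \<mu> where \<mu>: "\<mu> \<in> S" "\<mu> \<in> right_ext b" "\<nu> = cmp_bar \<Lambda> \<mu> b" by blast
      then show "seg (concat_path \<Lambda> \<nu> y) (0 + k) = seg (concat_X x' (concat_path \<Lambda> b y)) (0 + k)"
        using S(3)[OF \<mu>(1)] concat_concat[OF y bs \<mu>(2)] \<nu> by metis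
    qed
    then show "seg (concat_X x' (concat_path \<Lambda> b y)) (0 + k) = seg (concat_X x y) (0 + k)" by simp
  qed
  moreover have "shape_X \<Lambda> x' = shape_X \<Lambda> x - enat_vec m"
    unfolding vec_eq_iff
  proof (intro allI enat_eqI_le)
    fix i n
    have "enat (m $ i) \<le> shape_X \<Lambda> x $ i" using m by (simp add: less_eq_vec_def enat_vec_def)
    moreover have "enat (n + m $ i) \<le> shape_X \<Lambda> x $ i \<longleftrightarrow> enat n \<le> shape_X \<Lambda> x' $ i"
      using induced_shape[OF ind x', of m n i] b xb by (simp add: right_ext_def cmp_bar_bar)
    ultimately show "enat n \<le> shape_X \<Lambda> x' $ i \<longleftrightarrow> enat n \<le> (shape_X \<Lambda> x - enat_vec m) $ i"
      by (simp add: enat_vec_def le_enat_minus_iff)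
  qed
  ultimately show thesis using that[OF T Z'] phi_eq[OF Z'] by simp
qed

text \<open>With b = y(0, m), the points \<open>x\<close> and \<open>x1\<close> are related only
  through the equation xb = a x1. Clopen sets travel from \<open>x1\<close> to xb as images under
  left multiplication by \<open>a\<close>, and on to \<open>x\<close> as preimages under right
  multiplication by \<open>b\<close>.\<close>

lemma V_map_phi:
  assumes Z: "(x, y) \<in> Z_set \<Lambda>"
  obtains x' y' where "V_map \<Lambda> m (x, y) = Some (x', y')" "(x', y') \<in> Z_set \<Lambda>"
    "phi (x', y') = (shape_X \<Lambda> x, path_shift m (concat_X x y))"
proof -
  have x: "x \<in> X_set \<Lambda>" and y: "y \<in> inf_paths \<Lambda>" and xs: "lies_in x (src_set (path_tgt \<Lambda> y))"
    using Z by (simp_all add: Z_set_iff)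
  let ?b = "seg y m" and ?y = "path_shift m y"
  have y': "?y \<in> inf_paths \<Lambda>" by (rule path_shift_inf_paths[OF y])
  have b: "?b \<in> bar" "shape_bar \<Lambda> ?b = m" using seg_bar[OF y] shape_seg[OF y] by auto
  have bs: "?b \<in> src_set (path_tgt \<Lambda> ?y)" by (rule seg_src_set[OF y])
  note indr = induced_r_map[OF b(1)]
  have xr: "lies_in x (right_ext ?b)"
    using lies_in_mono[OF x src_set_clopen[OF path_tgt_obj[OF y]] right_ext_clopen[OF b(1)]
        src_set_subset_right_ext[OF y] xs] .
  let ?xb = "r_map \<Lambda> ?b x"
  have xb: "?xb \<in> X_set \<Lambda>" by (rule induced_X[OF indr x xr])
  have "{\<mu> \<in> right_ext ?b. cmp_bar \<Lambda> \<mu> ?b \<in> shape_ge m} = right_ext ?b"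
    using b by (auto simp: right_ext_def shape_ge_def cmp_bar_bar nat_vec_le_add)
  then have "lies_in ?xb (shape_ge m)" using induced_lies_in(2)[OF indr x xr shape_ge_clopen] xr by simp
  then have ex1: "\<exists>!(a, x1). is_left_fact \<Lambda> m ?xb a x1" by (rule left_fact_ex1[OF xb])
  then obtain a x1 where fact: "is_left_fact \<Lambda> m ?xb a x1" by auto
  have "shift_X \<Lambda> m ?xb = x1" unfolding shift_X_def using ex1 fact by (intro the_equality) auto
  then have V: "V_map \<Lambda> m (x, y) = Some (x1, ?y)" using Z by (simp add: V_map_def partial_on_def seg_def)
  have a: "a \<in> bar" "shape_bar \<Lambda> a = m" and ax: "l_map \<Lambda> a x1 = ?xb"
    using fact by (simp_all add: is_left_fact_def)
  have x1: "x1 \<in> X_set \<Lambda>" "lies_in x1 (left_ext a)" using fact l_dom_iff[OF a(1)] by (simp_all add: is_left_fact_def)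
  note indl = induced_l_map[OF a(1)]
  have step: "{\<mu> \<in> right_ext ?b. cmp_bar \<Lambda> \<mu> ?b \<in> cmp_bar \<Lambda> a ` (S \<inter> left_ext a)} \<in> clopens \<and>
      (lies_in x {\<mu> \<in> right_ext ?b. cmp_bar \<Lambda> \<mu> ?b \<in> cmp_bar \<Lambda> a ` (S \<inter> left_ext a)} \<longleftrightarrow> lies_in x1 S)"
    if S: "S \<in> clopens" for S
  proof -
    have Sl: "S \<inter> left_ext a \<in> clopens" "lies_in x1 (S \<inter> left_ext a) \<longleftrightarrow> lies_in x1 S"
      using S x1(2) left_ext_clopen[OF a(1)] by (simp_all add: clopens_Int lies_in_Int[OF x1(1)])
    have img: "cmp_bar \<Lambda> a ` (S \<inter> left_ext a) \<in> clopens"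
      "lies_in ?xb (cmp_bar \<Lambda> a ` (S \<inter> left_ext a)) \<longleftrightarrow> lies_in x1 S"
      using induced_image(1)[OF indl Sl(1) Int_lower2] induced_image(2)[OF indl Sl(1) Int_lower2 x1] Sl(2) ax
      by auto
    show ?thesis using induced_lies_in[OF indr x xr img(1)] img(2) by simp
  qed
  have \<mu>b_src: "cmp_bar \<Lambda> \<mu> ?b \<in> src_set (path_tgt \<Lambda> ?y)"
    if "\<mu> \<in> right_ext ?b" "\<mu> \<in> src_set (path_tgt \<Lambda> y)" for \<mu>
  proof (cases ?b)
    case None
    then have "m = 0" using b by simp
    then have "?y = y" by (simp add: path_shift_def)
    then show ?thesis using None that(2) by simp
  next
    case (Some c)
    then show ?thesis using cmp_bar_src_set[of \<mu> c] that(1) bs by (simp add: right_ext_def)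
  qed
  have \<nu>_src: "\<nu> \<in> src_set (path_tgt \<Lambda> ?y)"
    if "\<mu> \<in> right_ext ?b" "cmp_bar \<Lambda> \<mu> ?b = cmp_bar \<Lambda> a \<nu>" "\<nu> \<in> left_ext a" "\<mu> \<in> src_set (path_tgt \<Lambda> y)" for \<mu> \<nu>
    by (rule src_set_of_cmp_bar[of a \<nu>])
      (use \<mu>b_src[OF that(1,4)] that(2,3) a(1) in \<open>auto simp: left_ext_def\<close>)
  \<comment> \<open>For \<mu> composable with \<open>y\<close>, the relation \<mu>b = a\<nu> puts
    \<nu> into the source set of the shifted path. Taken near \<open>x\<close>, this places
    \<open>x1\<close> in that set as well.\<close>
  have Z1: "(x1, ?y) \<in> Z_set \<Lambda>"
  proof -
    let ?S = "src_set (path_tgt \<Lambda> ?y)"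
    have S: "?S \<in> clopens" by (rule src_set_clopen[OF path_tgt_obj[OF y']])
    have "lies_in x {\<mu> \<in> right_ext ?b. cmp_bar \<Lambda> \<mu> ?b \<in> cmp_bar \<Lambda> a ` (?S \<inter> left_ext a)}"
    proof (rule lies_in_mono[OF x])
      have B: "bar \<inter> left_ext a = left_ext a" using left_ext_bar by blast
      have "lies_in x {\<mu> \<in> right_ext ?b. cmp_bar \<Lambda> \<mu> ?b \<in> cmp_bar \<Lambda> a ` (bar \<inter> left_ext a)}"
        using step[OF bar_clopen] lies_in_bar[OF x1(1)] by blast
      then show "lies_in x ({\<mu> \<in> right_ext ?b. cmp_bar \<Lambda> \<mu> ?b \<in> cmp_bar \<Lambda> a ` left_ext a} \<inter> src_set (path_tgt \<Lambda> y))"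
        and "{\<mu> \<in> right_ext ?b. cmp_bar \<Lambda> \<mu> ?b \<in> cmp_bar \<Lambda> a ` left_ext a} \<inter> src_set (path_tgt \<Lambda> y) \<in> clopens"
        using lies_in_path_src[OF Z] step[OF bar_clopen] by (simp_all add: B)
      show "{\<mu> \<in> right_ext ?b. cmp_bar \<Lambda> \<mu> ?b \<in> cmp_bar \<Lambda> a ` left_ext a} \<inter> src_set (path_tgt \<Lambda> y)
          \<subseteq> {\<mu> \<in> right_ext ?b. cmp_bar \<Lambda> \<mu> ?b \<in> cmp_bar \<Lambda> a ` (?S \<inter> left_ext a)}"
        using \<nu>_src by blast
    qed (use step[OF S] in blast)
    then show ?thesis using step[OF S] x1 y' by (simp add: Z_set_iff)
  qed
  have "concat_X x1 ?y = path_shift m (concat_X x y)"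
  proof (rule seg_eqI[OF concat_X_path[OF Z1] path_shift_inf_paths[OF concat_X_path[OF Z]], of 0])
    fix k
    obtain S where S: "S \<in> clopens" "lies_in x1 S"
      "\<And>\<nu>. \<nu> \<in> S \<Longrightarrow> \<nu> \<in> src_set (path_tgt \<Lambda> ?y) \<Longrightarrow> seg (concat_path \<Lambda> \<nu> ?y) k = seg (concat_X x1 ?y) k"
      using concat_X_clopen[OF Z1] y' by metis
    let ?S = "{\<mu> \<in> right_ext ?b. cmp_bar \<Lambda> \<mu> ?b \<in> cmp_bar \<Lambda> a ` (S \<inter> left_ext a)}"
    \<comment> \<open>Composability is proved alongside because the later cancellation of
      \<open>a\<close> needs it. It does not mention \<mu>, so one \<mu> near \<open>x\<close> is
      enough for it.\<close>
    have eq: "seg (concat_X x y) (m + k) = cmp_bar \<Lambda> a (seg (concat_X x1 ?y) k) \<and>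
        composable_bar \<Lambda> a (seg (concat_X x1 ?y) k)"
    proof -
      have "seg (concat_path \<Lambda> \<mu> y) (m + k) = cmp_bar \<Lambda> a (seg (concat_X x1 ?y) k) \<and>
          composable_bar \<Lambda> a (seg (concat_X x1 ?y) k)"
        if \<mu>: "\<mu> \<in> ?S" "\<mu> \<in> src_set (path_tgt \<Lambda> y)" for \<mu>
      proof -
        obtain \<nu> where \<nu>: "\<nu> \<in> S" "\<nu> \<in> left_ext a" "cmp_bar \<Lambda> \<mu> ?b = cmp_bar \<Lambda> a \<nu>" using \<mu>(1) by blast
        have \<nu>s: "\<nu> \<in> src_set (path_tgt \<Lambda> ?y)" using \<nu>_src[OF _ \<nu>(3,2) \<mu>(2)] \<mu>(1) by blast
        have a\<nu>: "a \<in> right_ext \<nu>" "cmp_bar \<Lambda> a \<nu> \<in> src_set (path_tgt \<Lambda> ?y)"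
          using \<nu>(2,3) a(1) \<mu>b_src[of \<mu>] \<mu> by (auto simp: left_ext_def right_ext_def)
        let ?v = "concat_path \<Lambda> \<nu> ?y"
        have v: "?v \<in> inf_paths \<Lambda>" "seg ?v k = seg (concat_X x1 ?y) k"
          using concat_inf_paths[OF y' \<nu>s] S(3)[OF \<nu>(1) \<nu>s] by auto
        have av: "a \<in> src_set (path_tgt \<Lambda> ?v)" by (rule concat_concat(1)[OF y' \<nu>s a\<nu>])
        \<comment> \<open>The path \<open>y\<close> is split into its segment \<open>?b\<close> and
          the shifted path; \<mu>b is then regrouped as a\<nu>.\<close>
        have "concat_path \<Lambda> \<mu> y = concat_path \<Lambda> (cmp_bar \<Lambda> \<mu> ?b) ?y"
          using concat_concat(2)[OF y' bs, of \<mu>] \<mu> \<mu>b_src[of \<mu>] concat_seg_shift[OF y] by simp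
        also have "\<dots> = concat_path \<Lambda> a ?v" using concat_concat(2)[OF y' \<nu>s a\<nu>] \<nu>(3) by simp
        finally show ?thesis
          using seg_concat[OF v(1) av, of k] src_set_composable_seg[OF v(1) av, of k] v(2) a(2) by simp
      qed
      moreover have SS: "?S \<in> clopens" "lies_in x ?S" using step[OF S(1)] S(2) by blast+
      moreover obtain \<mu> where "\<mu> \<in> ?S" "\<mu> \<in> src_set (path_tgt \<Lambda> y)"
        using lies_in_nonempty[OF x lies_in_path_src(2)[OF Z SS]] by blast
      ultimately show ?thesis using concat_limit_segI[OF Z concat_X[OF Z] SS, of "m + k"] by blast
    qed
    let ?X = "concat_X x y"
    have X: "?X \<in> inf_paths \<Lambda>" by (rule concat_X_path[OF Z])
    \<comment> \<open>Both sides complete an initial factor of shape \<open>m\<close> to the same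
      segment of \<open>xy\<close>.\<close>
    have "seg (concat_X x1 ?y) k = seg (path_shift m ?X) k"
    proof (rule bar_factorization_cancel(2)[OF a(1) _ _ seg_bar[OF X, of m]])
      show "cmp_bar \<Lambda> a (seg (concat_X x1 ?y) k) = cmp_bar \<Lambda> (seg ?X m) (seg (path_shift m ?X) k)"
        using eq seg_add(2)[OF X] by metis
    qed (use eq seg_bar[OF concat_X_path[OF Z1]] seg_bar[OF path_shift_inf_paths[OF X]] seg_add(1)[OF X]
        shape_seg[OF X] a(2) in auto)
    then show "seg (concat_X x1 ?y) (0 + k) = seg (path_shift m (concat_X x y)) (0 + k)" by simp
  qed
  \<comment> \<open>Both \<open>x\<close> and \<open>x1\<close> gain \<open>m\<close> in shape on
    passing to the common point xb = a x1. Comparing thresholds cancels \<open>m\<close> at infinite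
    coordinates too.\<close>
  moreover have "shape_X \<Lambda> x1 = shape_X \<Lambda> x"
    unfolding vec_eq_iff
  proof (intro allI enat_eqI_le)
    fix i n
    have "enat (n + m $ i) \<le> shape_X \<Lambda> ?xb $ i \<longleftrightarrow> enat n \<le> shape_X \<Lambda> x $ i"
      using induced_shape[OF indr x xr, of m n i] b by (simp add: right_ext_def cmp_bar_bar)
    moreover have "enat (n + m $ i) \<le> shape_X \<Lambda> ?xb $ i \<longleftrightarrow> enat n \<le> shape_X \<Lambda> x1 $ i"
      using induced_shape[OF indl x1, of m n i] a ax by (simp add: left_ext_def cmp_bar_bar add.commute)
    ultimately show "enat n \<le> shape_X \<Lambda> x1 $ i \<longleftrightarrow> enat n \<le> shape_X \<Lambda> x $ i" by simp
  qed
  ultimately show thesis using that[OF V Z1] phi_eq[OF Z1] by simp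
qed

text \<open>The domains agree because the first coordinate of \<open>phi\<close> is the very shape
  tested by \<open>T_map\<close>.\<close>

lemma phi_T_map:
  "partial_on (Z_set \<Lambda>) phi \<circ>\<^sub>m T_map \<Lambda> k =
    partial_prod (S_map k) (partial_on (inf_paths \<Lambda>) id) \<circ>\<^sub>m partial_on (Z_set \<Lambda>) phi"
proof
  fix p :: "'m point \<times> ('m, 'r) path"
  obtain x y where p: "p = (x, y)" by (cases p)
  show "(partial_on (Z_set \<Lambda>) phi \<circ>\<^sub>m T_map \<Lambda> k) p =
    (partial_prod (S_map k) (partial_on (inf_paths \<Lambda>) id) \<circ>\<^sub>m partial_on (Z_set \<Lambda>) phi) p"
  proof (cases "(x, y) \<in> Z_set \<Lambda>")
    case False
    then show ?thesis by (simp add: p map_comp_def partial_on_def T_map_def)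
  next
    case Z: True
    show ?thesis
    proof (cases "enat_vec k \<le> shape_X \<Lambda> x")
      case False
      then show ?thesis
        using Z by (simp add: p map_comp_def partial_on_def T_map_def phi_eq S_map_def partial_prod_def)
    next
      case True
      obtain x' y' where "T_map \<Lambda> k (x, y) = Some (x', y')" "(x', y') \<in> Z_set \<Lambda>"
        "phi (x', y') = (shape_X \<Lambda> x - enat_vec k, concat_X x y)"
        using T_map_phi[OF Z True] .
      then show ?thesis
        using Z True concat_X_path[OF Z]
        by (simp add: p map_comp_def partial_on_def phi_eq S_map_def partial_prod_def)
    qed
  qed
qed

lemma phi_V_map:
  "partial_on (Z_set \<Lambda>) phi \<circ>\<^sub>m V_map \<Lambda> k =
    partial_prod Some (W_map \<Lambda> k) \<circ>\<^sub>m partial_on (Z_set \<Lambda>) phi"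
proof
  fix p :: "'m point \<times> ('m, 'r) path"
  obtain x y where p: "p = (x, y)" by (cases p)
  show "(partial_on (Z_set \<Lambda>) phi \<circ>\<^sub>m V_map \<Lambda> k) p =
    (partial_prod Some (W_map \<Lambda> k) \<circ>\<^sub>m partial_on (Z_set \<Lambda>) phi) p"
  proof (cases "(x, y) \<in> Z_set \<Lambda>")
    case False
    then show ?thesis by (simp add: p map_comp_def partial_on_def V_map_def)
  next
    case Z: True
    obtain x' y' where "V_map \<Lambda> k (x, y) = Some (x', y')" "(x', y') \<in> Z_set \<Lambda>"
      "phi (x', y') = (shape_X \<Lambda> x, path_shift k (concat_X x y))"
      using V_map_phi[OF Z] .
    then show ?thesis
      using Z concat_X_path[OF Z] by (simp add: p map_comp_def partial_on_def phi_eq W_map_def partial_prod_def)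
  qed
qed

lemma equivariant_phi:
  "equivariant (\<lambda>(k, k'). T_map \<Lambda> k \<circ>\<^sub>m V_map \<Lambda> k')
    (\<lambda>(k, k'). partial_prod (S_map k) (W_map \<Lambda> k')) (Z_set \<Lambda>) phi"
  unfolding equivariant_def
proof (intro allI, clarify)
  fix k k' :: "nat ^ 'r"
  have assoc: "f \<circ>\<^sub>m (g \<circ>\<^sub>m h) = (f \<circ>\<^sub>m g) \<circ>\<^sub>m h"
    for f :: "'c \<rightharpoonup> 'd" and g :: "'b \<rightharpoonup> 'c" and h :: "'a \<rightharpoonup> 'b"
    by (auto simp: map_comp_def fun_eq_iff split: option.splits)
  \<comment> \<open>Restricting the identity to \<open>inf_paths\<close> does not shrink the domain,
    since shifted paths are again in \<open>inf_paths\<close>.\<close>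
  have prod: "partial_prod (S_map k) (partial_on (inf_paths \<Lambda>) id) \<circ>\<^sub>m partial_prod Some (W_map \<Lambda> k')
      = partial_prod (S_map k) (W_map \<Lambda> k')"
  proof
    fix p :: "(enat ^ 'r) \<times> ('m, 'r) path"
    obtain n y where p: "p = (n, y)" by (cases p)
    show "(partial_prod (S_map k) (partial_on (inf_paths \<Lambda>) id) \<circ>\<^sub>m partial_prod Some (W_map \<Lambda> k')) p
        = partial_prod (S_map k) (W_map \<Lambda> k') p"
      using path_shift_inf_paths[of y k']
      by (cases "y \<in> inf_paths \<Lambda>"; cases "S_map k n")
        (simp_all add: p map_comp_def partial_prod_def W_map_def partial_on_def)
  qed
  let ?phi = "partial_on (Z_set \<Lambda>) phi"
    and ?P = "partial_prod (S_map k) (partial_on (inf_paths \<Lambda>) id)"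
  have "?phi \<circ>\<^sub>m (T_map \<Lambda> k \<circ>\<^sub>m V_map \<Lambda> k') = (?phi \<circ>\<^sub>m T_map \<Lambda> k) \<circ>\<^sub>m V_map \<Lambda> k'" by (rule assoc)
  also have "\<dots> = (?P \<circ>\<^sub>m ?phi) \<circ>\<^sub>m V_map \<Lambda> k'" by (simp only: phi_T_map)
  also have "\<dots> = ?P \<circ>\<^sub>m (?phi \<circ>\<^sub>m V_map \<Lambda> k')" by (rule assoc[symmetric])
  also have "\<dots> = ?P \<circ>\<^sub>m (partial_prod Some (W_map \<Lambda> k') \<circ>\<^sub>m ?phi)" by (simp only: phi_V_map)
  also have "\<dots> = (?P \<circ>\<^sub>m partial_prod Some (W_map \<Lambda> k')) \<circ>\<^sub>m ?phi" by (rule assoc)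
  finally show "?phi \<circ>\<^sub>m (T_map \<Lambda> k \<circ>\<^sub>m V_map \<Lambda> k') = partial_prod (S_map k) (W_map \<Lambda> k') \<circ>\<^sub>m ?phi"
    by (simp only: prod)
qed

end

theorem proposition3p4:
  fixes \<Lambda> :: "('o, 'm, 'r::finite) rgraph"
  assumes "rank_graph \<Lambda>" and "condition_F \<Lambda>"
  shows "(\<exists>!\<phi>. is_phi \<Lambda> \<phi>) \<and>
    (\<forall>\<phi>. is_phi \<Lambda> \<phi> \<longrightarrow>
      equivariant (\<lambda>(k, k'). T_map \<Lambda> k \<circ>\<^sub>m V_map \<Lambda> k')
        (\<lambda>(k, k'). partial_prod (S_map k) (W_map \<Lambda> k')) (Z_set \<Lambda>) \<phi> \<and>
      (\<forall>k. partial_on (Z_set \<Lambda>) \<phi> \<circ>\<^sub>m T_map \<Lambda> k =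
           partial_prod (S_map k) (partial_on (inf_paths \<Lambda>) id) \<circ>\<^sub>m partial_on (Z_set \<Lambda>) \<phi>) \<and>
      (\<forall>k. partial_on (Z_set \<Lambda>) \<phi> \<circ>\<^sub>m V_map \<Lambda> k =
           partial_prod Some (W_map \<Lambda> k) \<circ>\<^sub>m partial_on (Z_set \<Lambda>) \<phi>))"
proof -
  interpret rank_graph_F \<Lambda> by (rule rank_graph_F.intro[OF assms])
  show ?thesis
    unfolding is_phi_iff using equivariant_phi phi_T_map phi_V_map by simp
qed

end
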